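(* Let $K$ be a Herbrand field and let $L/K$ be a finite field extension. Then there exists a unique tower $$L=L_1/L_2/\dots/L_n/L_{n+1}=K'/K$$ (that is, $L=L_1\supseteq L_2\supseteq\dots\supseteq L_{n+1}=K'\supseteq K$) such that: 1. The field extension $L_i/L_{i+1}$ is simply ramified for all $i=1,\dots,n$. 2. The field extension $K'/K$ has trivial (that is, identity) Herbrand function. 3. The decomposition $\mathbb{H}_{L/K}=\mathbb{H}_{L_n/L_{n+1}}\circ\dots\circ\mathbb{H}_{L_1/L_2}$ holds and is the canonical decomposition of $\mathbb{H}_{L/K}$ into simple factors, i.e. if $b_i\in(0,1)$ is the unique break-point of $\mathbb{H}_{L_i/L_{i+1}}$, then $\mathbb{H}_{L_i/L_{i+1}}(b_i)<b_{i+1}$ for $i=1,\dots,n-1$.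
   Context: A valued field is a field with a nontrivial nonarchimedean (multiplicative) norm $|\cdot|$; $L^\circ=\{x\in L: |x|\le 1\}$. It is henselian if its norm extends uniquely to every finite extension. Let $L/K$ be a finite Galois extension of valued fields, $K$ henselian, with group $G$. The inertia function is $i_G:G\to[0,1]$, $i_G(\sigma)=\sup_{t\in L^\circ}|\sigma(t)-t|$, and the Herbrand function is $\mathbb{H}_{L/K}:[0,1]\to[0,1]$, $\mathbb{H}_{L/K}(r)=\prod_{\sigma\in G}\max\{r,i_G(\sigma)\}$. A finite Galois extension $L/K$ of a henselian field $K$ with group $G$ is a Herbrand extension if for every normal subgroup $H\trianglelefteq G$, with $F=L^H$, one has $\mathbb{H}_{L/K}=\mathbb{H}_{F/K}\circ\mathbb{H}_{L/F}$. A finite extension $L/K$ is a Herbrand extension if its Galois closure over $K$ is. $K$ is a Herbrand field if every finite extension of $K$ is a Herbrand extension. For a finite, not necessarily Galois, extension $L/K$ one defines $\mathbb{H}_{L/K}:=\mathbb{H}_{M/K}\circ\mathbb{H}_{M/L}^{-1}$, where $M$ is a finite Galois extension of $K$ containing $L$. Convention: finite extensions of a Herbrand field are regarded as Herbrand fields as well, so for $K\subseteq E\subseteq F$ finite over $K$ the function $\mathbb{H}_{F/E}$ is likewise computed as $\mathbb{H}_{M/E}\circ\mathbb{H}_{M/F}^{-1}$ with $M$ finite Galois over $K$ containing $F$. These functions are continuous, strictly increasing, fix $0$ and $1$, and are piecewise of the form $r\mapsto a r^d$. A break-point is a point of $(0,1)$ where the function is not smooth; the degree of the function is the exponent $d$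 on the last interval (the one ending at $1$). The function is simple if it has exactly one break-point. A finite extension $F/E$ is simply ramified if $\mathbb{H}_{F/E}$ has exactly one break-point and its degree equals $[F:E]$. *)

theory Defs
  imports "HOL-Analysis.Analysis" "HOL-Algebra.Algebraic_Closure" "HOL-Algebra.Bij"
begin

text \<open>
  All fields are subfields of an ambient field \<open>\<Omega>\<close>, which is an algebraic closure of the base
  field (locale \<^locale>\<open>algebraic_closure\<close>).  Every finite extension of the base field is
  isomorphic to a subfield of \<open>\<Omega>\<close>, so quantifying over subfields of \<open>\<Omega>\<close> is
  quantifying over all finite extensions.
\<close>

definition finite_extension :: "('a, 'b) ring_scheme \<Rightarrow> 'a set \<Rightarrow> 'a set \<Rightarrow> bool" where
  "finite_extension \<Omega> K L \<longleftrightarrow>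
     subfield K \<Omega> \<and> subfield L \<Omega> \<and> K \<subseteq> L \<and> ring.finite_dimension \<Omega> K L"

text \<open>Separability of a minimal polynomial is tested on its roots in the algebraically closed
  field \<open>\<Omega>\<close>.\<close>

definition finite_separable_extension :: "('a, 'b) ring_scheme \<Rightarrow> 'a set \<Rightarrow> 'a set \<Rightarrow> bool" where
  "finite_separable_extension \<Omega> K L \<longleftrightarrow>
     finite_extension \<Omega> K L \<and>
     (\<forall>x\<in>L. \<forall>a\<in>carrier \<Omega>. ring.alg_mult \<Omega> (ring.Irr \<Omega> K x) a \<le> 1)"

text \<open>Finite, separable and normal.  The library's \<open>splitted_on\<close> cannot express normality here:
  it intersects the roots with \<open>mset_set M\<close>, which is empty for infinite \<open>M\<close>.\<close>

definition finite_galois_extension :: "('a, 'b) ring_scheme \<Rightarrow> 'a set \<Rightarrow> 'a set \<Rightarrow> bool" where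
  "finite_galois_extension \<Omega> K M \<longleftrightarrow>
     finite_separable_extension \<Omega> K M \<and>
     (\<forall>x\<in>M. \<forall>a. ring.is_root \<Omega> (ring.Irr \<Omega> K x) a \<longrightarrow> a \<in> M)"

definition galois_closure :: "('a, 'b) ring_scheme \<Rightarrow> 'a set \<Rightarrow> 'a set \<Rightarrow> 'a set" where
  "galois_closure \<Omega> K L = \<Inter> {M. finite_galois_extension \<Omega> K M \<and> L \<subseteq> M}"

text \<open>As in \<^const>\<open>AutoGroup\<close>, automorphisms are extensional functions on \<open>L\<close>.\<close>

definition gal :: "('a, 'b) ring_scheme \<Rightarrow> 'a set \<Rightarrow> 'a set \<Rightarrow> ('a \<Rightarrow> 'a) monoid" where
  "gal \<Omega> K L = BijGroup L
     \<lparr>carrier := {\<sigma> \<in> Bij L \<inter> ring_hom (\<Omega>\<lparr>carrier := L\<rparr>) (\<Omega>\<lparr>carrier := L\<rparr>). \<forall>x\<in>K. \<sigma> x = x}\<rparr>"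

definition fixed_field :: "'a set \<Rightarrow> ('a \<Rightarrow> 'a) set \<Rightarrow> 'a set" where
  "fixed_field L H = {x \<in> L. \<forall>\<sigma>\<in>H. \<sigma> x = x}"

definition valued_field :: "('a, 'b) ring_scheme \<Rightarrow> 'a set \<Rightarrow> ('a \<Rightarrow> real) \<Rightarrow> bool" where
  "valued_field \<Omega> K v \<longleftrightarrow>
     subfield K \<Omega> \<and>
     (\<forall>x\<in>K. 0 \<le> v x) \<and>
     (\<forall>x\<in>K. v x = 0 \<longleftrightarrow> x = \<zero>\<^bsub>\<Omega>\<^esub>) \<and>
     (\<forall>x\<in>K. \<forall>y\<in>K. v (x \<otimes>\<^bsub>\<Omega>\<^esub> y) = v x * v y) \<and>
     (\<forall>x\<in>K. \<forall>y\<in>K. v (x \<oplus>\<^bsub>\<Omega>\<^esub> y) \<le> max (v x) (v y)) \<and>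
     (\<exists>x\<in>K. x \<noteq> \<zero>\<^bsub>\<Omega>\<^esub> \<and> v x \<noteq> 1)"

definition norm_extension ::
  "('a, 'b) ring_scheme \<Rightarrow> 'a set \<Rightarrow> ('a \<Rightarrow> real) \<Rightarrow> 'a set \<Rightarrow> ('a \<Rightarrow> real) \<Rightarrow> bool" where
  "norm_extension \<Omega> K v L w \<longleftrightarrow>
     w \<in> extensional L \<and> valued_field \<Omega> L w \<and> (\<forall>x\<in>K. w x = v x)"

definition henselian :: "('a, 'b) ring_scheme \<Rightarrow> 'a set \<Rightarrow> ('a \<Rightarrow> real) \<Rightarrow> bool" where
  "henselian \<Omega> K v \<longleftrightarrow>
     valued_field \<Omega> K v \<and>
     (\<forall>L. finite_extension \<Omega> K L \<longrightarrow> (\<exists>!w. norm_extension \<Omega> K v L w))"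

text \<open>The norm of a finite extension \<open>L\<close> of a henselian field \<open>(K, v)\<close>.\<close>

definition ext_norm ::
  "('a, 'b) ring_scheme \<Rightarrow> 'a set \<Rightarrow> ('a \<Rightarrow> real) \<Rightarrow> 'a set \<Rightarrow> 'a \<Rightarrow> real" where
  "ext_norm \<Omega> K v L = (THE w. norm_extension \<Omega> K v L w)"

definition inertia ::
  "('a, 'b) ring_scheme \<Rightarrow> 'a set \<Rightarrow> ('a \<Rightarrow> real) \<Rightarrow> ('a \<Rightarrow> 'a) \<Rightarrow> real" where
  "inertia \<Omega> L w \<sigma> = (SUP t\<in>{t\<in>L. w t \<le> 1}. w (\<sigma> t \<ominus>\<^bsub>\<Omega>\<^esub> t))"

text \<open>Herbrand function of a Galois extension \<open>L\<close> of \<open>K\<close>, where \<open>w\<close> is the norm of \<open>L\<close>.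
  Herbrand functions are maps from \<open>[0,1]\<close> to itself; values outside that interval are
  irrelevant.\<close>

definition galois_herbrand ::
  "('a, 'b) ring_scheme \<Rightarrow> 'a set \<Rightarrow> 'a set \<Rightarrow> ('a \<Rightarrow> real) \<Rightarrow> real \<Rightarrow> real" where
  "galois_herbrand \<Omega> K L w r = (\<Prod>\<sigma>\<in>carrier (gal \<Omega> K L). max r (inertia \<Omega> L w \<sigma>))"

definition galois_herbrand_extension ::
  "('a, 'b) ring_scheme \<Rightarrow> 'a set \<Rightarrow> ('a \<Rightarrow> real) \<Rightarrow> 'a set \<Rightarrow> bool" where
  "galois_herbrand_extension \<Omega> K v L \<longleftrightarrow>
     finite_galois_extension \<Omega> K L \<and>
     (\<forall>H. H \<lhd> gal \<Omega> K L \<longrightarrow>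
        (let F = fixed_field L H; w = ext_norm \<Omega> K v L in
         \<forall>r\<in>{0..1}. galois_herbrand \<Omega> K L w r =
           galois_herbrand \<Omega> K F (ext_norm \<Omega> K v F) (galois_herbrand \<Omega> F L w r)))"

definition herbrand_extension ::
  "('a, 'b) ring_scheme \<Rightarrow> 'a set \<Rightarrow> ('a \<Rightarrow> real) \<Rightarrow> 'a set \<Rightarrow> bool" where
  "herbrand_extension \<Omega> K v L \<longleftrightarrow>
     finite_separable_extension \<Omega> K L \<and>
     galois_herbrand_extension \<Omega> K v (galois_closure \<Omega> K L)"

text \<open>Only separable extensions have a Galois closure, so ``finite extension'' is read as
  ``finite separable extension'' wherever Herbrand functions are involved.\<close>

definition herbrand_field :: "('a, 'b) ring_scheme \<Rightarrow> 'a set \<Rightarrow> ('a \<Rightarrow> real) \<Rightarrow> bool" where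
  "herbrand_field \<Omega> K v \<longleftrightarrow>
     henselian \<Omega> K v \<and>
     (\<forall>L. finite_separable_extension \<Omega> K L \<longrightarrow> herbrand_extension \<Omega> K v L)"

text \<open>\<open>herbrand \<Omega> K v E F\<close> is the Herbrand function of \<open>F\<close> over \<open>E\<close>, for a tower of finite
  separable extensions \<open>K \<subseteq> E \<subseteq> F\<close> of the Herbrand field \<open>(K, v)\<close>.  It is computed with an
  arbitrary finite Galois extension \<open>M\<close> of \<open>K\<close> containing \<open>F\<close>.\<close>

definition herbrand ::
  "('a, 'b) ring_scheme \<Rightarrow> 'a set \<Rightarrow> ('a \<Rightarrow> real) \<Rightarrow> 'a set \<Rightarrow> 'a set \<Rightarrow> real \<Rightarrow> real" where
  "herbrand \<Omega> K v E F =
     (let M = (SOME M. finite_galois_extension \<Omega> K M \<and> F \<subseteq> M); w = ext_norm \<Omega> K v M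
      in galois_herbrand \<Omega> E M w \<circ> inv_into {0..1} (galois_herbrand \<Omega> F M w))"

definition smooth_at :: "(real \<Rightarrow> real) \<Rightarrow> real \<Rightarrow> bool" where
  "smooth_at f x \<longleftrightarrow>
     (\<exists>U. open U \<and> x \<in> U \<and> (\<forall>n. \<forall>y\<in>U. (deriv ^^ n) f field_differentiable at y))"

definition break_points :: "(real \<Rightarrow> real) \<Rightarrow> real set" where
  "break_points f = {b \<in> {0<..<1}. \<not> smooth_at f b}"

definition break_point :: "(real \<Rightarrow> real) \<Rightarrow> real" where
  "break_point f = (THE b. b \<in> break_points f)"

text \<open>The exponent \<open>d\<close> such that \<open>f r = a * r powr d\<close> on some interval ending at \<open>1\<close>.\<close>

definition herbrand_degree :: "(real \<Rightarrow> real) \<Rightarrow> real" where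
  "herbrand_degree f = (THE d. \<exists>a. \<exists>c\<in>{0..<1}. \<forall>r\<in>{c<..1}. f r = a * r powr d)"

definition simply_ramified ::
  "('a, 'b) ring_scheme \<Rightarrow> 'a set \<Rightarrow> ('a \<Rightarrow> real) \<Rightarrow> 'a set \<Rightarrow> 'a set \<Rightarrow> bool" where
  "simply_ramified \<Omega> K v E F \<longleftrightarrow>
     (\<exists>!b. b \<in> break_points (herbrand \<Omega> K v E F)) \<and>
     herbrand_degree (herbrand \<Omega> K v E F) = real (ring.dim \<Omega> E F)"

text \<open>A tower \<open>L = Ls ! 0 \<supseteq> Ls ! 1 \<supseteq> \<dots> \<supseteq> last Ls \<supseteq> K\<close>; indices start at \<open>0\<close> and the last field
  of the list is \<open>K'\<close>.\<close>

definition tower :: "('a, 'b) ring_scheme \<Rightarrow> 'a set \<Rightarrow> 'a set \<Rightarrow> 'a set list \<Rightarrow> bool" where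
  "tower \<Omega> K L Ls \<longleftrightarrow>
     Ls \<noteq> [] \<and> hd Ls = L \<and>
     (\<forall>E\<in>set Ls. subfield E \<Omega>) \<and>
     (\<forall>i. Suc i < length Ls \<longrightarrow> Ls ! Suc i \<subseteq> Ls ! i) \<and>
     K \<subseteq> last Ls"

definition step_herbrand ::
  "('a, 'b) ring_scheme \<Rightarrow> 'a set \<Rightarrow> ('a \<Rightarrow> real) \<Rightarrow> 'a set list \<Rightarrow> nat \<Rightarrow> real \<Rightarrow> real" where
  "step_herbrand \<Omega> K v Ls i = herbrand \<Omega> K v (Ls ! Suc i) (Ls ! i)"

text \<open>\<open>compose_upto f n = f (n - 1) \<circ> \<dots> \<circ> f 0\<close>\<close>

primrec compose_upto :: "(nat \<Rightarrow> 'c \<Rightarrow> 'c) \<Rightarrow> nat \<Rightarrow> 'c \<Rightarrow> 'c" where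
  "compose_upto f 0 = id"
| "compose_upto f (Suc n) = f n \<circ> compose_upto f n"

end

theory Submission
  imports Defs "HOL-Algebra.Zassenhaus"
begin

text \<open>
  Fix a finite Galois extension \<open>M\<close> of \<open>K\<close> containing \<open>L\<close>.  The Herbrand property makes
  \<open>\<H>\<^bsub>F/E\<^esub>\<close> computable in any such \<open>M\<close>: two choices are compared through their intersection.  With
  \<open>\<phi>\<^bsub>S\<^esub> r = (\<Prod>\<sigma>\<in>S. max r (i \<sigma>))\<close> one then has
  \<open>\<H>\<^bsub>F/E\<^esub> = \<phi>\<^bsub>T\<^esub> \<circ> \<phi>\<^bsub>S\<^esub>\<inverse>\<close> for \<open>S = Gal(M/F) \<subseteq> T = Gal(M/E)\<close>.  In logarithmic coordinates the slope of this
  function at \<open>\<phi>\<^bsub>S\<^esub> r\<close> is the ratio of the numbers of elements with \<open>i < r\<close> in \<open>T\<close> and in \<open>S\<close>.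
  Hence \<open>F/E\<close> is simply ramified iff for some \<open>\<beta> \<in> (0,1)\<close> the groups \<open>S \<noteq> T\<close> have the same elements
  below \<open>\<beta>\<close> and \<open>T\<close> is generated by \<open>S\<close> and the elements of \<open>T\<close> with \<open>i \<le> \<beta>\<close>; the break-point is
  then \<open>\<phi>\<^bsub>S\<^esub> \<beta>\<close>.  The condition on the break-points says that the \<open>\<beta>\<close>'s increase along the tower.  Therefore
  the group following \<open>U\<close> in the chain has to be \<open>U \<cdot> {\<sigma>. i \<sigma> \<le> \<beta>}\<close> with \<open>\<beta>\<close> the minimum of \<open>i\<close>
  outside \<open>U\<close>, and the chain has to stop once \<open>i = 1\<close> outside \<open>U\<close>.  The Galois correspondence turns
  this recursion into existence and uniqueness of the tower.
\<close>

section \<open>Break-points of Herbrand functions\<close>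

text \<open>Let T_r be the set of elements of T with \<open>i < r\<close>, and S_r = S \<inter> T_r.
  The slope |T_r| / |S_r| counts the cosets of S in T that meet T_r: it starts at 1, never decreases
  and is at most [T : S]. So a single break-point together with degree [F : E] = [T : S] means one
  leap from 1 to [T : S]; the two conditions on S and T say just this. The recursion rests on two
  facts. The norm extends uniquely, so the Galois group acts by isometries, and \<open>i\<close> is
  an ultrametric length on the group, invariant under conjugation; its levels are normal subgroups,
  and products with them are subgroups. Moreover, the image of one break-point and the next
  break-point are values of the same increasing function, that of the common group, so they compare
  as the \<beta>'s do. The Galois theory is done over infinite ground fields, which a nontrivial
  norm guarantees; infinity serves to find primitive elements and to compare polynomials by their
  values.\<close>

definition max_prod :: "('g \<Rightarrow> real) \<Rightarrow> 'g set \<Rightarrow> real \<Rightarrow> real" where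
  "max_prod i S r = (\<Prod>\<sigma>\<in>S. max r (i \<sigma>))"

definition herbrand_quotient :: "('g \<Rightarrow> real) \<Rightarrow> 'g set \<Rightarrow> 'g set \<Rightarrow> real \<Rightarrow> real" where
  "herbrand_quotient i S T = max_prod i T \<circ> inv_into {0..1} (max_prod i S)"

text \<open>The exponent of \<open>max_prod\<close> just to the left of \<open>r\<close> is the size
  of \<open>below\<close>, the one just to the right is the size of \<open>upto_level\<close>. A
  break-point is a difference between one-sided slopes, so both sets occur.\<close>

abbreviation below :: "('g \<Rightarrow> real) \<Rightarrow> 'g set \<Rightarrow> real \<Rightarrow> 'g set" where
  "below i S r \<equiv> {\<sigma> \<in> S. i \<sigma> < r}"

abbreviation upto_level :: "('g \<Rightarrow> real) \<Rightarrow> 'g set \<Rightarrow> real \<Rightarrow> 'g set" where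
  "upto_level i S r \<equiv> {\<sigma> \<in> S. i \<sigma> \<le> r}"

text \<open>The element of weight 0 will be the identity automorphism. Its factor is
  \<open>r\<close> itself, which forces the product to vanish at 0 and to increase strictly.\<close>

definition unit_weight :: "('g \<Rightarrow> real) \<Rightarrow> 'g set \<Rightarrow> bool" where
  "unit_weight i S \<longleftrightarrow> finite S \<and> (\<forall>\<sigma>\<in>S. 0 \<le> i \<sigma> \<and> i \<sigma> \<le> 1) \<and> (\<exists>\<sigma>\<in>S. i \<sigma> = 0)"

section \<open>The functions \<open>max_prod\<close> as increasing bijections of the unit
  interval\<close>

lemma max_prod_0: "unit_weight i S \<Longrightarrow> max_prod i S 0 = 0"
  unfolding max_prod_def unit_weight_def by (force intro: prod_zero)

lemma max_prod_1: "unit_weight i S \<Longrightarrow> max_prod i S 1 = 1"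
  unfolding max_prod_def unit_weight_def by (intro prod.neutral) auto

text \<open>The factor of an element of weight 0 grows strictly; the other factors grow weakly and
  are positive at \<open>s\<close>.\<close>

lemma max_prod_strict_mono:
  assumes "unit_weight i S" "0 \<le> r" "r < s"
  shows "max_prod i S r < max_prod i S s"
proof -
  from assms obtain e where e: "e \<in> S" "i e = 0" and fin: "finite S"
    unfolding unit_weight_def by auto
  have "(\<Prod>\<sigma>\<in>S - {e}. max r (i \<sigma>)) \<le> (\<Prod>\<sigma>\<in>S - {e}. max s (i \<sigma>))"
    by (intro prod_mono) (use assms in auto)
  moreover have "0 < (\<Prod>\<sigma>\<in>S - {e}. max s (i \<sigma>))"
    by (intro prod_pos) (use assms in auto)
  moreover have "0 \<le> (\<Prod>\<sigma>\<in>S - {e}. max r (i \<sigma>))"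
    by (intro prod_nonneg) (use assms in auto)
  ultimately have "r * (\<Prod>\<sigma>\<in>S - {e}. max r (i \<sigma>)) < s * (\<Prod>\<sigma>\<in>S - {e}. max s (i \<sigma>))"
    using mult_left_mono[OF _ assms(2)] mult_strict_right_mono[OF assms(3)] order_le_less_trans by blast
  then show ?thesis
    unfolding max_prod_def using assms(2,3) by (simp add: prod.remove[OF fin e(1)] e max_absorb1)
qed

lemma max_prod_less_iff:
  assumes "unit_weight i S" "0 \<le> r" "0 \<le> s"
  shows "max_prod i S r < max_prod i S s \<longleftrightarrow> r < s"
  by (metis assms less_asym linorder_neqE_linordered_idom max_prod_strict_mono order_less_irrefl)

lemma inj_on_max_prod: "unit_weight i S \<Longrightarrow> inj_on (max_prod i S) {0..1}"
  by (rule linorder_inj_onI) (use max_prod_strict_mono in \<open>force+\<close>)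

lemma max_prod_image:
  assumes "unit_weight i S"
  shows "max_prod i S ` {0..1} = {0..1}"
proof
  show "max_prod i S ` {0..1} \<subseteq> {0..1}"
    using max_prod_less_iff[OF assms] max_prod_0[OF assms] max_prod_1[OF assms]
    by (smt (verit, best) atLeastAtMost_iff image_subset_iff)
  have "continuous_on {0..1} (max_prod i S)"
    unfolding max_prod_def by (intro continuous_intros)
  then show "{0..1} \<subseteq> max_prod i S ` {0..1}"
    using IVT'[of "max_prod i S" 0 _ 1] max_prod_0[OF assms] max_prod_1[OF assms] by fastforce
qed

lemma max_prod_image_open:
  assumes "unit_weight i S"
  shows "max_prod i S ` {0<..<1} = {0<..<1}"
proof -
  have "max_prod i S ` {0<..<1} = max_prod i S ` ({0..1} - {0, 1})"
    by (rule arg_cong[of _ _ "image _"]) auto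
  also have "\<dots> = max_prod i S ` {0..1} - max_prod i S ` {0, 1}"
    by (rule inj_on_image_set_diff[OF inj_on_max_prod[OF assms]]) auto
  also have "\<dots> = {0<..<1}"
    using max_prod_0[OF assms] max_prod_1[OF assms] max_prod_image[OF assms] by auto
  finally show ?thesis .
qed

text \<open>Every later computation writes its argument as \<open>max_prod i S r\<close>, so that
  the inverse function disappears.\<close>

lemma herbrand_quotient_max_prod:
  assumes "unit_weight i S" "r \<in> {0..1}"
  shows "herbrand_quotient i S T (max_prod i S r) = max_prod i T r"
  using inv_into_f_f[OF inj_on_max_prod[OF assms(1)] assms(2)] by (simp add: herbrand_quotient_def)

text \<open>The function of T is the function of S times the product over \<open>T - S\<close>, so
  the quotient is the identity iff this extra product is 1 wherever the function of S is
  nonzero.\<close>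

lemma herbrand_quotient_eq_id_iff:
  assumes "unit_weight i T" "S \<subseteq> T" "unit_weight i S"
  shows "(\<forall>r\<in>{0..1}. herbrand_quotient i S T r = r) \<longleftrightarrow> (\<forall>\<sigma>\<in>T - S. i \<sigma> = 1)"
proof -
  have fin: "finite T" using assms by (auto simp: unit_weight_def)
  have split: "max_prod i T r = max_prod i S r * (\<Prod>\<sigma>\<in>T - S. max r (i \<sigma>))" for r
    unfolding max_prod_def using prod.subset_diff[OF assms(2) fin] by (simp add: mult.commute)
  have "(\<forall>r\<in>{0..1}. herbrand_quotient i S T r = r) \<longleftrightarrow>
      (\<forall>r\<in>max_prod i S ` {0..1}. herbrand_quotient i S T r = r)"
    by (simp add: max_prod_image[OF assms(3)])
  also have "\<dots> \<longleftrightarrow> (\<forall>r\<in>{0..1}. max_prod i T r = max_prod i S r)"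
    using herbrand_quotient_max_prod[OF assms(3)] by simp
  also have "\<dots> \<longleftrightarrow> (\<forall>\<sigma>\<in>T - S. i \<sigma> = 1)"
  proof
    assume eq: "\<forall>r\<in>{0..1}. max_prod i T r = max_prod i S r"
    show "\<forall>\<sigma>\<in>T - S. i \<sigma> = 1"
    proof (rule ccontr)
      assume "\<not> ?thesis"
      then obtain \<sigma> where \<sigma>: "\<sigma> \<in> T - S" "i \<sigma> < 1"
        using assms(1) unfolding unit_weight_def by force
      \<comment> \<open>Any r in (0,1) with \<open>i \<sigma> \<le> r\<close> makes the extra
        product smaller than 1. The value 1/2 keeps r positive, so that
        \<open>max_prod i S r\<close> is positive too.\<close>
      define r where "r = max (1/2) (i \<sigma>)"
      have r: "0 < r" "r < 1" "i \<sigma> \<le> r" using \<sigma> by (auto simp: r_def)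
      have "(\<Prod>\<sigma>\<in>T - S. max r (i \<sigma>)) < 1"
      proof -
        have "(\<Prod>\<sigma>\<in>T - S. max r (i \<sigma>)) = max r (i \<sigma>) * (\<Prod>\<sigma>\<in>T - S - {\<sigma>}. max r (i \<sigma>))"
          using fin \<sigma> by (intro prod.remove) auto
        also have "\<dots> \<le> r"
        proof -
          have "(\<Prod>\<sigma>\<in>T - S - {\<sigma>}. max r (i \<sigma>)) \<le> 1"
            by (rule prod_le_1) (use assms(1) r in \<open>auto simp: unit_weight_def\<close>)
          then show ?thesis using r by (simp add: max_def mult_left_le)
        qed
        finally show ?thesis using r by simp
      qed
      moreover have "0 < max_prod i S r"
        unfolding max_prod_def by (rule prod_pos) (use r in auto)
      ultimately have "max_prod i T r < max_prod i S r" by (simp add: split)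
      then show False using eq r by auto
    qed
  next
    assume "\<forall>\<sigma>\<in>T - S. i \<sigma> = 1"
    then show "\<forall>r\<in>{0..1}. max_prod i T r = max_prod i S r"
      by (auto simp: split intro!: prod.neutral)
  qed
  finally show ?thesis .
qed

section \<open>Power laws between consecutive weights\<close>

text \<open>When no weight lies strictly between x and y, each factor is either \<open>r\<close> or
  constant on the whole closed interval: weight x counts as \<open>r\<close>, weight y as a
  constant.\<close>

lemma max_prod_monomial:
  assumes "finite S" "x < y" "0 \<le> x" "\<And>\<sigma>. \<sigma> \<in> S \<Longrightarrow> \<not> (x < i \<sigma> \<and> i \<sigma> < y)"
  obtains C where "C > 0" "\<And>r. r \<in> {x..y} \<Longrightarrow> max_prod i S r = C * r ^ card (upto_level i S x)"
proof
  define C where "C = (\<Prod>\<sigma>\<in>S - upto_level i S x. i \<sigma>)"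
  show "C > 0" unfolding C_def by (rule prod_pos) (use assms in auto)
  fix r assume r: "r \<in> {x..y}"
  have "max_prod i S r = (\<Prod>\<sigma>\<in>S - upto_level i S x. max r (i \<sigma>)) * (\<Prod>\<sigma>\<in>upto_level i S x. max r (i \<sigma>))"
    unfolding max_prod_def by (rule prod.subset_diff) (use assms in auto)
  also have "(\<Prod>\<sigma>\<in>S - upto_level i S x. max r (i \<sigma>)) = C"
    unfolding C_def by (rule prod.cong) (use assms r in fastforce)+
  also have "(\<Prod>\<sigma>\<in>upto_level i S x. max r (i \<sigma>)) = (\<Prod>\<sigma>\<in>upto_level i S x. r)"
    by (rule prod.cong) (use r in auto)
  finally show "max_prod i S r = C * r ^ card (upto_level i S x)" by simp
qed

text \<open>Eliminating r from z = C r^n and the value D r^m leaves D (z / C)^(m/n). The restriction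
  to positive z makes r positive, as the laws of \<open>powr\<close> require.\<close>

lemma herbrand_quotient_powr:
  assumes S: "unit_weight i S" and T: "unit_weight i T"
    and "x < y" "0 \<le> x" "y \<le> 1" and gap: "\<And>\<sigma>. \<sigma> \<in> S \<union> T \<Longrightarrow> \<not> (x < i \<sigma> \<and> i \<sigma> < y)"
  obtains a where "a > 0"
    "\<And>z. 0 < z \<Longrightarrow> z \<in> {max_prod i S x..max_prod i S y} \<Longrightarrow> herbrand_quotient i S T z =
       a * z powr (real (card (upto_level i T x)) / real (card (upto_level i S x)))"
proof -
  let ?n = "card (upto_level i S x)" and ?m = "card (upto_level i T x)"
  obtain C where C: "C > 0" "\<And>r. r \<in> {x..y} \<Longrightarrow> max_prod i S r = C * r ^ ?n"
    using max_prod_monomial[of S x y i] assms unfolding unit_weight_def by blast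
  obtain D where D: "D > 0" "\<And>r. r \<in> {x..y} \<Longrightarrow> max_prod i T r = D * r ^ ?m"
    using max_prod_monomial[of T x y i] assms unfolding unit_weight_def by blast
  have "?n > 0" using S \<open>0 \<le> x\<close> unfolding unit_weight_def card_gt_0_iff by auto
  have "herbrand_quotient i S T z = (D / C powr (?m / ?n)) * z powr (?m / ?n)"
    if z: "0 < z" "z \<in> {max_prod i S x..max_prod i S y}" for z
  proof -
    have "z \<in> {0..1}" using z assms(3-5) max_prod_1[OF S] max_prod_less_iff[OF S]
      by (smt (verit, del_insts) atLeastAtMost_iff)
    then obtain r where r: "r \<in> {0..1}" "z = max_prod i S r"
      using max_prod_image[OF S] by (metis imageE)
    with z have rxy: "r \<in> {x..y}" using max_prod_less_iff[OF S] assms(3-5)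
      by (smt (verit, del_insts) atLeastAtMost_iff)
    have "r > 0" using z(1) r max_prod_0[OF S] by (metis atLeastAtMost_iff less_eq_real_def order_less_irrefl)
    have "z / C = r powr ?n" using C rxy r \<open>r > 0\<close> by (simp add: powr_realpow)
    then have "(z / C) powr (?m / ?n) = r powr ?m" using \<open>?n > 0\<close> by (simp add: powr_powr)
    then have "D * (z powr (?m / ?n) / C powr (?m / ?n)) = D * r ^ ?m"
      using \<open>r > 0\<close> z C by (simp add: powr_divide powr_realpow)
    then show ?thesis
      using herbrand_quotient_max_prod[OF S r(1)] D(2)[OF rxy] r by simp
  qed
  moreover have "D / C powr (?m / ?n) > 0" using C D by simp
  ultimately show ?thesis using that by blast
qed

section \<open>Smoothness, break-points and degree of piecewise power functions\<close>

lemma higher_deriv_cong_open: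
  fixes f g :: "real \<Rightarrow> real"
  assumes "open U" "\<And>y. y \<in> U \<Longrightarrow> f y = g y" "y \<in> U"
  shows "(deriv ^^ n) f y = (deriv ^^ n) g y"
  using assms(3)
proof (induction n arbitrary: y)
  case 0
  then show ?case using assms(2) by simp
next
  case (Suc n)
  have "deriv ((deriv ^^ n) f) y = deriv ((deriv ^^ n) g) y"
  proof (rule deriv_cong_ev)
    show "\<forall>\<^sub>F x in nhds y. (deriv ^^ n) f x = (deriv ^^ n) g x"
      using eventually_nhds_in_open[OF assms(1) Suc.prems] by eventually_elim (rule Suc.IH)
  qed simp
  then show ?case by simp
qed

lemma smooth_at_cong:
  assumes "open U" "\<And>y. y \<in> U \<Longrightarrow> f y = g y" "x \<in> U" "smooth_at f x"
  shows "smooth_at g x"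
proof -
  from assms(4) obtain V where V: "open V" "x \<in> V"
    "\<And>n y. y \<in> V \<Longrightarrow> (deriv ^^ n) f field_differentiable at y"
    unfolding smooth_at_def by blast
  have "(deriv ^^ n) g field_differentiable at y" if y: "y \<in> U \<inter> V" for n y
  proof -
    obtain f' where "((deriv ^^ n) f has_field_derivative f') (at y)"
      using V(3)[of y n] y by (auto simp: field_differentiable_def)
    then have "((deriv ^^ n) g has_field_derivative f') (at y)"
      by (rule has_field_derivative_transform_within_open[where S = U])
        (use y assms(1,2) higher_deriv_cong_open[of U f g] in auto)
    then show ?thesis by (auto simp: field_differentiable_def)
  qed
  then show ?thesis unfolding smooth_at_def using V assms by (intro exI[of _ "U \<inter> V"]) auto
qed

text \<open>Herbrand functions are controlled only on the unit interval. Smoothness is local and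
  (0,1) is open, so values outside do not affect the break-points.\<close>

lemma break_points_cong:
  assumes "\<And>r. r \<in> {0<..<1} \<Longrightarrow> f r = g r"
  shows "break_points f = break_points g"
proof -
  have "smooth_at f r \<longleftrightarrow> smooth_at g r" if "r \<in> {0<..<1}" for r
    using smooth_at_cong[OF open_greaterThanLessThan _ that, of f g]
      smooth_at_cong[OF open_greaterThanLessThan _ that, of g f] assms by metis
  then show ?thesis unfolding break_points_def by auto
qed

text \<open>On the positive half-line every iterated derivative again has the form b y^e.\<close>

lemma smooth_at_powr:
  fixes a d x :: real
  assumes "x > 0"
  shows "smooth_at (\<lambda>z. a * z powr d) x"
proof -
  have pow: "\<exists>b e. \<forall>y>0. (deriv ^^ n) (\<lambda>z. a * z powr d) y = b * y powr e" for n
  proof (induction n)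
    case 0
    show ?case by (intro exI[of _ a] exI[of _ d]) simp
  next
    case (Suc n)
    then obtain b e where be: "\<And>y. y > 0 \<Longrightarrow> (deriv ^^ n) (\<lambda>z. a * z powr d) y = b * y powr e"
      by blast
    have "deriv ((deriv ^^ n) (\<lambda>z. a * z powr d)) y = b * e * y powr (e - 1)" if "y > 0" for y
    proof (rule DERIV_imp_deriv)
      have "((\<lambda>z. b * z powr e) has_field_derivative b * e * y powr (e - 1)) (at y)"
        using that by (auto intro!: derivative_eq_intros)
      then show "((deriv ^^ n) (\<lambda>z. a * z powr d) has_field_derivative b * e * y powr (e - 1)) (at y)"
        by (rule has_field_derivative_transform_within_open[where S = "{0<..}"]) (use that be in auto)
    qed
    then show ?case by (intro exI[of _ "b * e"] exI[of _ "e - 1"]) simp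
  qed
  have "(deriv ^^ n) (\<lambda>z. a * z powr d) field_differentiable at y" if "y > 0" for n y
  proof -
    obtain b e where be: "\<And>y. y > 0 \<Longrightarrow> (deriv ^^ n) (\<lambda>z. a * z powr d) y = b * y powr e"
      using pow by blast
    have "((\<lambda>z. b * z powr e) has_field_derivative b * e * y powr (e - 1)) (at y)"
      using that by (auto intro!: derivative_eq_intros)
    then have "((deriv ^^ n) (\<lambda>z. a * z powr d) has_field_derivative b * e * y powr (e - 1)) (at y)"
      by (rule has_field_derivative_transform_within_open[where S = "{0<..}"]) (use that be in auto)
    then show ?thesis by (auto simp: field_differentiable_def)
  qed
  then show ?thesis unfolding smooth_at_def using assms by (intro exI[of _ "{0<..}"]) auto
qed

text \<open>The one-sided derivatives at q are d g(q) / q and e g(q) / q with g(q) > 0, so the first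
  derivative alone forces d = e. Conversely, d = e and the common value at q give a = b, and g is a
  single power near q.\<close>

lemma smooth_at_two_powers_iff:
  fixes g :: "real \<Rightarrow> real"
  assumes "0 < p" "p < q" "q < s" "a > 0"
    and left: "\<And>z. z \<in> {p..q} \<Longrightarrow> g z = a * z powr d"
    and right: "\<And>z. z \<in> {q..s} \<Longrightarrow> g z = b * z powr e"
  shows "smooth_at g q \<longleftrightarrow> d = e"
proof
  have q: "q > 0" "q \<in> {p..q}" "q \<in> {q..s}" using assms(1-3) by auto
  have eq: "a * q powr d = b * q powr e" using left[OF q(2)] right[OF q(3)] by simp
  {
    assume "d = e"
    then have "a = b" using eq q(1) by simp
    have "a * z powr d = g z" if "z \<in> {p<..<s}" for z
    proof (cases "z \<le> q")
      case True
      with that have "z \<in> {p..q}" by simp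
      then show ?thesis using left by metis
    next
      case False
      with that have "z \<in> {q..s}" by simp
      then show ?thesis using right \<open>a = b\<close> \<open>d = e\<close> by metis
    qed
    then show "smooth_at g q"
      by (rule smooth_at_cong[OF open_greaterThanLessThan[of p s]])
        (use assms(2,3) smooth_at_powr[OF q(1)] in auto)
  }
  assume "smooth_at g q"
  then have "g field_differentiable at q"
    unfolding smooth_at_def by (metis funpow_0)
  then obtain D where D: "(g has_field_derivative D) (at q)" by (auto simp: field_differentiable_def)
  have *: "D = c * k * q powr (k - 1)"
    if A: "\<And>z. z \<in> A \<Longrightarrow> g z = c * z powr k" "q \<in> A" "at q within A \<noteq> bot" for A c k
  proof -
    have "((\<lambda>z. c * z powr k) has_field_derivative c * k * q powr (k - 1)) (at q within A)"
      using q(1) by (auto intro!: derivative_eq_intros)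
    moreover have "((\<lambda>z. c * z powr k) has_field_derivative D) (at q within A)"
      by (rule has_field_derivative_transform_within[OF has_field_derivative_at_within[OF D, of A] zero_less_one A(2)])
        (rule A(1))
    ultimately show ?thesis
      using vector_derivative_unique_within[OF A(3)]
      by (metis has_real_derivative_iff_has_vector_derivative)
  qed
  have "D = a * d * q powr (d - 1)"
    by (rule *[of "{p..q}"], rule left) (use assms(2) in \<open>auto simp: at_within_Icc_at_left\<close>)
  moreover have "D = b * e * q powr (e - 1)"
    by (rule *[of "{q..s}"], rule right) (use assms(3) in \<open>auto simp: at_within_Icc_at_right\<close>)
  moreover have "a * d * q powr (d - 1) = d * (a * q powr d) / q" "b * e * q powr (e - 1) = e * (b * q powr e) / q"
    using q(1) by (simp_all add: powr_diff)
  ultimately have "d * (a * q powr d) / q = e * (a * q powr d) / q" using eq by metis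
  then show "d = e" using q(1) \<open>a > 0\<close> by simp
qed

lemma herbrand_degreeI:
  fixes f :: "real \<Rightarrow> real"
  assumes "c \<in> {0..<1}" "a > 0" "\<And>r. r \<in> {c<..1} \<Longrightarrow> f r = a * r powr d"
  shows "herbrand_degree f = d"
  unfolding herbrand_degree_def
proof (rule the_equality)
  show "\<exists>a. \<exists>c\<in>{0..<1}. \<forall>r\<in>{c<..1}. f r = a * r powr d" using assms by blast
next
  fix e assume "\<exists>a. \<exists>c\<in>{0..<1}. \<forall>r\<in>{c<..1}. f r = a * r powr e"
  then obtain b c' where b: "c' \<in> {0..<1}" "\<And>r. r \<in> {c'<..1} \<Longrightarrow> f r = b * r powr e" by blast
  \<comment> \<open>A point of both intervals different from 0 and 1: the value at 1 identifies the
    coefficients, the value at r the exponents.\<close>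
  define r where "r = (max c c' + 1) / 2"
  have r: "0 < r" "r < 1" "c < r" "c' < r" using assms(1) b(1) by (auto simp: r_def)
  have "a = b" using assms(1) b(1) b(2)[of 1] assms(3)[of 1] by auto
  then have "r powr d = r powr e" using b(2)[of r] assms(3)[of r] r assms(2) by auto
  then show "e = d" using r by (simp add: powr_inj)
qed

lemma finite_gap:
  fixes r :: real
  assumes "finite V" "0 < r" "r \<le> 1"
  obtains x y where "0 < x" "x < r" "r < y" "\<And>v. v \<in> V \<Longrightarrow> \<not> (x < v \<and> v < r)"
    "\<And>v. v \<in> V \<Longrightarrow> \<not> (r < v \<and> v < y)"
proof
  \<comment> \<open>The inserted values r / 2 and r + 1 make the maximum and the minimum exist and
    keep x positive.\<close>
  let ?A = "insert (r / 2) {v \<in> V. v < r}" and ?B = "insert (r + 1) {v \<in> V. r < v}"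
  define x where "x = Max ?A"
  define y where "y = Min ?B"
  have "x \<in> ?A" "y \<in> ?B" unfolding x_def y_def using assms(1) by (intro Max_in Min_in; auto)+
  then show "x < r" "r < y" using assms by auto
  show "0 < x" unfolding x_def using assms by (auto simp: Max_gr_iff)
  show "\<not> (x < v \<and> v < r)" if "v \<in> V" for v
    using Max_ge[of ?A v] that assms(1) unfolding x_def by (auto simp: not_less)
  show "\<not> (r < v \<and> v < y)" if "v \<in> V" for v
    using Min_le[of ?B v] that assms(1) unfolding y_def by (auto simp: not_less)
qed

lemma smooth_at_herbrand_quotient_iff:
  assumes S: "unit_weight i S" and T: "unit_weight i T" and r: "r \<in> {0<..<1}"
  shows "smooth_at (herbrand_quotient i S T) (max_prod i S r) \<longleftrightarrow>
    card (below i T r) * card (upto_level i S r) = card (upto_level i T r) * card (below i S r)"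
proof -
  have fin: "finite (i ` (S \<union> T))" using S T by (auto simp: unit_weight_def)
  obtain x y0 where xy0: "0 < x" "x < r" "r < y0" "\<And>\<sigma>. \<sigma> \<in> S \<union> T \<Longrightarrow> \<not> (x < i \<sigma> \<and> i \<sigma> < r)"
    "\<And>\<sigma>. \<sigma> \<in> S \<union> T \<Longrightarrow> \<not> (r < i \<sigma> \<and> i \<sigma> < y0)"
    using finite_gap[OF fin, of r] r by (metis greaterThanLessThan_iff imageI less_eq_real_def)
  define y where "y = min y0 1"
  have xy: "0 < x" "x < r" "r < y" "y \<le> 1" "\<And>\<sigma>. \<sigma> \<in> S \<union> T \<Longrightarrow> \<not> (x < i \<sigma> \<and> i \<sigma> < r)"
    "\<And>\<sigma>. \<sigma> \<in> S \<union> T \<Longrightarrow> \<not> (r < i \<sigma> \<and> i \<sigma> < y)"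
    using xy0 r by (auto simp: y_def)
  \<comment> \<open>Since no weight lies strictly between x and r, the exponent on the left piece,
    counted at x, is the number of elements strictly below r.\<close>
  have low: "upto_level i S x = below i S r" "upto_level i T x = below i T r"
    using xy(2,5) by force+
  obtain a where a: "a > 0" "\<And>z. 0 < z \<Longrightarrow> z \<in> {max_prod i S x..max_prod i S r} \<Longrightarrow> herbrand_quotient i S T z =
       a * z powr (real (card (below i T r)) / real (card (below i S r)))"
    using herbrand_quotient_powr[OF S T xy(2) _ _ xy(5)] xy r unfolding low by auto
  obtain b where b: "b > 0" "\<And>z. 0 < z \<Longrightarrow> z \<in> {max_prod i S r..max_prod i S y} \<Longrightarrow> herbrand_quotient i S T z =
       b * z powr (real (card (upto_level i T r)) / real (card (upto_level i S r)))"
    using herbrand_quotient_powr[OF S T xy(3) _ _ xy(6)] xy r by auto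
  have pos: "0 < max_prod i S x" "max_prod i S x < max_prod i S r" "max_prod i S r < max_prod i S y"
    using max_prod_less_iff[OF S, of 0 x] max_prod_less_iff[OF S, of x r] max_prod_less_iff[OF S, of r y]
      max_prod_0[OF S] xy r by auto
  obtain e where e: "e \<in> S" "i e = 0" "finite S" using S unfolding unit_weight_def by blast
  then have "e \<in> below i S r" "e \<in> upto_level i S r" using r by auto
  moreover have "finite (below i S r)" "finite (upto_level i S r)" using e(3) by auto
  ultimately have n: "card (below i S r) > 0" "card (upto_level i S r) > 0"
    unfolding card_gt_0_iff by blast+
  have "smooth_at (herbrand_quotient i S T) (max_prod i S r) \<longleftrightarrow>
     real (card (below i T r)) / real (card (below i S r)) = real (card (upto_level i T r)) / real (card (upto_level i S r))"
    by (rule smooth_at_two_powers_iff[OF pos a(1)]) (use a b pos in auto)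
  also have "\<dots> \<longleftrightarrow> card (below i T r) * card (upto_level i S r) = card (upto_level i T r) * card (below i S r)"
    using n by (simp add: frac_eq_eq flip: of_nat_mult)
  finally show ?thesis .
qed

text \<open>The quotients \<open>card T / card S\<close> below and up to \<open>r\<close> are the logarithmic slopes on the two sides of
  \<open>r\<close>; the inequality is cross-multiplied.\<close>

definition jumps :: "('g \<Rightarrow> real) \<Rightarrow> 'g set \<Rightarrow> 'g set \<Rightarrow> real set" where
  "jumps i S T = {r \<in> {0<..<1}.
     card (below i T r) * card (upto_level i S r) \<noteq> card (upto_level i T r) * card (below i S r)}"

lemma break_points_herbrand_quotient:
  assumes S: "unit_weight i S" and T: "unit_weight i T"
  shows "break_points (herbrand_quotient i S T) = max_prod i S ` jumps i S T"
proof -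
  have "break_points (herbrand_quotient i S T) =
      {b \<in> max_prod i S ` {0<..<1}. \<not> smooth_at (herbrand_quotient i S T) b}"
    unfolding break_points_def max_prod_image_open[OF S] ..
  also have "\<dots> = max_prod i S ` {r \<in> {0<..<1}. \<not> smooth_at (herbrand_quotient i S T) (max_prod i S r)}"
    by auto
  also have "{r \<in> {0<..<1}. \<not> smooth_at (herbrand_quotient i S T) (max_prod i S r)} = jumps i S T"
    unfolding jumps_def by (intro Collect_cong conj_cong refl) (simp add: smooth_at_herbrand_quotient_iff[OF S T])
  finally show ?thesis .
qed

text \<open>An element of weight 1 contributes the constant factor 1 on the unit interval, so the
  last exponent counts the elements of weight less than 1 and not the whole groups. \<open>f\<close>
  stands for a Herbrand function, known on the unit interval only.\<close>

lemma herbrand_degree_herbrand_quotient: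
  assumes S: "unit_weight i S" and T: "unit_weight i T"
    and eq: "\<And>r. r \<in> {0..1} \<Longrightarrow> f r = herbrand_quotient i S T r"
  shows "herbrand_degree f = real (card (below i T 1)) / real (card (below i S 1))"
proof -
  have fin: "finite (i ` (S \<union> T))" using S T by (auto simp: unit_weight_def)
  obtain x y where xy: "0 < x" "x < 1" "\<And>\<sigma>. \<sigma> \<in> S \<union> T \<Longrightarrow> \<not> (x < i \<sigma> \<and> i \<sigma> < 1)"
    using finite_gap[OF fin, of 1] by (metis imageI less_eq_real_def zero_less_one)
  have low: "upto_level i S x = below i S 1" "upto_level i T x = below i T 1"
    using xy(2,3) by force+
  obtain a where a: "a > 0" "\<And>z. 0 < z \<Longrightarrow> z \<in> {max_prod i S x..max_prod i S 1} \<Longrightarrow> herbrand_quotient i S T z =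
       a * z powr (real (card (below i T 1)) / real (card (below i S 1)))"
    using herbrand_quotient_powr[OF S T xy(2) _ _ xy(3)] xy unfolding low by auto
  have "0 < max_prod i S x" "max_prod i S x < 1"
    using max_prod_less_iff[OF S, of 0 x] max_prod_less_iff[OF S, of x 1] max_prod_0[OF S] max_prod_1[OF S] xy by auto
  then show ?thesis
    using a eq max_prod_1[OF S] by (intro herbrand_degreeI[of "max_prod i S x" a]) auto
qed

section \<open>Canonical chains of subgroups\<close>

text \<open>The fibre of multiplication S x N over s n consists of the pairs (s h, h^-1 n) with h in
  \<open>S \<inter> N\<close>, so all fibres have the same size. The product set itself need not be
  a subgroup.\<close>

lemma (in group) card_subgroup_set_mult:
  assumes S: "subgroup S G" and N: "subgroup N G" and fin: "finite S" "finite N"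
  shows "card (S <#> N) * card (S \<inter> N) = card S * card N"
proof -
  interpret S: subgroup S G by fact
  interpret N: subgroup N G by fact
  let ?f = "\<lambda>(s, n). s \<otimes> n"
  have SN: "S <#> N = ?f ` (S \<times> N)" by (auto simp: set_mult_def)
  have fib: "card {p \<in> S \<times> N. ?f p = x} = card (S \<inter> N)" if x: "x \<in> S <#> N" for x
  proof -
    obtain s n where sn: "s \<in> S" "n \<in> N" "x = s \<otimes> n" using x by (auto simp: set_mult_def)
    have "bij_betw (\<lambda>h. (s \<otimes> h, inv h \<otimes> n)) (S \<inter> N) {p \<in> S \<times> N. ?f p = x}"
    proof (rule bij_betw_byWitness[where f' = "\<lambda>p. inv s \<otimes> fst p"])
      show "\<forall>h\<in>S \<inter> N. inv s \<otimes> fst (s \<otimes> h, inv h \<otimes> n) = h"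
        using sn(1) by (simp add: S.mem_carrier flip: m_assoc)
      show "\<forall>p\<in>{p \<in> S \<times> N. ?f p = x}. (s \<otimes> (inv s \<otimes> fst p), inv (inv s \<otimes> fst p) \<otimes> n) = p"
      proof (rule ballI)
        fix p assume "p \<in> {p \<in> S \<times> N. ?f p = x}"
        then obtain a b where p: "p = (a, b)" and ab: "a \<in> S" "b \<in> N" "x = a \<otimes> b" by auto
        note c = S.mem_carrier[OF sn(1)] N.mem_carrier[OF sn(2)] S.mem_carrier[OF ab(1)] N.mem_carrier[OF ab(2)]
        have "inv (inv s \<otimes> a) \<otimes> n = inv a \<otimes> (s \<otimes> n)" using c by (simp add: inv_mult_group m_assoc)
        also have "\<dots> = inv a \<otimes> (a \<otimes> b)" using ab(3) sn(3) by simp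
        also have "\<dots> = b" using c by (simp flip: m_assoc)
        finally have "inv (inv s \<otimes> a) \<otimes> n = b" .
        moreover have "s \<otimes> (inv s \<otimes> a) = a" using c by (simp flip: m_assoc)
        ultimately show "(s \<otimes> (inv s \<otimes> fst p), inv (inv s \<otimes> fst p) \<otimes> n) = p" by (simp add: p)
      qed
      show "(\<lambda>h. (s \<otimes> h, inv h \<otimes> n)) ` (S \<inter> N) \<subseteq> {p \<in> S \<times> N. ?f p = x}"
      proof (rule image_subsetI)
        fix h assume "h \<in> S \<inter> N"
        then have h: "h \<in> S" "h \<in> N" by auto
        note c = S.mem_carrier[OF sn(1)] N.mem_carrier[OF sn(2)] S.mem_carrier[OF h(1)]
        have "s \<otimes> h \<otimes> (inv h \<otimes> n) = s \<otimes> (h \<otimes> inv h) \<otimes> n"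
          using c by (metis inv_closed m_assoc m_closed)
        also have "\<dots> = x" using c sn(3) by simp
        finally show "(s \<otimes> h, inv h \<otimes> n) \<in> {p \<in> S \<times> N. ?f p = x}"
          using sn(1,2) h by simp
      qed
      show "(\<lambda>p. inv s \<otimes> fst p) ` {p \<in> S \<times> N. ?f p = x} \<subseteq> S \<inter> N"
      proof (rule image_subsetI)
        fix p assume "p \<in> {p \<in> S \<times> N. ?f p = x}"
        then obtain a b where p: "p = (a, b)" and ab: "a \<in> S" "b \<in> N" "x = a \<otimes> b" by auto
        note c = S.mem_carrier[OF sn(1)] N.mem_carrier[OF sn(2)] S.mem_carrier[OF ab(1)] N.mem_carrier[OF ab(2)]
        have "inv s \<otimes> a = inv s \<otimes> (a \<otimes> b) \<otimes> inv b" using c by (metis inv_closed m_assoc m_closed r_inv r_one)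
        also have "\<dots> = inv s \<otimes> (s \<otimes> n) \<otimes> inv b" using ab(3) sn(3) by simp
        also have "\<dots> = n \<otimes> inv b" using c by (simp flip: m_assoc)
        finally have "inv s \<otimes> a \<in> N" using ab(2) sn(2) by simp
        then show "inv s \<otimes> fst p \<in> S \<inter> N" using ab(1) sn(1) by (simp add: p)
      qed
    qed
    from bij_betw_same_card[OF this] show ?thesis by (rule sym)
  qed
  have "card S * card N = card (S \<times> N)" by (simp add: card_cartesian_product)
  also have "\<dots> = (\<Sum>x\<in>S <#> N. card {p \<in> S \<times> N. ?f p = x})"
    unfolding card_eq_sum SN by (rule sum.image_gen) (rule finite_cartesian_product[OF fin])
  also have "\<dots> = card (S <#> N) * card (S \<inter> N)" using fib by simp
  finally show ?thesis by simp
qed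

section \<open>Simple steps in a group with an ultrametric length\<close>

text \<open>These are the properties of the inertia function on which the group theory rests. The
  ultrametric inequality and invariance under inversion make the levels subgroups; invariance under
  conjugation makes the levels of the full group normal.\<close>

locale ramified_group = group G for G (structure) +
  fixes i :: "'a \<Rightarrow> real"
  assumes finite_carrier: "finite (carrier G)"
    and i_nonneg: "\<sigma> \<in> carrier G \<Longrightarrow> 0 \<le> i \<sigma>"
    and i_le_1: "\<sigma> \<in> carrier G \<Longrightarrow> i \<sigma> \<le> 1"
    and i_eq_0_iff: "\<sigma> \<in> carrier G \<Longrightarrow> i \<sigma> = 0 \<longleftrightarrow> \<sigma> = \<one>"
    and i_mult: "\<sigma> \<in> carrier G \<Longrightarrow> \<tau> \<in> carrier G \<Longrightarrow> i (\<sigma> \<otimes> \<tau>) \<le> max (i \<sigma>) (i \<tau>)"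
    and i_inv: "\<sigma> \<in> carrier G \<Longrightarrow> i (inv \<sigma>) = i \<sigma>"
    and i_conj: "\<sigma> \<in> carrier G \<Longrightarrow> \<tau> \<in> carrier G \<Longrightarrow> i (\<sigma> \<otimes> \<tau> \<otimes> inv \<sigma>) = i \<tau>"
begin

lemma finite_subgroup: "subgroup S G \<Longrightarrow> finite S"
  using finite_carrier finite_subset subgroup.subset by blast

lemma unit_weight_subgroup:
  assumes "subgroup S G"
  shows "unit_weight i S"
  unfolding unit_weight_def
  using assms finite_subgroup i_nonneg i_le_1 i_eq_0_iff subgroup.mem_carrier subgroup.one_closed
  by (metis one_closed)

lemma subgroup_level:
  assumes S: "subgroup S G"
  shows "0 < r \<Longrightarrow> subgroup (below i S r) G" "0 \<le> r \<Longrightarrow> subgroup (upto_level i S r) G"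
proof -
  interpret S: subgroup S G by fact
  have i1: "i \<one> = 0" using i_eq_0_iff by simp
  show "subgroup (below i S r) G" if "0 < r"
  proof (unfold_locales, goal_cases)
    case (2 x y)
    then show ?case using i_mult[of x y] by auto
  qed (use that i1 i_inv in auto)
  show "subgroup (upto_level i S r) G" if "0 \<le> r"
  proof (unfold_locales, goal_cases)
    case (2 x y)
    then show ?case using i_mult[of x y] by auto
  qed (use that i1 i_inv in auto)
qed

text \<open>The group form of simple ramification. Equality below \<beta> says that the slope is 1
  to the left of the break-point; the product condition says that it is [T : S] to the
  right.\<close>

definition simple_step :: "'a set \<Rightarrow> 'a set \<Rightarrow> real \<Rightarrow> bool" where
  "simple_step S T \<beta> \<longleftrightarrow> \<beta> \<in> {0<..<1} \<and> below i T \<beta> = below i S \<beta> \<and>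
     T = S <#> upto_level i T \<beta> \<and> S \<noteq> T"

lemma simple_stepD:
  assumes "simple_step S T \<beta>"
  shows "0 < \<beta>" "\<beta> < 1" "below i T \<beta> = below i S \<beta>" "T = S <#> upto_level i T \<beta>" "S \<noteq> T"
  using assms unfolding simple_step_def greaterThanLessThan_iff by blast+

lemma simple_step_subset:
  assumes "simple_step S T \<beta>" "subgroup S G" "subgroup T G"
  shows "S \<subseteq> T"
proof
  fix x assume "x \<in> S"
  have "\<one> \<in> upto_level i T \<beta>"
    using subgroup.one_closed[OF assms(3)] i_eq_0_iff[of \<one>] simple_stepD(1)[OF assms(1)] by simp
  then have "x \<otimes> \<one> \<in> S <#> upto_level i T \<beta>" using \<open>x \<in> S\<close> unfolding set_mult_def by blast
  then show "x \<in> T" using subgroup.mem_carrier[OF assms(2) \<open>x \<in> S\<close>] simple_stepD(4)[OF assms(1)] by simp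
qed

text \<open>A group N between the level \<beta> of T and T itself satisfies S N = T, so the product
  formula gives |N| / |S \<inter> N| = |T| / |S|. Taking levels for N shows that the slope has
  already reached the index.\<close>

lemma card_level_ratio:
  assumes S: "subgroup S G" and T: "subgroup T G" and "S \<subseteq> T" and ST: "T = S <#> upto_level i T \<beta>"
    and N: "subgroup N G" "upto_level i T \<beta> \<subseteq> N" "N \<subseteq> T"
  shows "card N * card S = card T * card (S \<inter> N)"
proof -
  have "S <#> N = T"
  proof
    show "S <#> N \<subseteq> T"
      using \<open>S \<subseteq> T\<close> N(3) subgroup.m_closed[OF T] unfolding set_mult_def by blast
    show "T \<subseteq> S <#> N" using mono_set_mult[OF order_refl N(2), of G S] ST by blast
  qed
  then show ?thesis
    using card_subgroup_set_mult[OF S N(1) finite_subgroup[OF S] finite_subgroup[OF N(1)]]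
    by (simp add: mult.commute)
qed

text \<open>The slope is 1 up to \<beta> and [T : S] afterwards, and these differ because S \<noteq>
  T. The second conclusion is the equality of degree and field degree with denominators
  cleared.\<close>

lemma simple_step_jumps:
  assumes S: "subgroup S G" and T: "subgroup T G" and st: "simple_step S T \<beta>"
  shows "jumps i S T = {\<beta>}"
    and "card (below i T 1) * card S = card T * card (below i S 1)"
proof -
  have \<beta>: "0 < \<beta>" "\<beta> < 1" and low: "below i T \<beta> = below i S \<beta>"
    and ST: "T = S <#> upto_level i T \<beta>" and ne: "S \<noteq> T"
    using simple_stepD[OF st] .
  note sub = simple_step_subset[OF st S T]
  have pos: "0 < card S" "0 < card T"
    using subgroup.finite_imp_card_positive[OF S finite_carrier] subgroup.finite_imp_card_positive[OF T finite_carrier] .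
  have b: "card (below i T r) * card S = card T * card (below i S r)" if "r > \<beta>" for r
  proof -
    have "S \<inter> below i T r = below i S r" using sub by blast
    moreover have "upto_level i T \<beta> \<subseteq> below i T r" using that by auto
    ultimately show ?thesis
      using card_level_ratio[OF S T sub ST subgroup_level(1)[OF T, of r]] that \<beta> by simp
  qed
  have u: "card (upto_level i T r) * card S = card T * card (upto_level i S r)" if "r \<ge> \<beta>" for r
  proof -
    have "S \<inter> upto_level i T r = upto_level i S r" using sub by blast
    moreover have "upto_level i T \<beta> \<subseteq> upto_level i T r" using that by auto
    ultimately show ?thesis
      using card_level_ratio[OF S T sub ST subgroup_level(2)[OF T, of r]] that \<beta> by simp
  qed
  show "card (below i T 1) * card S = card T * card (below i S 1)" using b \<beta> by simp
  show "jumps i S T = {\<beta>}"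
  proof (intro equalityI subsetI)
    fix r assume r: "r \<in> jumps i S T"
    then have J: "card (below i T r) * card (upto_level i S r) \<noteq> card (upto_level i T r) * card (below i S r)"
      by (simp add: jumps_def)
    have "\<not> r < \<beta>"
    proof
      assume "r < \<beta>"
      then have "below i T r = below i S r" "upto_level i T r = upto_level i S r"
      proof -
        have "below i Y r = {\<sigma> \<in> below i Y \<beta>. i \<sigma> < r}" "upto_level i Y r = {\<sigma> \<in> below i Y \<beta>. i \<sigma> \<le> r}" for Y
          using \<open>r < \<beta>\<close> by auto
        from this[of T] this[of S] show "below i T r = below i S r" "upto_level i T r = upto_level i S r"
          unfolding low by simp_all
      qed
      then show False using J by simp
    qed
    moreover have "\<not> r > \<beta>"
    proof
      assume "r > \<beta>"
      \<comment> \<open>Both one-sided slopes at r equal |T| / |S|. To avoid fractions the equation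
        is multiplied by |S| |T|, which is cancelled at the end.\<close>
      then have "(card (below i T r) * card (upto_level i S r)) * (card S * card T) =
         (card (below i T r) * card S) * (card T * card (upto_level i S r))"
        by (simp add: algebra_simps)
      also have "\<dots> = (card T * card (below i S r)) * (card (upto_level i T r) * card S)"
        using b[of r] u[of r] \<open>r > \<beta>\<close> by simp
      also have "\<dots> = (card (upto_level i T r) * card (below i S r)) * (card S * card T)"
        by (simp add: algebra_simps)
      finally show False using J pos by simp
    qed
    ultimately show "r \<in> {\<beta>}" by simp
  next
    fix r assume "r \<in> {\<beta>}"
    moreover have "card (below i T \<beta>) * card (upto_level i S \<beta>) \<noteq> card (upto_level i T \<beta>) * card (below i S \<beta>)"
    proof
      assume "card (below i T \<beta>) * card (upto_level i S \<beta>) = card (upto_level i T \<beta>) * card (below i S \<beta>)"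
      moreover have "card (below i S \<beta>) > 0"
        using subgroup.finite_imp_card_positive[OF subgroup_level(1)[OF S \<beta>(1)] finite_carrier] .
      ultimately have "card (upto_level i S \<beta>) = card (upto_level i T \<beta>)" using low by simp
      moreover have "card (upto_level i S \<beta>) > 0"
        using subgroup.finite_imp_card_positive[OF subgroup_level(2)[OF S] finite_carrier] \<beta> by simp
      ultimately have "card S = card T" using u[of \<beta>] by simp
      then show False using ne sub finite_subgroup[OF T] card_subset_eq by blast
    qed
    ultimately show "r \<in> jumps i S T" using \<beta> by (simp add: jumps_def)
  qed
qed

text \<open>The slope can change only at \<beta>. Starting from small levels, where T and S agree,
  it stays 1 until \<beta>; starting from the level 1, where the degree condition gives [T : S], it
  keeps that value down to \<beta>.\<close>

lemma simple_step_of_unique_jump: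
  assumes S: "subgroup S G" and T: "subgroup T G" and sub: "S \<subseteq> T"
    and J: "jumps i S T = {\<beta>}" and deg: "card (below i T 1) * card S = card T * card (below i S 1)"
  shows "simple_step S T \<beta>"
proof -
  have bJ: "\<beta> \<in> jumps i S T" using J by simp
  then have \<beta>: "0 < \<beta>" "\<beta> < 1" by (simp_all add: jumps_def)
  have nojump: "card (below i T r) * card (upto_level i S r) = card (upto_level i T r) * card (below i S r)"
    if "0 < r" "r < 1" "r \<noteq> \<beta>" for r
  proof -
    have "r \<notin> jumps i S T" using J that by simp
    then show ?thesis using that by (simp add: jumps_def)
  qed
  note fin = finite_subgroup[OF S] finite_subgroup[OF T]
  have pos: "card (below i S r) > 0" "card (upto_level i S r) > 0" if "r > 0" for r
    using subgroup_level[OF S, of r] that subgroup.finite_imp_card_positive[OF _ finite_carrier] by auto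
  have low: "below i T \<beta> = below i S \<beta>"
  proof (rule ccontr)
    assume "below i T \<beta> \<noteq> below i S \<beta>"
    then have ne: "i ` {\<sigma> \<in> T - S. i \<sigma> < \<beta>} \<noteq> {}" using sub by blast
    \<comment> \<open>The first weight at which T has an element outside S. Below r the groups
      agree, and as there is no jump at r, they agree up to r as well: a contradiction.\<close>
    define r where "r = Min (i ` {\<sigma> \<in> T - S. i \<sigma> < \<beta>})"
    have "r \<in> i ` {\<sigma> \<in> T - S. i \<sigma> < \<beta>}" unfolding r_def using ne fin by (intro Min_in) auto
    then obtain \<sigma> where \<sigma>: "\<sigma> \<in> T - S" "i \<sigma> < \<beta>" "i \<sigma> = r" by auto
    have min: "r \<le> i \<tau>" if "\<tau> \<in> T - S" "i \<tau> < \<beta>" for \<tau>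
      unfolding r_def using that fin by (intro Min_le) auto
    have "\<sigma> \<noteq> \<one>" using \<sigma>(1) subgroup.one_closed[OF S] by auto
    then have "0 < r" using i_nonneg[of \<sigma>] i_eq_0_iff[of \<sigma>] \<sigma> subgroup.mem_carrier[OF T] by fastforce
    have "below i T r = below i S r"
    proof (intro equalityI subsetI)
      fix \<tau> assume \<tau>: "\<tau> \<in> below i T r"
      then have "\<tau> \<in> S" using min[of \<tau>] \<sigma>(2,3) by fastforce
      then show "\<tau> \<in> below i S r" using \<tau> by simp
    qed (use sub in auto)
    then have "card (upto_level i S r) = card (upto_level i T r)"
      using nojump[of r] \<open>0 < r\<close> \<sigma> \<beta> pos(1)[of r] by simp
    then have "upto_level i S r = upto_level i T r"
      using sub fin by (intro card_subset_eq) auto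
    then show False using \<sigma> by auto
  qed
  have "T \<subseteq> S <#> upto_level i T \<beta>"
  proof -
    \<comment> \<open>The weights at which the slope on the right is already the full index. The
      degree condition puts the largest weight below 1 into \<open>R\<close>; its minimum will turn
      out to be at most \<beta>.\<close>
    define R where "R = {r \<in> i ` T. r < 1 \<and> card (upto_level i T r) * card S = card T * card (upto_level i S r)}"
    have finR: "finite R" unfolding R_def using fin by auto
    \<comment> \<open>The predecessor of s among the weights in T; it exists because the identity
      has weight 0.\<close>
    define m where "m s = Max (i ` below i T s)" for s
    have m: "m s \<in> i ` T" "m s < s" "upto_level i T (m s) = below i T s" "upto_level i S (m s) = below i S s"
      if "0 < s" for s
    proof -
      have ne: "i ` below i T s \<noteq> {}"
        using subgroup.one_closed[OF T] that i_eq_0_iff[of \<one>] by force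
      have f: "finite (i ` below i T s)" using fin by auto
      have "m s \<in> i ` below i T s" unfolding m_def using ne f by (rule Max_in[rotated])
      then show a: "m s \<in> i ` T" "m s < s" by auto
      have b: "i \<sigma> \<le> m s" if "\<sigma> \<in> T" "i \<sigma> < s" for \<sigma>
        unfolding m_def using that f by (intro Max_ge) auto
      show "upto_level i T (m s) = below i T s" "upto_level i S (m s) = below i S s"
        using a(2) b sub by (auto intro: order_le_less_trans)
    qed
    have "m 1 \<in> R" unfolding R_def using m[of 1] deg by simp
    define r where "r = Min R"
    have "r \<in> R" unfolding r_def using finR \<open>m 1 \<in> R\<close> by (intro Min_in) auto
    have r0: "0 \<le> r" using \<open>r \<in> R\<close> i_nonneg subgroup.mem_carrier[OF T] unfolding R_def by auto
    \<comment> \<open>If r > \<beta>, the absence of a jump at r carries the full index from the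
      right of r to its left, that is, to the predecessor weight, against minimality.\<close>
    have "r \<le> \<beta>"
    proof (rule ccontr)
      assume r: "\<not> r \<le> \<beta>"
      have r': "0 < r" "r < 1" using r \<beta> \<open>r \<in> R\<close> by (auto simp: R_def)
      have e: "card (upto_level i T r) * card S = card T * card (upto_level i S r)"
        using \<open>r \<in> R\<close> by (simp add: R_def)
      have "(card (below i T r) * card S) * card (upto_level i S r) = (card (below i T r) * card (upto_level i S r)) * card S"
        by simp
      also have "\<dots> = (card (upto_level i T r) * card S) * card (below i S r)"
        using nojump[of r] r r' by simp
      also have "\<dots> = (card T * card (below i S r)) * card (upto_level i S r)"
        unfolding e by simp
      finally have "card (below i T r) * card S = card T * card (below i S r)"
        using pos(2)[OF r'(1)] by simp
      then have "m r \<in> R" unfolding R_def using m[OF r'(1)] r' by simp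
      then have "r \<le> m r" unfolding r_def using finR by (intro Min_le)
      then show False using m(2)[OF r'(1)] by simp
    qed
    \<comment> \<open>By the choice of r this level has index [T : S] over its intersection with S,
      so the product formula makes S times it as large as T.\<close>
    let ?N = "upto_level i T r"
    have N: "subgroup ?N G" by (rule subgroup_level(2)[OF T r0])
    have SN: "S \<inter> ?N = upto_level i S r" using sub by blast
    have "card (S <#> ?N) * card (upto_level i S r) = card T * card (upto_level i S r)"
      using card_subgroup_set_mult[OF S N fin(1) finite_subgroup[OF N]] \<open>r \<in> R\<close>
      unfolding SN R_def by (simp add: mult.commute)
    moreover have "card (upto_level i S r) > 0"
      using subgroup.finite_imp_card_positive[OF subgroup_level(2)[OF S r0] finite_carrier] .
    ultimately have "card (S <#> ?N) = card T" by simp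
    moreover have "S <#> ?N \<subseteq> T"
      using sub subgroup.m_closed[OF T] unfolding set_mult_def by blast
    ultimately have "S <#> ?N = T" using fin(2) by (simp add: card_subset_eq)
    moreover have "S <#> ?N \<subseteq> S <#> upto_level i T \<beta>"
      using \<open>r \<le> \<beta>\<close> by (intro mono_set_mult) auto
    ultimately show ?thesis by simp
  qed
  moreover have "S <#> upto_level i T \<beta> \<subseteq> T"
    using sub subgroup.m_closed[OF T] unfolding set_mult_def by blast
  moreover have "S \<noteq> T" using bJ by (auto simp: jumps_def)
  ultimately show ?thesis using \<beta> low by (simp add: simple_step_def)
qed

text \<open>Thus \<beta> is the least weight in \<open>T - S\<close> and can be read off from the
  two groups. It is attained, since otherwise the level would lie in S and the product S times the
  level could not exceed S.\<close>

lemma simple_step_bounds: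
  assumes S: "subgroup S G" and T: "subgroup T G" and st: "simple_step S T \<beta>"
  shows "\<And>\<tau>. \<tau> \<in> T - S \<Longrightarrow> \<beta> \<le> i \<tau>" and "\<exists>\<tau>\<in>T - S. i \<tau> = \<beta>"
proof -
  show ge: "\<beta> \<le> i \<tau>" if "\<tau> \<in> T - S" for \<tau>
  proof (rule ccontr)
    assume "\<not> \<beta> \<le> i \<tau>"
    then have "\<tau> \<in> below i T \<beta>" using that by simp
    then show False using simple_stepD(3)[OF st] that by blast
  qed
  have "\<not> upto_level i T \<beta> \<subseteq> S"
  proof
    assume "upto_level i T \<beta> \<subseteq> S"
    then have "S <#> upto_level i T \<beta> \<subseteq> S"
      using subgroup.m_closed[OF S] unfolding set_mult_def by blast
    then show False using simple_stepD(4,5)[OF st] simple_step_subset[OF st S T] by blast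
  qed
  then obtain \<tau> where "\<tau> \<in> T - S" "i \<tau> \<le> \<beta>" by blast
  then show "\<exists>\<tau>\<in>T - S. i \<tau> = \<beta>" using ge by force
qed

section \<open>Chains of simple steps with increasing levels\<close>

text \<open>The groups grow while the fields of the tower shrink, so the list orders agree.
  \<open>b j\<close> is the level of the step from index j to j + 1; two consecutive steps need
  \<open>Suc (Suc j) < length Ss\<close>. The last condition expresses that K'/K has identity
  Herbrand function.\<close>

definition canonical_chain :: "'a set list \<Rightarrow> (nat \<Rightarrow> real) \<Rightarrow> bool" where
  "canonical_chain Ss b \<longleftrightarrow> Ss \<noteq> [] \<and> (\<forall>S\<in>set Ss. subgroup S G) \<and>
     (\<forall>j. Suc j < length Ss \<longrightarrow> simple_step (Ss ! j) (Ss ! Suc j) (b j)) \<and>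
     (\<forall>j. Suc (Suc j) < length Ss \<longrightarrow> b j < b (Suc j)) \<and>
     (\<forall>\<sigma>\<in>carrier G - last Ss. i \<sigma> = 1)"

lemma canonical_chain_ConsD:
  assumes "canonical_chain (S # T # Ss) b"
  shows "subgroup S G" "subgroup T G" "simple_step S T (b 0)" "canonical_chain (T # Ss) (b \<circ> Suc)"
    "Ss \<noteq> [] \<Longrightarrow> b 0 < b 1"
proof -
  have st: "simple_step ((S # T # Ss) ! j) ((S # T # Ss) ! Suc j) (b j)" if "j < Suc (length Ss)" for j
    using assms that by (simp add: canonical_chain_def)
  have inc: "b j < b (Suc j)" if "j < length Ss" for j
    using assms that by (simp add: canonical_chain_def)
  show "subgroup S G" "subgroup T G" using assms by (auto simp: canonical_chain_def)
  show "simple_step S T (b 0)" using st[of 0] by simp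
  show "b 0 < b 1" if "Ss \<noteq> []" using inc[of 0] that by simp
  show "canonical_chain (T # Ss) (b \<circ> Suc)"
    using assms st inc unfolding canonical_chain_def by auto
qed

text \<open>An element outside S either enters at some step, whose level bounds its weight from
  below and is at least \<open>b 0\<close>, or never enters and has weight 1. The value 1 for a
  chain without steps covers the second case.\<close>

lemma canonical_chain_lower_bound:
  assumes "canonical_chain (S # Ss) b" "\<sigma> \<in> carrier G - S"
  shows "(if Ss = [] then 1 else b 0) \<le> i \<sigma>"
  using assms
proof (induction Ss arbitrary: S b)
  case Nil
  then show ?case by (auto simp: canonical_chain_def)
next
  case (Cons T Ss)
  note D = canonical_chain_ConsD[OF Cons.prems(1)]
  show ?case
  proof (cases "\<sigma> \<in> T")
    case True
    then show ?thesis using simple_step_bounds(1)[OF D(1-3)] Cons.prems(2) by simp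
  next
    case False
    then have "(if Ss = [] then 1 else b 1) \<le> i \<sigma>"
      using Cons.IH[OF D(4)] Cons.prems(2) by (simp split: if_splits)
    then show ?thesis using simple_stepD(2)[OF D(3)] D(5) by (auto split: if_splits)
  qed
qed

text \<open>The first level and the second group depend on S alone. An element outside T has weight
  at least the next level, or 1, both larger than \<open>b 0\<close>; hence the whole level
  \<open>b 0\<close> of G lies in T.\<close>

lemma canonical_chain_step:
  assumes "canonical_chain (S # T # Ss) b"
  shows "b 0 = Min (i ` (carrier G - S))" "b 0 < 1" "T = S <#> upto_level i (carrier G) (b 0)"
    "carrier G - S \<noteq> {}"
proof -
  note D = canonical_chain_ConsD[OF assms]
  obtain \<tau> where \<tau>: "\<tau> \<in> T - S" "i \<tau> = b 0" using simple_step_bounds(2)[OF D(1-3)] by blast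
  have TG: "T \<subseteq> carrier G" using D(2) by (rule subgroup.subset)
  show "carrier G - S \<noteq> {}" using \<tau> TG by blast
  show "b 0 = Min (i ` (carrier G - S))"
    using \<tau> TG canonical_chain_lower_bound[OF assms] finite_carrier
    by (intro Min_eqI[symmetric]) (auto intro!: image_eqI[of _ _ \<tau>])
  show "b 0 < 1" using simple_stepD(2)[OF D(3)] .
  have "upto_level i (carrier G) (b 0) \<subseteq> T"
  proof
    fix \<sigma> assume \<sigma>: "\<sigma> \<in> upto_level i (carrier G) (b 0)"
    show "\<sigma> \<in> T"
    proof (rule ccontr)
      assume "\<sigma> \<notin> T"
      then have "(if Ss = [] then 1 else b 1) \<le> i \<sigma>" using canonical_chain_lower_bound[OF D(4), of \<sigma>] \<sigma> by (simp split: if_splits)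
      then show False using simple_stepD(2)[OF D(3)] D(5) \<sigma> by (auto split: if_splits)
    qed
  qed
  then have "upto_level i T (b 0) = upto_level i (carrier G) (b 0)" using TG by blast
  then show "T = S <#> upto_level i (carrier G) (b 0)" using simple_stepD(4)[OF D(3)] by metis
qed

text \<open>The second group is forced by the first. Chains also stop at the same place: when all
  weights outside S are 1 their minimum is not below 1, as a further step would require.\<close>

lemma canonical_chain_unique:
  assumes "canonical_chain (S # Ss) b" "canonical_chain (S # Ss') b'"
  shows "Ss = Ss'"
  using assms
proof (induction Ss arbitrary: S b b' Ss')
  case Nil
  show ?case
  proof (cases Ss')
    case (Cons T Ss)
    have "\<forall>\<sigma>\<in>carrier G - S. i \<sigma> = 1" using Nil(1) by (simp add: canonical_chain_def)
    then have "Min (i ` (carrier G - S)) = 1" if "carrier G - S \<noteq> {}"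
      using that by (metis (no_types, lifting) Min_singleton image_constant image_cong ex_in_conv)
    then show ?thesis using canonical_chain_step[OF Nil(2)[unfolded Cons]] by simp
  qed simp
next
  case (Cons T Ss)
  show ?case
  proof (cases Ss')
    case Nil
    have "\<forall>\<sigma>\<in>carrier G - S. i \<sigma> = 1" using Cons.prems(2) Nil by (simp add: canonical_chain_def)
    then have "Min (i ` (carrier G - S)) = 1" if "carrier G - S \<noteq> {}"
      using that by (metis (no_types, lifting) Min_singleton image_constant image_cong ex_in_conv)
    then show ?thesis using canonical_chain_step[OF Cons.prems(1)] by simp
  next
    case (Cons T' Ss'')
    note 1 = canonical_chain_step[OF Cons.prems(1)] and 2 = canonical_chain_step[OF Cons.prems(2)[unfolded Cons]]
    have "T = T'" using 1(1,3) 2(1,3) by simp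
    moreover have "Ss = Ss''"
      using Cons.IH canonical_chain_ConsD(4)[OF Cons.prems(1)]
        canonical_chain_ConsD(4)[OF Cons.prems(2)[unfolded Cons]] \<open>T = T'\<close> by blast
    ultimately show ?thesis using Cons by simp
  qed
qed

text \<open>The level is taken in the full group, where conjugation invariance makes it
  normal.\<close>

lemma subgroup_level_mult:
  assumes S: "subgroup S G" and "0 \<le> r"
  shows "subgroup (S <#> upto_level i (carrier G) r) G"
proof -
  have "upto_level i (carrier G) r \<lhd> G"
    unfolding normal_inv_iff using subgroup_level(2)[OF subgroup_self assms(2)] i_conj by auto
  then show ?thesis using mult_norm_subgroup[OF _ S] commut_normal[OF S] by simp
qed

text \<open>The forced step always works: with \<beta> the least weight outside S, the product of S
  with the level \<beta> is a strictly larger group, and the induction runs on the number of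
  elements outside.\<close>

lemma canonical_chain_exists:
  assumes "subgroup S G"
  shows "\<exists>Ss b. canonical_chain (S # Ss) b"
  using assms
proof (induction "card (carrier G - S)" arbitrary: S rule: less_induct)
  case less
  note S = less.prems
  interpret S: subgroup S G by fact
  show ?case
  proof (cases "\<forall>\<sigma>\<in>carrier G - S. i \<sigma> = 1")
    case True
    then have "canonical_chain [S] b" for b using S by (simp add: canonical_chain_def)
    then show ?thesis by blast
  next
    case False
    define \<beta> where "\<beta> = Min (i ` (carrier G - S))"
    have f: "finite (i ` (carrier G - S))" "i ` (carrier G - S) \<noteq> {}" using False finite_carrier by auto
    obtain \<sigma> where \<sigma>: "\<sigma> \<in> carrier G - S" "i \<sigma> = \<beta>" using Min_in[OF f] by (auto simp: \<beta>_def)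
    have min: "\<beta> \<le> i \<tau>" if "\<tau> \<in> carrier G - S" for \<tau> using that f by (simp add: \<beta>_def)
    have "\<sigma> \<noteq> \<one>" using \<sigma>(1) by auto
    then have b0: "0 < \<beta>" using i_nonneg[of \<sigma>] i_eq_0_iff[of \<sigma>] \<sigma> by fastforce
    have b1: "\<beta> < 1" using False min i_le_1 by force
    define T where "T = S <#> upto_level i (carrier G) \<beta>"
    have T: "subgroup T G" unfolding T_def using S b0 by (intro subgroup_level_mult) auto
    have NT: "upto_level i (carrier G) \<beta> \<subseteq> T"
    proof
      fix x assume x: "x \<in> upto_level i (carrier G) \<beta>"
      then have "\<one> \<otimes> x \<in> T" unfolding T_def set_mult_def using S.one_closed by blast
      then show "x \<in> T" using x by simp
    qed
    have TG: "T \<subseteq> carrier G" using T by (rule subgroup.subset)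
    have ST: "simple_step S T \<beta>" unfolding simple_step_def
    proof (intro conjI)
      have "upto_level i T \<beta> = upto_level i (carrier G) \<beta>" using NT TG by blast
      then show "T = S <#> upto_level i T \<beta>" unfolding T_def by simp
      have sub: "S \<subseteq> T"
      proof
        fix x assume x: "x \<in> S"
        have "\<one> \<in> upto_level i (carrier G) \<beta>" using i_eq_0_iff[of \<one>] b0 by simp
        then have "x \<otimes> \<one> \<in> T" unfolding T_def set_mult_def using x by blast
        then show "x \<in> T" using x by simp
      qed
      show "below i T \<beta> = below i S \<beta>" using min TG sub by (force simp: not_less)
      show "S \<noteq> T" using \<sigma> NT by auto
    qed (use b0 b1 in auto)
    have "carrier G - T \<subset> carrier G - S"
      using simple_step_subset[OF ST S T] \<sigma> NT by auto
    then have "card (carrier G - T) < card (carrier G - S)" using finite_carrier by (intro psubset_card_mono) auto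
    then obtain Ss b where C: "canonical_chain (T # Ss) b" using less.hyps T by blast
    \<comment> \<open>The next level is the weight of an element outside T, whereas everything of
      weight at most \<beta> is in T.\<close>
    have gt: "\<beta> < b 0" if ne: "Ss \<noteq> []"
    proof -
      obtain U Us where U: "Ss = U # Us" using ne list.exhaust by blast
      note D = canonical_chain_ConsD[OF C[unfolded U]]
      obtain \<tau> where \<tau>: "\<tau> \<in> U - T" "i \<tau> = b 0" using simple_step_bounds(2)[OF D(1-3)] by blast
      then have "\<tau> \<in> carrier G" using subgroup.mem_carrier[OF D(2)] by blast
      then show ?thesis using \<tau> NT by force
    qed
    have "canonical_chain (S # T # Ss) (case_nat \<beta> b)"
      unfolding canonical_chain_def
    proof (intro conjI allI impI)
      fix j assume j: "Suc j < length (S # T # Ss)"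
      show "simple_step ((S # T # Ss) ! j) ((S # T # Ss) ! Suc j) (case_nat \<beta> b j)"
      proof (cases j)
        case 0 then show ?thesis using ST by simp
      next
        case (Suc k) then show ?thesis using C j by (simp add: canonical_chain_def)
      qed
    next
      fix j assume j: "Suc (Suc j) < length (S # T # Ss)"
      show "(case_nat \<beta> b j :: real) < case_nat \<beta> b (Suc j)"
      proof (cases j)
        case 0 then show ?thesis using gt j by auto
      next
        case (Suc k) then show ?thesis using C j by (simp add: canonical_chain_def)
      qed
    qed (use C S in \<open>auto simp: canonical_chain_def\<close>)
    then show ?thesis by blast
  qed
qed

end

section \<open>Galois theory over infinite fields\<close>

context ring
begin

lemma dimension_subset:
  assumes "subfield K R" "dimension m K V" "dimension n K W" "V \<subseteq> W"
  shows "m \<le> n" "m = n \<Longrightarrow> V = W"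
proof -
  obtain Us where Us: "independent K Us" "length Us = m" "Span K Us = V"
    using exists_base[OF assms(1,2)] by blast
  have "set Us \<subseteq> V"
    using Span_base_incl[OF assms(1) independent_in_carrier[OF Us(1)]] Us(3) by simp
  then have "set Us \<subseteq> W" using assms(4) by blast
  then show "m \<le> n" "m = n \<Longrightarrow> V = W"
    using independent_length_le_dimension[OF assms(1,3) Us(1)]
      independent_length_eq_dimension[OF assms(1,3) Us(1)] Us(2,3) by auto
qed

lemma subfield_is_subalgebra:
  assumes "subfield K R" "subfield F R" "K \<subseteq> F"
  shows "subalgebra K F R"
proof -
  have "subring F R" using assms(2) by (rule subfieldE(1))
  then have "subgroup F (add_monoid R)" using subring.axioms(1) by blast
  then show ?thesis
    unfolding subalgebra_def subalgebra_axioms_def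
    using subringE(6)[OF \<open>subring F R\<close>] assms(3) by blast
qed

text \<open>F is a K-subalgebra of M, hence finite over K; a K-basis of M also spans M over
  F.\<close>

lemma finite_dimension_tower:
  assumes K: "subfield K R" and F: "subfield F R" and M: "subfield M R" and "K \<subseteq> F" "F \<subseteq> M"
    and fin: "finite_dimension K M"
  shows "finite_dimension K F" "finite_dimension F M" "dim K M = dim K F * dim F M"
proof -
  show KF: "finite_dimension K F"
    using subalbegra_incl_imp_finite_dimension[OF K fin subfield_is_subalgebra[OF K F]] assms by blast
  obtain n where "dimension n K M" using fin by auto
  then obtain Us where Us: "set Us \<subseteq> carrier R" "Span K Us = M"
    using exists_base[OF K] by blast
  have "set Us \<subseteq> M" using Span_base_incl[OF K Us(1)] Us(2) by simp
  then have "Span F Us \<subseteq> M"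
    by (rule subalgebra_Span_incl[OF F subfield_is_subalgebra[OF F M \<open>F \<subseteq> M\<close>]])
  moreover have "Span K Us \<subseteq> Span F Us"
  proof (rule subalgebra_Span_incl[OF K])
    have "subalgebra F (Span F Us) R" by (rule Span_is_subalgebra[OF F Us(1)])
    then show "subalgebra K (Span F Us) R"
      using \<open>K \<subseteq> F\<close> unfolding subalgebra_def subalgebra_axioms_def by blast
    show "set Us \<subseteq> Span F Us" by (rule Span_base_incl[OF F Us(1)])
  qed
  ultimately have "Span F Us = M" using Us(2) by simp
  then show FM: "finite_dimension F M" using Span_finite_dimension[OF F Us(1)] by simp
  show "dim K M = dim K F * dim F M"
    using telescopic_base_dim(2)[OF K F KF FM] by (simp add: over_def)
qed

end

section \<open>Minimal polynomials and their roots\<close>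

context domain
begin

lemma Irr_eval_zero_transfer:
  assumes "subfield K R" "x \<in> carrier R" "(algebraic over K) x" "p \<in> carrier (K[X])" "eval p x = \<zero>"
    and "y \<in> carrier R" "eval (Irr K x) y = \<zero>"
  shows "eval p y = \<zero>"
  using pdivides_imp_root_sharing[OF carrier_polynomial_shell[OF subfieldE(1)[OF assms(1)] IrrE(1)[OF assms(1-3)]]
      Irr_minimal[OF assms(1-5)] assms(6,7)] .

text \<open>For conjugate x and y this makes the assignment \<open>eval p x\<close> to
  \<open>eval p y\<close> well defined, which is how automorphisms are built below.\<close>

lemma Irr_eval_eq_transfer:
  assumes K: "subfield K R" and x: "x \<in> carrier R" "(algebraic over K) x"
    and p: "p \<in> carrier (K[X])" and q: "q \<in> carrier (K[X])" and eq: "eval p x = eval q x"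
    and y: "y \<in> carrier R" "eval (Irr K x) y = \<zero>"
  shows "eval p y = eval q y"
proof -
  note sub = subfieldE(1)[OF K]
  interpret UP: domain "K[X]" by (rule univ_poly_is_domain[OF sub])
  let ?d = "p \<ominus>\<^bsub>K[X]\<^esub> q"
  have ev: "eval ?d z = eval p z \<ominus> eval q z" if "z \<in> carrier R" for z
  proof -
    interpret ring_hom_ring "K[X]" R "\<lambda>p. eval p z" by (rule eval_ring_hom[OF sub that])
    show ?thesis using p q by (simp add: a_minus_def)
  qed
  have cl: "eval r z \<in> carrier R" if "r \<in> carrier (K[X])" "z \<in> carrier R" for r z
    using ring_hom_closed[OF eval_is_hom[OF sub that(2)] that(1)] .
  have "eval ?d x = \<zero>" using ev[OF x(1)] eq cl[OF q x(1)] by (simp add: a_minus_def r_neg)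
  then have "eval ?d y = \<zero>"
    using Irr_eval_zero_transfer[OF K x _ _ y] p q by simp
  then have "eval p y \<ominus> eval q y = \<zero>" using ev[OF y(1)] by simp
  then show ?thesis using cl[OF p y(1)] cl[OF q y(1)] by simp
qed

lemma Irr_pdivides_Irr:
  assumes E: "subfield E R" and F: "subfield F R" and "E \<subseteq> F" and x: "x \<in> carrier R" "(algebraic over E) x"
  shows "(Irr F x) pdivides (Irr E x)"
proof (rule Irr_minimal[OF F x(1)])
  show "(algebraic over F) x" using algebraic_mono[OF \<open>E \<subseteq> F\<close> x(2)] .
  show "Irr E x \<in> carrier (F[X])"
    using IrrE(1)[OF E x] \<open>E \<subseteq> F\<close> unfolding univ_poly_def polynomial_def by auto
  show "eval (Irr E x) x = \<zero>" using IrrE(4)[OF E x] .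
qed

lemma Irr_in_poly_ring:
  assumes "subfield K R" "x \<in> carrier R" "(algebraic over K) x"
  shows "Irr K x \<in> carrier (poly_ring R)" "Irr K x \<noteq> []"
proof -
  show "Irr K x \<in> carrier (poly_ring R)"
    using carrier_polynomial_shell[OF subfieldE(1)[OF assms(1)] IrrE(1)[OF assms]] .
  show "Irr K x \<noteq> []"
    using pirreducibleE(1)[OF subfieldE(1)[OF assms(1)] IrrE(1,2)[OF assms]] .
qed

lemma is_root_Irr_iff:
  assumes "subfield K R" "x \<in> carrier R" "(algebraic over K) x"
  shows "is_root (Irr K x) a \<longleftrightarrow> a \<in> carrier R \<and> eval (Irr K x) a = \<zero>"
  using Irr_in_poly_ring(2)[OF assms] by (simp add: is_root_def)

lemma is_root_Irr_self:
  assumes "subfield K R" "x \<in> carrier R" "(algebraic over K) x"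
  shows "is_root (Irr K x) x"
  using is_root_Irr_iff[OF assms] IrrE(4)[OF assms] assms(2) by simp

text \<open>The minimal polynomial over the larger field divides the one over the smaller field.
  This carries separability over to intermediate ground fields.\<close>

lemma alg_mult_Irr_le:
  assumes E: "subfield E R" and F: "subfield F R" and "E \<subseteq> F" and x: "x \<in> carrier R" "(algebraic over E) x"
  shows "alg_mult (Irr F x) a \<le> alg_mult (Irr E x) a"
proof -
  have xF: "(algebraic over F) x" using algebraic_mono[OF \<open>E \<subseteq> F\<close> x(2)] .
  note c = Irr_in_poly_ring[OF E x] Irr_in_poly_ring[OF F x(1) xF]
  have "roots (Irr F x) \<subseteq># roots (Irr E x)"
    using pdivides_imp_roots_incl[OF c(3,1,2) Irr_pdivides_Irr[OF E F \<open>E \<subseteq> F\<close> x]] .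
  then show ?thesis using c alg_mult_eq_count_roots mset_subset_eq_count by metis
qed

text \<open>Elements of \<open>K[X]\<close> are coefficient lists without leading zero; normalizing
  allows lists such as \<open>[\<ominus> t, c]\<close> whose head may vanish.\<close>

lemma exists_poly_eval:
  assumes "subfield K R" "set p \<subseteq> K"
  obtains q where "q \<in> carrier (K[X])" "\<And>x. x \<in> carrier R \<Longrightarrow> eval q x = eval p x"
proof
  show "normalize p \<in> carrier (K[X])"
    using normalize_gives_polynomial[OF assms(2)] univ_poly_carrier by blast
  show "eval (normalize p) x = eval p x" if "x \<in> carrier R" for x
    using eval_normalize[OF _ that] assms subfieldE(3) by blast
qed

text \<open>Composition of polynomials, stated by values: the head of the list contributes a
  q^(length p). It is applied to the linear polynomial c - t X.\<close>

lemma exists_poly_comp: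
  assumes K: "subfield K R" and "set p \<subseteq> K" and q: "q \<in> carrier (K[X])"
  shows "\<exists>h\<in>carrier (K[X]). \<forall>x\<in>carrier R. eval h x = eval p (eval q x)"
  using assms(2)
proof (induction p)
  case Nil
  have "[] \<in> carrier (K[X])" by (simp add: univ_poly_def polynomial_def)
  then show ?case by (intro bexI[of _ "[]"]) auto
next
  case (Cons a p)
  note sub = subfieldE(1)[OF K]
  interpret UP: domain "K[X]" by (rule univ_poly_is_domain[OF sub])
  obtain h where h: "h \<in> carrier (K[X])" "\<And>x. x \<in> carrier R \<Longrightarrow> eval h x = eval p (eval q x)"
    using Cons by auto
  obtain c where c: "c \<in> carrier (K[X])" "\<And>x. x \<in> carrier R \<Longrightarrow> eval c x = eval [a] x"
    using exists_poly_eval[OF K, of "[a]"] Cons.prems by auto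
  let ?h = "(c \<otimes>\<^bsub>K[X]\<^esub> (q [^]\<^bsub>K[X]\<^esub> length p)) \<oplus>\<^bsub>K[X]\<^esub> h"
  have "eval ?h x = eval (a # p) (eval q x)" if x: "x \<in> carrier R" for x
  proof -
    interpret ring_hom_ring "K[X]" R "\<lambda>p. eval p x" by (rule eval_ring_hom[OF sub x])
    have "a \<in> carrier R" using Cons.prems subfieldE(3)[OF K] by auto
    then show ?thesis using c h q x by (simp add: hom_nat_pow)
  qed
  moreover have "?h \<in> carrier (K[X])" using c(1) h(1) q by simp
  ultimately show ?case by blast
qed

end

context field
begin

lemma card_roots_separable:
  assumes "p \<in> carrier (poly_ring R)" "p \<noteq> []" "splitted p" "\<And>a. a \<in> carrier R \<Longrightarrow> alg_mult p a \<le> 1"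
  shows "card {a. is_root p a} = degree p"
proof -
  have set: "set_mset (roots p) = {a. is_root p a}"
    using roots_mem_iff_is_root[OF assms(1)] by auto
  have one: "count (roots p) a = 1" if "a \<in># roots p" for a
  proof -
    have "is_root p a" using that set by blast
    then have "a \<in> carrier R" by (simp add: is_root_def)
    then have "count (roots p) a \<le> 1" using assms(4) alg_mult_eq_count_roots[OF assms(1)] by metis
    moreover have "0 < count (roots p) a" using that by simp
    ultimately show ?thesis by linarith
  qed
  have "degree p = size (roots p)" using assms(3) by (simp add: splitted_def)
  also have "\<dots> = (\<Sum>a\<in>set_mset (roots p). count (roots p) a)" by (rule size_multiset_overloaded_eq)
  also have "\<dots> = card (set_mset (roots p))" using one by simp
  finally show ?thesis using set by simp
qed

end

context algebraically_closed
begin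

lemma card_roots_Irr:
  assumes "subfield K L" "x \<in> carrier L" "(algebraic over K) x"
    and "\<And>a. a \<in> carrier L \<Longrightarrow> alg_mult (Irr K x) a \<le> 1"
  shows "card {a. is_root (Irr K x) a} = degree (Irr K x)"
  using card_roots_separable[OF Irr_in_poly_ring[OF assms(1-3)]
      roots_over_carrier[OF Irr_in_poly_ring(1)[OF assms(1-3)]]] assms(4) by blast

text \<open>A separable minimal polynomial has as many roots as its degree, so a single root means
  degree 1, and the constant coefficient of the monic polynomial is -b.\<close>

lemma mem_of_unique_root:
  assumes F: "subfield F L" and b: "b \<in> carrier L" "(algebraic over F) b"
    and sep: "\<And>a. a \<in> carrier L \<Longrightarrow> alg_mult (Irr F b) a \<le> 1"
    and uniq: "\<And>a. is_root (Irr F b) a \<Longrightarrow> a = b"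
  shows "b \<in> F"
proof -
  have "{a. is_root (Irr F b) a} = {b}" using uniq is_root_Irr_self[OF F b] by auto
  then have "degree (Irr F b) = 1" using card_roots_Irr[OF F b sep] by simp
  then obtain u v where uv: "Irr F b = [u, v]"
    by (metis One_nat_def diff_Suc_1 length_0_conv length_Suc_conv list.size(3) Suc_diff_1 length_greater_0_conv zero_neq_one diff_0_eq_0)
  have "u = \<one>" using IrrE(3)[OF F b] uv by simp
  have "set (Irr F b) \<subseteq> F" using IrrE(1)[OF F b] uv by (auto simp: univ_poly_def polynomial_def)
  then have v: "v \<in> F" "v \<in> carrier L" using uv subfieldE(3)[OF F] by auto
  have "b \<oplus> v = \<zero>" using IrrE(4)[OF F b] uv \<open>u = \<one>\<close> b(1) v by simp
  then have "b = \<ominus> v" using b(1) v by (simp add: sum_zero_eq_neg)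
  then show ?thesis using v subringE(5)[OF subfieldE(1)[OF F]] by simp
qed

end

section \<open>The theorem of the primitive element\<close>

context algebraically_closed
begin

lemma simple_extension_subfield:
  assumes "subfield E L" "c \<in> carrier L" "(algebraic over E) c"
  shows "subfield (simple_extension E c) L" "E \<subseteq> simple_extension E c" "c \<in> simple_extension E c"
  using simple_extension_is_subfield[OF assms(1,2)] assms(3)
    simple_extension_incl[OF subfieldE(3)[OF assms(1)] assms(2)]
    simple_extension_mem[OF subfieldE(1)[OF assms(1)] assms(2)] by blast+

text \<open>\<open>c = a + t b\<close> is primitive once \<open>t\<close> is chosen so that \<open>c - t b'\<close> is not a conjugate of \<open>a\<close> for any
  conjugate \<open>b' \<noteq> b\<close> of \<open>b\<close>.\<close>

lemma primitive_element_pair: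
  assumes E: "subfield E L" and inf: "infinite E"
    and M: "subfield M L" "E \<subseteq> M" "finite_dimension E M" and a: "a \<in> M" and b: "b \<in> M"
    and sep: "\<And>z. z \<in> carrier L \<Longrightarrow> alg_mult (Irr E b) z \<le> 1"
  shows "\<exists>c\<in>M. a \<in> simple_extension E c \<and> b \<in> simple_extension E c"
proof -
  have alg: "(algebraic over E) x" if "x \<in> M" for x
    using finite_dimension_imp_algebraic[OF E subfieldE(1)[OF M(1)] M(3) that] .
  have MC: "x \<in> carrier L" if "x \<in> M" for x using subfieldE(3)[OF M(1)] that by blast
  note ac = MC[OF a] alg[OF a] and bc = MC[OF b] alg[OF b]
  define A where "A = {z. is_root (Irr E a) z}"
  define B where "B = {z. is_root (Irr E b) z}"
  have fin: "finite A" "finite B"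
    unfolding A_def B_def using finite_number_of_roots Irr_in_poly_ring(1)[OF E] ac bc by blast+
  have AB: "A \<subseteq> carrier L" "B \<subseteq> carrier L" unfolding A_def B_def by (auto simp: is_root_def)
  \<comment> \<open>The equation c - t b' = a' amounts to t = (a' - a) / (b - b'), so only finitely
    many values of t are excluded.\<close>
  have "\<not> E \<subseteq> (\<lambda>(a', b'). (a' \<ominus> a) \<otimes> inv (b \<ominus> b')) ` (A \<times> B)"
    using inf fin by (meson finite_SigmaI finite_imageI finite_subset)
  then obtain t where t: "t \<in> E" "t \<notin> (\<lambda>(a', b'). (a' \<ominus> a) \<otimes> inv (b \<ominus> b')) ` (A \<times> B)" by blast
  have tC: "t \<in> carrier L" and tM: "t \<in> M" using t(1) M(2) MC by auto
  define c where "c = a \<oplus> t \<otimes> b"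
  have cM: "c \<in> M" unfolding c_def
    using subringE(6,7)[OF subfieldE(1)[OF M(1)]] a b tM by blast
  note cc = MC[OF cM] alg[OF cM]
  define F where "F = simple_extension E c"
  have F: "subfield F L" "E \<subseteq> F" "c \<in> F"
    unfolding F_def using simple_extension_subfield[OF E cc] by blast+
  have bF: "(algebraic over F) b" using algebraic_mono[OF F(2) bc(2)] .
  note Fring = subringE[OF subfieldE(1)[OF F(1)]]
  obtain q where q: "q \<in> carrier (F[X])" "\<And>x. x \<in> carrier L \<Longrightarrow> eval q x = eval [\<ominus> t, c] x"
    using exists_poly_eval[OF F(1), of "[\<ominus> t, c]"] F(2,3) t(1) Fring(5) by auto
  have q': "eval q x = c \<ominus> t \<otimes> x" if "x \<in> carrier L" for x
    using q(2)[OF that] that tC cc(1) by (simp add: a_minus_def l_minus a_comm)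
  have "set (Irr E a) \<subseteq> F"
    using IrrE(1)[OF E ac] F(2) by (auto simp: univ_poly_def polynomial_def)
  \<comment> \<open>\<open>h\<close> is the minimal polynomial of a at c - t X. It has coefficients
    in F and vanishes at b, so each root z of the minimal polynomial of b over F makes c - t z a
    conjugate of a.\<close>
  then obtain h where h: "h \<in> carrier (F[X])" "\<And>x. x \<in> carrier L \<Longrightarrow> eval h x = eval (Irr E a) (eval q x)"
    using exists_poly_comp[OF F(1) _ q(1)] by blast
  have "c \<ominus> t \<otimes> b = a"
  proof -
    have "(a \<oplus> t \<otimes> b) \<ominus> t \<otimes> b = a" using ac(1) bc(1) tC by algebra
    then show ?thesis by (simp add: c_def)
  qed
  then have hb: "eval h b = \<zero>" using h(2) q' bc(1) IrrE(4)[OF E ac] by simp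
  have "b \<in> F"
  proof (rule mem_of_unique_root[OF F(1) bc(1) bF])
    show "alg_mult (Irr F b) z \<le> 1" if "z \<in> carrier L" for z
      using alg_mult_Irr_le[OF E F(1,2) bc, of z] sep[OF that] by simp
    fix z assume z: "is_root (Irr F b) z"
    then have zC: "z \<in> carrier L" and z0: "eval (Irr F b) z = \<zero>" by (simp_all add: is_root_def)
    have "eval (Irr E b) z = \<zero>"
      using Irr_eval_zero_transfer[OF F(1) bc(1) bF _ _ zC z0, of "Irr E b"]
        IrrE(1,4)[OF E bc] F(2) by (auto simp: univ_poly_def polynomial_def)
    then have "z \<in> B" using is_root_Irr_iff[OF E bc] zC by (simp add: B_def)
    have "eval h z = \<zero>" by (rule Irr_eval_zero_transfer[OF F(1) bc(1) bF h(1) hb zC z0])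
    then have "eval (Irr E a) (c \<ominus> t \<otimes> z) = \<zero>" using h(2) q' zC by simp
    then have "c \<ominus> t \<otimes> z \<in> A"
      using is_root_Irr_iff[OF E ac] zC cc(1) tC by (simp add: A_def)
    show "z = b"
    proof (rule ccontr)
      assume "z \<noteq> b"
      then have nz: "b \<ominus> z \<noteq> \<zero>" using zC bc(1) by simp
      then have u: "b \<ominus> z \<in> Units L" using zC bc(1) by (simp add: field_Units)
      have "(c \<ominus> t \<otimes> z) \<ominus> a = t \<otimes> (b \<ominus> z)" unfolding c_def using zC bc(1) ac(1) tC by algebra
      then have "((c \<ominus> t \<otimes> z) \<ominus> a) \<otimes> inv (b \<ominus> z) = t \<otimes> ((b \<ominus> z) \<otimes> inv (b \<ominus> z))"
        using u tC by (simp add: m_assoc Units_closed)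
      also have "\<dots> = t" using u tC by simp
      finally show False using t(2) \<open>c \<ominus> t \<otimes> z \<in> A\<close> \<open>z \<in> B\<close> by force
    qed
  qed
  moreover have "a \<in> F"
  proof -
    have "t \<otimes> b \<in> F" using Fring(6) \<open>b \<in> F\<close> t(1) F(2) by blast
    then have "c \<oplus> \<ominus> (t \<otimes> b) \<in> F" using Fring(5,7) F(3) by blast
    then show ?thesis using \<open>c \<ominus> t \<otimes> b = a\<close> by (simp add: a_minus_def)
  qed
  ultimately show ?thesis using cM unfolding F_def by blast
qed

text \<open>An element c of maximal degree is primitive: for any x the pair c, x lies in some E(d),
  whose degree cannot exceed that of c, so E(c) = E(d) contains x.\<close>

lemma primitive_element:
  assumes E: "subfield E L" and inf: "infinite E" and M: "finite_separable_extension L E M"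
  shows "\<exists>c\<in>M. simple_extension E c = M"
proof -
  have Ms: "subfield M L" "E \<subseteq> M" "finite_dimension E M"
    and sep: "\<And>x z. x \<in> M \<Longrightarrow> z \<in> carrier L \<Longrightarrow> alg_mult (Irr E x) z \<le> 1"
    using M by (auto simp: finite_separable_extension_def finite_extension_def)
  have MC: "x \<in> carrier L" if "x \<in> M" for x using subfieldE(3)[OF Ms(1)] that by blast
  have alg: "(algebraic over E) x" if "x \<in> M" for x
    using finite_dimension_imp_algebraic[OF E subfieldE(1)[OF Ms(1)] Ms(3) that] .
  obtain n where n: "dimension n E M" using Ms(3) by auto
  have sub: "simple_extension E x \<subseteq> M" if "x \<in> M" for x
    using simple_extension_subring_incl[OF subfieldE(1)[OF Ms(1)] Ms(2) that] .
  have dm: "dimension (degree (Irr E x)) E (simple_extension E x)" if "x \<in> M" for x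
    using dimension_simple_extension[OF E MC[OF that] alg[OF that]] .
  have bound: "degree (Irr E x) \<le> n" if "x \<in> M" for x
    using dimension_subset(1)[OF E dm[OF that] n sub[OF that]] .
  have "\<zero> \<in> M" using subringE(2)[OF subfieldE(1)[OF Ms(1)]] .
  then obtain c where c: "c \<in> M" "\<And>x. x \<in> M \<Longrightarrow> degree (Irr E x) \<le> degree (Irr E c)"
    using ex_has_greatest_nat[of "\<lambda>x. x \<in> M" "\<zero>" "\<lambda>x. degree (Irr E x)" "Suc n"] bound
    by (metis le_imp_less_Suc)
  have "x \<in> simple_extension E c" if x: "x \<in> M" for x
  proof -
    obtain d where d: "d \<in> M" "c \<in> simple_extension E d" "x \<in> simple_extension E d"
      using primitive_element_pair[OF E inf Ms c(1) x sep[OF x]] by blast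
    have "simple_extension E c \<subseteq> simple_extension E d"
      using simple_extension_subring_incl[OF _ _ d(2)] simple_extension_subfield[OF E MC[OF d(1)] alg[OF d(1)]]
        subfieldE(1) by blast
    moreover have "degree (Irr E c) = degree (Irr E d)"
      using dimension_subset(1)[OF E dm[OF c(1)] dm[OF d(1)]] calculation c(2)[OF d(1)] by simp
    ultimately have "simple_extension E c = simple_extension E d"
      using dimension_subset(2)[OF E dm[OF c(1)] dm[OF d(1)]] by blast
    then show ?thesis using d(3) by simp
  qed
  then show ?thesis using c(1) sub by blast
qed

end

section \<open>Automorphism groups of subfields\<close>

lemma carrier_gal: "carrier (gal \<Omega> E M) =
    {\<theta> \<in> Bij M \<inter> ring_hom (\<Omega>\<lparr>carrier := M\<rparr>) (\<Omega>\<lparr>carrier := M\<rparr>). \<forall>x\<in>E. \<theta> x = x}"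
  by (simp add: gal_def)

lemma gal_memD:
  assumes "\<theta> \<in> carrier (gal \<Omega> E M)"
  shows "\<theta> \<in> extensional M" "bij_betw \<theta> M M" "\<And>x. x \<in> E \<Longrightarrow> \<theta> x = x" "\<And>x. x \<in> M \<Longrightarrow> \<theta> x \<in> M"
    "\<And>x y. x \<in> M \<Longrightarrow> y \<in> M \<Longrightarrow> \<theta> (x \<otimes>\<^bsub>\<Omega>\<^esub> y) = \<theta> x \<otimes>\<^bsub>\<Omega>\<^esub> \<theta> y"
    "\<And>x y. x \<in> M \<Longrightarrow> y \<in> M \<Longrightarrow> \<theta> (x \<oplus>\<^bsub>\<Omega>\<^esub> y) = \<theta> x \<oplus>\<^bsub>\<Omega>\<^esub> \<theta> y"
    "\<theta> \<one>\<^bsub>\<Omega>\<^esub> = \<one>\<^bsub>\<Omega>\<^esub>"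
  using assms by (auto simp: carrier_gal Bij_def ring_hom_def bij_betw_def)

lemma gal_memI:
  assumes "\<theta> \<in> extensional M" "bij_betw \<theta> M M" "\<And>x. x \<in> E \<Longrightarrow> \<theta> x = x"
    "\<And>x y. x \<in> M \<Longrightarrow> y \<in> M \<Longrightarrow> \<theta> (x \<otimes>\<^bsub>\<Omega>\<^esub> y) = \<theta> x \<otimes>\<^bsub>\<Omega>\<^esub> \<theta> y"
    "\<And>x y. x \<in> M \<Longrightarrow> y \<in> M \<Longrightarrow> \<theta> (x \<oplus>\<^bsub>\<Omega>\<^esub> y) = \<theta> x \<oplus>\<^bsub>\<Omega>\<^esub> \<theta> y"
    "\<theta> \<one>\<^bsub>\<Omega>\<^esub> = \<one>\<^bsub>\<Omega>\<^esub>"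
  shows "\<theta> \<in> carrier (gal \<Omega> E M)"
  using assms by (auto simp: carrier_gal Bij_def ring_hom_def bij_betw_def)

lemma mult_gal:
  assumes "\<theta> \<in> carrier (gal \<Omega> E M)" "\<tau> \<in> carrier (gal \<Omega> E M)"
  shows "\<theta> \<otimes>\<^bsub>gal \<Omega> E M\<^esub> \<tau> = compose M \<theta> \<tau>"
  using assms by (simp add: gal_def BijGroup_def)

lemma one_gal: "\<one>\<^bsub>gal \<Omega> E M\<^esub> = (\<lambda>x\<in>M. x)"
  by (simp add: gal_def BijGroup_def)

lemma carrier_gal_mono: "E \<subseteq> F \<Longrightarrow> carrier (gal \<Omega> F M) \<subseteq> carrier (gal \<Omega> E M)"
  by (auto simp: carrier_gal)

context ring
begin

lemma subgroup_gal_BijGroup: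
  assumes M: "subring M R" and "E \<subseteq> M"
  shows "subgroup (carrier (gal R E M)) (BijGroup M)"
proof (rule group.subgroupI[OF group_BijGroup])
  note mem = subringE(3,6,7)[OF M]
  show "carrier (gal R E M) \<subseteq> carrier (BijGroup M)"
    by (auto simp: carrier_gal BijGroup_def)
  have "(\<lambda>x\<in>M. x) \<in> Bij M" by (rule id_Bij)
  then have "(\<lambda>x\<in>M. x) \<in> carrier (gal R E M)"
    by (intro gal_memI) (use mem \<open>E \<subseteq> M\<close> in \<open>auto simp: Bij_def\<close>)
  then show "carrier (gal R E M) \<noteq> {}" by blast
  fix \<theta> assume \<theta>: "\<theta> \<in> carrier (gal R E M)"
  note D = gal_memD[OF \<theta>]
  have \<theta>B: "\<theta> \<in> Bij M" using \<theta> by (simp add: carrier_gal)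
  have fixed: "inv_into M \<theta> x = x" if "x \<in> E \<union> {\<one>}" for x
    by (rule inv_into_f_eq) (use D(2,3,7) that mem \<open>E \<subseteq> M\<close> in \<open>auto simp: bij_betw_def\<close>)
  have hom: "inv_into M \<theta> (x \<otimes> y) = inv_into M \<theta> x \<otimes> inv_into M \<theta> y"
    "inv_into M \<theta> (x \<oplus> y) = inv_into M \<theta> x \<oplus> inv_into M \<theta> y" if "x \<in> M" "y \<in> M" for x y
    using Bij_inv_into_lemma[of M \<theta> "(\<otimes>)", OF D(5) \<theta>B _ that] Bij_inv_into_lemma[of M \<theta> "(\<oplus>)", OF D(6) \<theta>B _ that]
      mem by auto
  have "(\<lambda>x\<in>M. inv_into M \<theta> x) \<in> Bij M" using \<theta>B by (rule restrict_inv_into_Bij)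
  then have "(\<lambda>x\<in>M. inv_into M \<theta> x) \<in> carrier (gal R E M)"
    by (intro gal_memI) (use mem \<open>E \<subseteq> M\<close> hom fixed in \<open>auto simp: Bij_def\<close>)
  then show "inv\<^bsub>BijGroup M\<^esub> \<theta> \<in> carrier (gal R E M)" by (simp add: inv_BijGroup[OF \<theta>B])
  fix \<tau> assume \<tau>: "\<tau> \<in> carrier (gal R E M)"
  note D' = gal_memD[OF \<tau>]
  have \<tau>B: "\<tau> \<in> Bij M" using \<tau> by (simp add: carrier_gal)
  have "compose M \<theta> \<tau> \<in> Bij M" using \<theta>B \<tau>B by (rule compose_Bij)
  then have "compose M \<theta> \<tau> \<in> carrier (gal R E M)"
    by (intro gal_memI) (use mem \<open>E \<subseteq> M\<close> D D' in \<open>auto simp: Bij_def compose_def\<close>)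
  then show "\<theta> \<otimes>\<^bsub>BijGroup M\<^esub> \<tau> \<in> carrier (gal R E M)" using \<theta>B \<tau>B by (simp add: BijGroup_def)
qed

lemma group_gal:
  assumes "subring M R" "E \<subseteq> M"
  shows "group (gal R E M)"
  using subgroup.subgroup_is_group[OF subgroup_gal_BijGroup[OF assms] group_BijGroup]
  by (simp add: gal_def)

lemma subgroup_gal:
  assumes "subring M R" "E \<subseteq> F" "F \<subseteq> M"
  shows "subgroup (carrier (gal R F M)) (gal R E M)"
proof -
  have "subgroup (carrier (gal R F M)) (BijGroup M \<lparr>carrier := carrier (gal R E M)\<rparr>)"
    using group.subgroup_incl[OF group_BijGroup subgroup_gal_BijGroup[OF assms(1,3)]
        subgroup_gal_BijGroup[OF assms(1), of E]] carrier_gal_mono[OF assms(2)] assms(2,3) by blast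
  then show ?thesis by (simp add: gal_def)
qed

lemma inv_gal:
  assumes "subring M R" "E \<subseteq> M" "\<theta> \<in> carrier (gal R E M)" "x \<in> M"
  shows "(inv\<^bsub>gal R E M\<^esub> \<theta>) (\<theta> x) = x" "\<theta> ((inv\<^bsub>gal R E M\<^esub> \<theta>) x) = x"
proof -
  interpret G: group "gal R E M" using assms by (intro group_gal)
  have i: "inv\<^bsub>gal R E M\<^esub> \<theta> \<in> carrier (gal R E M)" using assms(3) by simp
  have "compose M (inv\<^bsub>gal R E M\<^esub> \<theta>) \<theta> = (\<lambda>x\<in>M. x)" "compose M \<theta> (inv\<^bsub>gal R E M\<^esub> \<theta>) = (\<lambda>x\<in>M. x)"
    using G.l_inv[OF assms(3)] G.r_inv[OF assms(3)] mult_gal[OF i assms(3)] mult_gal[OF assms(3) i]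
    by (simp_all add: one_gal)
  then show "(inv\<^bsub>gal R E M\<^esub> \<theta>) (\<theta> x) = x" "\<theta> ((inv\<^bsub>gal R E M\<^esub> \<theta>) x) = x"
    using assms(4) by (simp_all add: compose_def fun_eq_iff restrict_def) metis+
qed

lemma gal_zero_minus:
  assumes "subring M R" "\<theta> \<in> carrier (gal R E M)"
  shows "\<theta> \<zero> = \<zero>" "\<And>x y. x \<in> M \<Longrightarrow> y \<in> M \<Longrightarrow> \<theta> (x \<ominus> y) = \<theta> x \<ominus> \<theta> y"
proof -
  note D = gal_memD[OF assms(2)] and MC = subringE(1)[OF assms(1)]
  note mem = subringE(2,5)[OF assms(1)]
  have cl: "\<theta> x \<in> carrier R" if "x \<in> M" for x using D(4)[OF that] MC by blast
  have "\<theta> \<zero> \<oplus> \<theta> \<zero> = \<theta> \<zero>" using D(6)[OF mem(1) mem(1)] by simp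
  then show z: "\<theta> \<zero> = \<zero>" using cl[OF mem(1)] by (metis r_zero local.add.l_cancel zero_closed)
  fix x y assume xy: "x \<in> M" "y \<in> M"
  have "\<theta> (\<ominus> y) \<oplus> \<theta> y = \<zero>"
    using D(6)[OF mem(2)[OF xy(2)] xy(2)] z xy MC by (simp add: l_neg subsetD)
  then have "\<theta> (\<ominus> y) = \<ominus> \<theta> y" using cl mem(2) xy by (simp add: minus_equality)
  then show "\<theta> (x \<ominus> y) = \<theta> x \<ominus> \<theta> y" using D(6)[OF xy(1) mem(2)[OF xy(2)]] by (simp add: a_minus_def)
qed

lemma gal_nat_pow:
  assumes "subring M R" "\<theta> \<in> carrier (gal R E M)" "x \<in> M"
  shows "\<theta> (x [^] (n::nat)) = \<theta> x [^] n" "x [^] n \<in> M"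
proof -
  have M: "x [^] (k::nat) \<in> M" for k
    by (induction k) (use assms subringE(3,6)[OF assms(1)] in auto)
  then show "x [^] n \<in> M" .
  show "\<theta> (x [^] n) = \<theta> x [^] n"
    by (induction n) (use M assms gal_memD[OF assms(2)] in auto)
qed

lemma gal_eval:
  assumes M: "subring M R" and \<theta>: "\<theta> \<in> carrier (gal R E M)" and x: "x \<in> M" and E: "E \<subseteq> M" and p: "set p \<subseteq> E"
  shows "eval p x \<in> M \<and> \<theta> (eval p x) = eval p (\<theta> x)"
  using p
proof (induction p)
  case Nil
  then show ?case using gal_zero_minus(1)[OF M \<theta>] subringE(2)[OF M] by simp
next
  case (Cons a p)
  then have a: "a \<in> E" "a \<in> M" using E by auto
  have "a \<otimes> x [^] length p \<in> M" using a gal_nat_pow(2)[OF M \<theta> x] subringE(6)[OF M] by blast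
  then show ?case
    using Cons a gal_memD[OF \<theta>] gal_nat_pow[OF M \<theta> x] subringE(7)[OF M] by simp
qed

end

section \<open>Galois extensions and the order of their groups\<close>

context algebraically_closed
begin

lemma finite_galois_extensionD:
  assumes "finite_galois_extension L E M"
  shows "subfield E L" "subfield M L" "E \<subseteq> M" "finite_dimension E M" "finite_separable_extension L E M"
    "\<And>x a. x \<in> M \<Longrightarrow> is_root (Irr E x) a \<Longrightarrow> a \<in> M"
    "\<And>x a. x \<in> M \<Longrightarrow> a \<in> carrier L \<Longrightarrow> alg_mult (Irr E x) a \<le> 1"
    "\<And>x. x \<in> M \<Longrightarrow> (algebraic over E) x" "\<And>x. x \<in> M \<Longrightarrow> x \<in> carrier L"
proof -
  show 1: "subfield E L" "subfield M L" "E \<subseteq> M" "finite_dimension E M" "finite_separable_extension L E M"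
    "\<And>x a. x \<in> M \<Longrightarrow> is_root (Irr E x) a \<Longrightarrow> a \<in> M"
    "\<And>x a. x \<in> M \<Longrightarrow> a \<in> carrier L \<Longrightarrow> alg_mult (Irr E x) a \<le> 1"
    using assms by (auto simp: finite_galois_extension_def finite_separable_extension_def finite_extension_def)
  show "(algebraic over E) x" if "x \<in> M" for x
    using finite_dimension_imp_algebraic[OF 1(1) subfieldE(1)[OF 1(2)] 1(4) that] .
  show "x \<in> carrier L" if "x \<in> M" for x using subfieldE(3)[OF 1(2)] that by blast
qed

lemma finite_separable_extension_mid:
  assumes M: "finite_separable_extension L E M" and F: "subfield F L" "E \<subseteq> F" "F \<subseteq> M"
  shows "finite_separable_extension L E F" "finite_separable_extension L F M"
proof -
  have 1: "subfield E L" "subfield M L" "finite_dimension E M"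
    and sep: "\<And>x a. x \<in> M \<Longrightarrow> a \<in> carrier L \<Longrightarrow> alg_mult (Irr E x) a \<le> 1"
    using M by (auto simp: finite_separable_extension_def finite_extension_def)
  note fd = finite_dimension_tower[OF 1(1) F(1) 1(2) F(2,3) 1(3)]
  show "finite_separable_extension L E F"
    using 1 F fd sep by (auto simp: finite_separable_extension_def finite_extension_def)
  have "alg_mult (Irr F x) a \<le> 1" if "x \<in> M" "a \<in> carrier L" for x a
  proof -
    have "(algebraic over E) x" "x \<in> carrier L"
      using finite_dimension_imp_algebraic[OF 1(1) subfieldE(1)[OF 1(2)] 1(3) that(1)]
        subfieldE(3)[OF 1(2)] that(1) by auto
    then show ?thesis using alg_mult_Irr_le[OF 1(1) F(1,2), of x a] sep[OF that] by simp
  qed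
  then show "finite_separable_extension L F M"
    using 1 F fd by (auto simp: finite_separable_extension_def finite_extension_def)
qed

lemma finite_galois_extension_mid:
  assumes M: "finite_galois_extension L E M" and F: "subfield F L" "E \<subseteq> F" "F \<subseteq> M"
  shows "finite_galois_extension L F M"
  unfolding finite_galois_extension_def
proof (intro conjI ballI allI impI)
  note D = finite_galois_extensionD[OF M]
  show "finite_separable_extension L F M" by (rule finite_separable_extension_mid(2)[OF D(5) F])
  fix x a assume x: "x \<in> M" and a: "is_root (Irr F x) a"
  note xc = D(9)[OF x] D(8)[OF x]
  have "eval (Irr E x) a = \<zero>"
    using pdivides_imp_root_sharing[OF Irr_in_poly_ring(1)[OF F(1) xc(1) algebraic_mono[OF F(2) xc(2)]]
        Irr_pdivides_Irr[OF D(1) F(1,2) xc]] a by (auto simp: is_root_def)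
  then show "a \<in> M" using D(6)[OF x] is_root_Irr_iff[OF D(1) xc] a by (auto simp: is_root_def)
qed

lemma gal_root:
  assumes M: "finite_galois_extension L E M" and "\<theta> \<in> carrier (gal L E M)" "x \<in> M"
  shows "is_root (Irr E x) (\<theta> x)"
proof -
  note D = finite_galois_extensionD[OF M]
  note xc = D(9)[OF assms(3)] D(8)[OF assms(3)]
  have "set (Irr E x) \<subseteq> E" using IrrE(1)[OF D(1) xc] by (auto simp: univ_poly_def polynomial_def)
  then have "eval (Irr E x) (\<theta> x) = \<theta> (eval (Irr E x) x)"
    using gal_eval[OF subfieldE(1)[OF D(2)] assms(2,3) D(3)] by simp
  also have "\<dots> = \<zero>" using IrrE(4)[OF D(1) xc] gal_zero_minus(1)[OF subfieldE(1)[OF D(2)] assms(2)] by simp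
  finally show ?thesis
    using is_root_Irr_iff[OF D(1) xc] D(9) gal_memD(4)[OF assms(2,3)] by simp
qed

lemma gal_determined:
  assumes M: "finite_galois_extension L E M" and c: "c \<in> M" "simple_extension E c = M"
    and \<theta>: "\<theta> \<in> carrier (gal L E M)" and \<tau>: "\<tau> \<in> carrier (gal L E M)" and eq: "\<theta> c = \<tau> c"
  shows "\<theta> = \<tau>"
proof (rule extensionalityI[OF gal_memD(1)[OF \<theta>] gal_memD(1)[OF \<tau>]])
  note D = finite_galois_extensionD[OF M]
  fix x assume "x \<in> M"
  then obtain p where p: "p \<in> carrier (E[X])" "x = eval p c"
    using c(2) simple_extension_as_eval_img[OF subfieldE(3)[OF D(1)] D(9)[OF c(1)]] by auto
  then have "set p \<subseteq> E" by (auto simp: univ_poly_def polynomial_def)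
  then show "\<theta> x = \<tau> x"
    using gal_eval[OF subfieldE(1)[OF D(2)] \<theta> c(1) D(3)] gal_eval[OF subfieldE(1)[OF D(2)] \<tau> c(1) D(3)] eq p(2)
    by simp
qed

text \<open>Every element of M is the value at c of a polynomial over E; the automorphism evaluates
  the same polynomial at d. Since c and d have the same minimal polynomial, this is well defined and
  injective, and E(d) = M by dimension.\<close>

lemma exists_gal_conjugate:
  assumes M: "finite_galois_extension L E M" and c: "c \<in> M" "simple_extension E c = M"
    and d: "is_root (Irr E c) d"
  shows "\<exists>\<theta>\<in>carrier (gal L E M). \<theta> c = d"
proof -
  note D = finite_galois_extensionD[OF M]
  note E = D(1) and sub = subfieldE(1)[OF D(1)]
  note cc = D(9)[OF c(1)] D(8)[OF c(1)]
  have d0: "d \<in> carrier L" "eval (Irr E c) d = \<zero>" using d by (simp_all add: is_root_def)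
  have dM: "d \<in> M" using D(6)[OF c(1) d] .
  note dalg = D(8)[OF dM]
  have "Irr E d = Irr E c"
    using minimal_polynomial_is_unique[OF E d0(1) dalg] IrrE[OF E cc] IrrE[OF E d0(1) dalg] d0(2) by blast
  then have c0: "eval (Irr E d) c = \<zero>" using IrrE(4)[OF E cc] by simp
  have simple: "simple_extension E d = M"
  proof (rule dimension_subset(2)[OF E])
    show "dimension (degree (Irr E d)) E (simple_extension E d)"
      by (rule dimension_simple_extension[OF E d0(1) dalg])
    show "dimension (degree (Irr E c)) E M"
      using dimension_simple_extension[OF E cc] c(2) by simp
    show "simple_extension E d \<subseteq> M"
      by (rule simple_extension_subring_incl[OF subfieldE(1)[OF D(2)] D(3) dM])
  qed (use \<open>Irr E d = Irr E c\<close> in simp)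
  have img: "\<exists>p\<in>carrier (E[X]). x = eval p c" "\<exists>p\<in>carrier (E[X]). x = eval p d" if "x \<in> M" for x
    using that c(2) simple simple_extension_as_eval_img[OF subfieldE(3)[OF E]] cc(1) d0(1) by auto
  \<comment> \<open>A chosen polynomial representing x. The later fact \<open>\<theta>\<close> shows
    that the value at d does not depend on the choice, which yields the homomorphism laws.\<close>
  define P where "P x = (SOME p. p \<in> carrier (E[X]) \<and> x = eval p c)" for x
  have P: "P x \<in> carrier (E[X])" "eval (P x) c = x" if "x \<in> M" for x
    using someI_ex[OF img(1)[OF that, unfolded Bex_def]] by (simp_all add: P_def)
  define \<theta> where "\<theta> = (\<lambda>x\<in>M. eval (P x) d)"
  have ev: "eval p c \<in> M" "eval p d \<in> M" if "p \<in> carrier (E[X])" for p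
    using that c(2) simple simple_extension_as_eval_img[OF subfieldE(3)[OF E]] cc(1) d0(1) by auto
  have \<theta>: "\<theta> (eval p c) = eval p d" if p: "p \<in> carrier (E[X])" for p
    using Irr_eval_eq_transfer[OF E cc P(1)[OF ev(1)[OF p]] p P(2)[OF ev(1)[OF p]] d0] ev(1)[OF p]
    by (simp add: \<theta>_def)
  interpret UP: domain "E[X]" by (rule univ_poly_is_domain[OF sub])
  interpret hc: ring_hom_ring "E[X]" L "\<lambda>p. eval p c" by (rule eval_ring_hom[OF sub cc(1)])
  interpret hd: ring_hom_ring "E[X]" L "\<lambda>p. eval p d" by (rule eval_ring_hom[OF sub d0(1)])
  have "\<theta> \<in> carrier (gal L E M)"
  proof (rule gal_memI)
    show "\<theta> \<in> extensional M" by (simp add: \<theta>_def)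
    show "bij_betw \<theta> M M"
      unfolding bij_betw_def
    proof
      show "inj_on \<theta> M"
      proof (rule inj_onI)
        fix x y assume xy: "x \<in> M" "y \<in> M" "\<theta> x = \<theta> y"
        then have "eval (P x) d = eval (P y) d" by (simp add: \<theta>_def)
        from Irr_eval_eq_transfer[OF E d0(1) dalg P(1)[OF xy(1)] P(1)[OF xy(2)] this cc(1) c0]
        show "x = y" using P(2) xy by simp
      qed
      show "\<theta> ` M = M"
      proof
        show "\<theta> ` M \<subseteq> M" using P(1) ev(2) by (auto simp: \<theta>_def)
        show "M \<subseteq> \<theta> ` M"
        proof
          fix x assume "x \<in> M"
          then obtain p where p: "p \<in> carrier (E[X])" "x = eval p d" using img(2) by blast
          then show "x \<in> \<theta> ` M" using \<theta>[OF p(1)] ev(1)[OF p(1)] by (metis imageI)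
        qed
      qed
    qed
    show "\<theta> x = x" if x: "x \<in> E" for x
    proof -
      have xC: "x \<in> carrier L" using x subfieldE(3)[OF E] by blast
      have "set [x] \<subseteq> E" using x by simp
      obtain q where q: "q \<in> carrier (E[X])" "\<And>z. z \<in> carrier L \<Longrightarrow> eval q z = eval [x] z"
        using exists_poly_eval[OF E \<open>set [x] \<subseteq> E\<close>] by blast
      then show ?thesis using \<theta>[OF q(1)] cc(1) d0(1) xC by simp
    qed
    show "\<theta> (x \<otimes> y) = \<theta> x \<otimes> \<theta> y" if xy: "x \<in> M" "y \<in> M" for x y
    proof -
      obtain p q where pq: "p \<in> carrier (E[X])" "x = eval p c" "q \<in> carrier (E[X])" "y = eval q c"
        using img(1) xy by blast
      then have "x \<otimes> y = eval (p \<otimes>\<^bsub>E[X]\<^esub> q) c" by simp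
      then show ?thesis using \<theta>[of "p \<otimes>\<^bsub>E[X]\<^esub> q"] \<theta> pq by simp
    qed
    show "\<theta> (x \<oplus> y) = \<theta> x \<oplus> \<theta> y" if xy: "x \<in> M" "y \<in> M" for x y
    proof -
      obtain p q where pq: "p \<in> carrier (E[X])" "x = eval p c" "q \<in> carrier (E[X])" "y = eval q c"
        using img(1) xy by blast
      then have "x \<oplus> y = eval (p \<oplus>\<^bsub>E[X]\<^esub> q) c" by simp
      then show ?thesis using \<theta>[of "p \<oplus>\<^bsub>E[X]\<^esub> q"] \<theta> pq by simp
    qed
    show "\<theta> \<one> = \<one>" using \<theta>[OF UP.one_closed] by simp
  qed
  moreover have "\<theta> c = d" using \<theta>[OF var_closed(1)[OF sub]] eval_var cc(1) d0(1) by simp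
  ultimately show ?thesis by blast
qed

text \<open>An automorphism is determined by the image of a primitive element c, and the possible
  images are the roots of its minimal polynomial, by separability as many as its degree.\<close>

lemma card_gal:
  assumes M: "finite_galois_extension L E M" and inf: "infinite E"
  shows "card (carrier (gal L E M)) = dim E M" "finite (carrier (gal L E M))"
proof -
  note D = finite_galois_extensionD[OF M]
  obtain c where c: "c \<in> M" "simple_extension E c = M"
    using primitive_element[OF D(1) inf D(5)] by blast
  note cc = D(9)[OF c(1)] D(8)[OF c(1)]
  have "bij_betw (\<lambda>\<theta>. \<theta> c) (carrier (gal L E M)) {a. is_root (Irr E c) a}"
    unfolding bij_betw_def
  proof
    show "inj_on (\<lambda>\<theta>. \<theta> c) (carrier (gal L E M))"
      using gal_determined[OF M c] by (blast intro: inj_onI)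
    show "(\<lambda>\<theta>. \<theta> c) ` carrier (gal L E M) = {a. is_root (Irr E c) a}"
      using gal_root[OF M _ c(1)] exists_gal_conjugate[OF M c] by blast
  qed
  then show "card (carrier (gal L E M)) = dim E M" "finite (carrier (gal L E M))"
    using bij_betw_same_card bij_betw_finite finite_number_of_roots[OF Irr_in_poly_ring(1)[OF D(1) cc]]
      card_roots_Irr[OF D(1) cc D(7)[OF c(1)]] dimI[OF D(1) dimension_simple_extension[OF D(1) cc]] c(2)
    by (fastforce simp: over_def)+
qed

end

context ring
begin

lemma gal_mult_apply:
  assumes "\<theta> \<in> carrier (gal R E M)" "\<tau> \<in> carrier (gal R E M)" "x \<in> M"
  shows "(\<theta> \<otimes>\<^bsub>gal R E M\<^esub> \<tau>) x = \<theta> (\<tau> x)"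
  using mult_gal[OF assms(1,2)] assms(3) by (simp add: compose_def)

end

section \<open>Fixed fields and the Galois correspondence\<close>

context field
begin

lemma subfield_inverse:
  assumes "subfield M R" "k \<in> M" "k \<noteq> \<zero>"
  shows "inv k \<in> M" "k \<otimes> inv k = \<one>" "inv k \<otimes> k = \<one>" "inv k \<in> carrier R" "inv k \<noteq> \<zero>"
proof -
  show "inv k \<in> M" "k \<otimes> inv k = \<one>" "inv k \<otimes> k = \<one>" "inv k \<noteq> \<zero>"
    using subfield_m_inv[OF assms(1), of k] assms(2,3) by auto
  then show "inv k \<in> carrier R" using subfieldE(3)[OF assms(1)] by blast
qed

lemma subfield_Int:
  assumes "subfield A R" "subfield B R"
  shows "subfield (A \<inter> B) R"
proof (rule subfieldI')
  note A = subringE[OF subfieldE(1)[OF assms(1)]] and B = subringE[OF subfieldE(1)[OF assms(2)]]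
  show "subring (A \<inter> B) R"
    by (rule subringI) (use A B in auto)
  show "inv k \<in> A \<inter> B" if "k \<in> A \<inter> B - {\<zero>}" for k
    using subfield_inverse(1)[OF assms(1), of k] subfield_inverse(1)[OF assms(2), of k] that by auto
qed

lemma gal_inverse:
  assumes "subfield M R" "\<theta> \<in> carrier (gal R E M)" "k \<in> M" "k \<noteq> \<zero>"
  shows "\<theta> (inv k) = inv (\<theta> k)"
proof -
  note D = gal_memD[OF assms(2)] and I = subfield_inverse[OF assms(1,3,4)]
  have "\<theta> (inv k) \<in> carrier R" "\<theta> k \<in> carrier R"
    using D(4) I(1) assms(3) subfieldE(3)[OF assms(1)] by blast+
  moreover have "\<theta> (inv k) \<otimes> \<theta> k = \<one>" using D(5)[OF I(1) assms(3)] I(3) D(7) by simp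
  ultimately show ?thesis using comm_inv_char m_comm by metis
qed

lemma subfield_fixed_field:
  assumes M: "subfield M R" and S: "S \<subseteq> carrier (gal R E M)"
  shows "subfield (fixed_field M S) R"
proof (rule subfieldI')
  note m = subringE[OF subfieldE(1)[OF M]]
  note D = gal_memD[OF subsetD[OF S]] and Z = gal_zero_minus[OF subfieldE(1)[OF M] subsetD[OF S]]
  show "subring (fixed_field M S) R"
  proof (rule subringI)
    show "\<ominus> x \<in> fixed_field M S" if "x \<in> fixed_field M S" for x
    proof -
      have x: "x \<in> M" "\<And>s. s \<in> S \<Longrightarrow> s x = x" using that by (auto simp: fixed_field_def)
      have "s (\<ominus> x) = \<ominus> x" if "s \<in> S" for s
      proof -
        have "s (\<zero> \<ominus> x) = \<zero> \<ominus> x" using Z(1)[OF that] Z(2)[OF that m(2) x(1)] x(2)[OF that] by simp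
        then show ?thesis using x(1) m(1) by (simp add: a_minus_def subsetD)
      qed
      then show ?thesis using x(1) m(5) by (simp add: fixed_field_def)
    qed
    fix x y assume "x \<in> fixed_field M S" "y \<in> fixed_field M S"
    then have x: "x \<in> M" "\<And>s. s \<in> S \<Longrightarrow> s x = x" and y: "y \<in> M" "\<And>s. s \<in> S \<Longrightarrow> s y = y"
      by (auto simp: fixed_field_def)
    have "s (x \<otimes> y) = x \<otimes> y" "s (x \<oplus> y) = x \<oplus> y" if "s \<in> S" for s
      using D(5,6)[OF that x(1) y(1)] x(2)[OF that] y(2)[OF that] by simp_all
    then show "x \<otimes> y \<in> fixed_field M S" "x \<oplus> y \<in> fixed_field M S"
      using m(6,7)[OF x(1) y(1)] unfolding fixed_field_def by auto
  qed (use m D(7) in \<open>auto simp: fixed_field_def\<close>)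
  show "inv k \<in> fixed_field M S" if "k \<in> fixed_field M S - {\<zero>}" for k
  proof -
    have k: "k \<in> M" "k \<noteq> \<zero>" "\<And>s. s \<in> S \<Longrightarrow> s k = k" using that by (auto simp: fixed_field_def)
    have "s (inv k) = inv k" if "s \<in> S" for s
      using gal_inverse[OF M subsetD[OF S that] k(1,2)] k(3)[OF that] by simp
    then show ?thesis using subfield_inverse(1)[OF M k(1,2)] by (simp add: fixed_field_def)
  qed
qed

lemma exists_poly_finprod:
  assumes "finite A" "f \<in> A \<rightarrow> carrier R"
  shows "\<exists>p\<in>carrier (poly_ring R). \<forall>x\<in>carrier R. eval p x = (\<Otimes>a\<in>A. x \<ominus> f a)"
  using assms
proof (induction A rule: finite_induct)
  case empty
  have "[\<one>] \<in> carrier (poly_ring R)" by (simp add: univ_poly_def polynomial_def)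
  then show ?case by (intro bexI[of _ "[\<one>]"]) auto
next
  case (insert a A)
  then obtain p where p: "p \<in> carrier (poly_ring R)" "\<And>x. x \<in> carrier R \<Longrightarrow> eval p x = (\<Otimes>a\<in>A. x \<ominus> f a)"
    by auto
  have fa: "f a \<in> carrier R" using insert by auto
  interpret UP: domain "poly_ring R" by (rule univ_poly_is_domain[OF carrier_is_subring])
  have q: "[\<one>, \<ominus> f a] \<in> carrier (poly_ring R)" using fa by (simp add: univ_poly_def polynomial_def)
  have "eval ([\<one>, \<ominus> f a] \<otimes>\<^bsub>poly_ring R\<^esub> p) x = (\<Otimes>a\<in>insert a A. x \<ominus> f a)" if x: "x \<in> carrier R" for x
  proof -
    interpret ring_hom_ring "poly_ring R" R "\<lambda>p. eval p x" by (rule eval_ring_hom[OF carrier_is_subring x])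
    have "(\<lambda>a. x \<ominus> f a) \<in> A \<rightarrow> carrier R" using insert x by auto
    then show ?thesis using insert p(1) p(2)[OF x] q fa x by (simp add: a_minus_def)
  qed
  then show ?case using p(1) q by (intro bexI[of _ "[\<one>, \<ominus> f a] \<otimes>\<^bsub>poly_ring R\<^esub> p"]) auto
qed

text \<open>Allows the products of X - s c to be compared through their values on the infinite
  ground field, without speaking of symmetric functions in the coefficients.\<close>

lemma poly_eval_eq_of_infinite:
  assumes p: "p \<in> carrier (poly_ring R)" and q: "q \<in> carrier (poly_ring R)"
    and E: "infinite E" "E \<subseteq> carrier R" "\<And>x. x \<in> E \<Longrightarrow> eval p x = eval q x" and x: "x \<in> carrier R"
  shows "eval p x = eval q x"
proof -
  interpret UP: domain "poly_ring R" by (rule univ_poly_is_domain[OF carrier_is_subring])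
  let ?d = "p \<ominus>\<^bsub>poly_ring R\<^esub> q"
  have cl: "eval r z \<in> carrier R" if "r \<in> carrier (poly_ring R)" "z \<in> carrier R" for r z
    using ring_hom_closed[OF eval_is_hom[OF carrier_is_subring that(2)] that(1)] .
  have ev: "eval ?d z = eval p z \<ominus> eval q z" if "z \<in> carrier R" for z
  proof -
    interpret ring_hom_ring "poly_ring R" R "\<lambda>p. eval p z" by (rule eval_ring_hom[OF carrier_is_subring that])
    show ?thesis using p q by (simp add: a_minus_def)
  qed
  have "?d = []"
  proof (rule ccontr)
    assume "?d \<noteq> []"
    then have "E \<subseteq> {x. is_root ?d x}"
      using E(2,3) ev cl[OF q] by (auto simp: is_root_def a_minus_def r_neg)
    then show False using E(1) finite_number_of_roots[of ?d] p q finite_subset by blast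
  qed
  then have "eval p x \<ominus> eval q x = \<zero>" using ev[OF x] by simp
  then show ?thesis using cl[OF p x] cl[OF q x] by simp
qed

lemma finprod_nonzero:
  assumes "finite A" "\<And>a. a \<in> A \<Longrightarrow> f a \<in> carrier R - {\<zero>}"
  shows "(\<Otimes>a\<in>A. f a) \<noteq> \<zero>"
  using assms
proof (induction A rule: finite_induct)
  case (insert a A)
  then have "f \<in> A \<rightarrow> carrier R" "f a \<in> carrier R" "f a \<noteq> \<zero>" "(\<Otimes>a\<in>A. f a) \<noteq> \<zero>" by auto
  then show ?case using insert(1,2) integral[of "f a" "finprod R f A"] by auto
qed simp

lemma gal_finprod:
  assumes M: "subfield M R" and \<theta>: "\<theta> \<in> carrier (gal R E M)" and A: "finite A" "f \<in> A \<rightarrow> M"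
  shows "(\<Otimes>a\<in>A. f a) \<in> M \<and> \<theta> (\<Otimes>a\<in>A. f a) = (\<Otimes>a\<in>A. \<theta> (f a))"
  using A
proof (induction A rule: finite_induct)
  case empty
  then show ?case using subringE(3)[OF subfieldE(1)[OF M]] gal_memD(7)[OF \<theta>] by simp
next
  case (insert a A)
  note MC = subfieldE(3)[OF M] and D = gal_memD[OF \<theta>]
  have "f a \<in> M" "f \<in> A \<rightarrow> M" "f a \<in> carrier R" "f \<in> A \<rightarrow> carrier R"
    "\<theta> (f a) \<in> carrier R" "(\<lambda>a. \<theta> (f a)) \<in> A \<rightarrow> carrier R"
    using insert.prems MC D(4) by (auto simp: Pi_def)
  then show ?case using insert D(5) subringE(6)[OF subfieldE(1)[OF M]] by simp
qed

end

context algebraically_closed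
begin

text \<open>M has the same automorphisms over E and over the fixed field F, hence the same degree
  over both, and the tower formula gives [F : E] = 1.\<close>

lemma fixed_field_gal:
  assumes M: "finite_galois_extension L E M" and inf: "infinite E"
  shows "fixed_field M (carrier (gal L E M)) = E"
proof -
  note D = finite_galois_extensionD[OF M]
  define F where "F = fixed_field M (carrier (gal L E M))"
  have F: "subfield F L" "E \<subseteq> F" "F \<subseteq> M"
    unfolding F_def using subfield_fixed_field[OF D(2) order_refl] gal_memD(3) D(3)
    by (auto simp: fixed_field_def)
  have MF: "finite_galois_extension L F M" by (rule finite_galois_extension_mid[OF M F])
  have "infinite F" using inf F(2) finite_subset by blast
  have "carrier (gal L F M) = carrier (gal L E M)"
    using carrier_gal_mono[OF F(2)] unfolding F_def fixed_field_def carrier_gal by blast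
  then have "dim E M = dim F M" using card_gal(1)[OF M inf] card_gal(1)[OF MF \<open>infinite F\<close>] by simp
  moreover have "dim E M = dim E F * dim F M"
    by (rule finite_dimension_tower(3)[OF D(1) F(1) D(2) F(2,3) D(4)])
  moreover have "dim F M > 0"
  proof -
    have "(\<lambda>x\<in>M. x) \<in> carrier (gal L F M)"
      using group.subgroup_self group_gal[OF subfieldE(1)[OF D(2)] F(3)] one_gal
      by (metis group.is_monoid monoid.one_closed)
    then show ?thesis using card_gal[OF MF \<open>infinite F\<close>] card_gt_0_iff by (metis empty_iff)
  qed
  ultimately have "dim E F = 1" by simp
  then have "dimension 1 E F"
    using finite_dimensionE[OF D(1) finite_dimension_tower(1)[OF D(1) F(1) D(2) F(2,3) D(4)]] by (simp add: over_def)
  then show ?thesis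
    using dimension_subset(2)[OF D(1) dimension_one[OF D(1)] _ F(2)] unfolding F_def by simp
qed

text \<open>For a primitive element \<open>c\<close> and \<open>e \<in> E\<close> the product of the \<open>e - s c\<close> over \<open>s \<in> S\<close> lies in the fixed
  field.  Since \<open>E\<close> is infinite, an automorphism fixing all these values permutes the roots \<open>s c\<close>.\<close>

lemma gal_fixed_field:
  assumes M: "finite_galois_extension L E M" and inf: "infinite E" and S: "subgroup S (gal L E M)"
  shows "carrier (gal L (fixed_field M S) M) = S"
proof
  note D = finite_galois_extensionD[OF M]
  note Mr = subfieldE(1)[OF D(2)]
  interpret G: group "gal L E M" by (rule group_gal[OF Mr D(3)])
  interpret S: subgroup S "gal L E M" by fact
  have SG: "s \<in> carrier (gal L E M)" if "s \<in> S" for s using S.mem_carrier[OF that] .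
  show "S \<subseteq> carrier (gal L (fixed_field M S) M)"
    using SG unfolding carrier_gal fixed_field_def by blast
  have finS: "finite S" using card_gal(2)[OF M inf] S.subset finite_subset by blast
  obtain c where c: "c \<in> M" "simple_extension E c = M"
    using primitive_element[OF D(1) inf D(5)] by blast
  show "carrier (gal L (fixed_field M S) M) \<subseteq> S"
  proof
    fix \<tau> assume \<tau>: "\<tau> \<in> carrier (gal L (fixed_field M S) M)"
    have EF: "E \<subseteq> fixed_field M S" using D(3) gal_memD(3)[OF SG] by (auto simp: fixed_field_def)
    have \<tau>E: "\<tau> \<in> carrier (gal L E M)" using carrier_gal_mono[OF EF] \<tau> by blast
    have sc: "s c \<in> M" if "s \<in> S" for s using gal_memD(4)[OF SG[OF that] c(1)] .
    have diff: "x \<ominus> y \<in> M" if "x \<in> M" "y \<in> M" for x y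
      using subringE(5,7)[OF Mr] that by (simp add: a_minus_def)
    have EM: "e \<in> M" "e \<in> carrier L" if "e \<in> E" for e using that D(3,9) by blast+
    have inv: "(\<Otimes>s\<in>S. e \<ominus> s c) \<in> fixed_field M S" if e: "e \<in> E" for e
    proof -
      have f: "(\<lambda>s. e \<ominus> s c) \<in> S \<rightarrow> M" using diff sc EM(1)[OF e] by blast
      have "\<rho> (\<Otimes>s\<in>S. e \<ominus> s c) = (\<Otimes>s\<in>S. e \<ominus> s c)" if \<rho>: "\<rho> \<in> S" for \<rho>
      proof -
        have "\<rho> (\<Otimes>s\<in>S. e \<ominus> s c) = (\<Otimes>s\<in>S. \<rho> (e \<ominus> s c))"
          using gal_finprod[OF D(2) SG[OF \<rho>] finS f] by simp
        \<comment> \<open>The element e of E is fixed by \<rho>, and left multiplication by \<rho>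
          permutes S, so reindexing brings back the original product.\<close>
        also have "\<dots> = (\<Otimes>s\<in>S. e \<ominus> (\<rho> \<otimes>\<^bsub>gal L E M\<^esub> s) c)"
        proof (rule finprod_cong')
          fix s assume s: "s \<in> S"
          show "\<rho> (e \<ominus> s c) = e \<ominus> (\<rho> \<otimes>\<^bsub>gal L E M\<^esub> s) c"
            using gal_zero_minus(2)[OF Mr SG[OF \<rho>] EM(1)[OF e] sc[OF s]] gal_memD(3)[OF SG[OF \<rho>] e]
              gal_mult_apply[OF SG[OF \<rho>] SG[OF s] c(1)] by simp
        next
          show "(\<lambda>s. e \<ominus> (\<rho> \<otimes>\<^bsub>gal L E M\<^esub> s) c) \<in> S \<rightarrow> carrier L"
            using diff sc EM(1)[OF e] D(9) S.m_closed[OF \<rho>] by blast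
        qed simp
        also have "\<dots> = (\<Otimes>s\<in>(\<lambda>s. \<rho> \<otimes>\<^bsub>gal L E M\<^esub> s) ` S. e \<ominus> s c)"
        proof (rule finprod_reindex[symmetric])
          show "(\<lambda>s. e \<ominus> s c) \<in> (\<lambda>s. \<rho> \<otimes>\<^bsub>gal L E M\<^esub> s) ` S \<rightarrow> carrier L"
            using diff sc EM(1)[OF e] D(9) S.m_closed[OF \<rho>] by blast
          show "inj_on (\<lambda>s. \<rho> \<otimes>\<^bsub>gal L E M\<^esub> s) S"
            using SG \<rho> by (intro inj_onI) (simp add: G.l_cancel)
        qed
        also have "(\<lambda>s. \<rho> \<otimes>\<^bsub>gal L E M\<^esub> s) ` S = S"
        proof (rule endo_inj_surj[OF finS])
          show "(\<lambda>s. \<rho> \<otimes>\<^bsub>gal L E M\<^esub> s) ` S \<subseteq> S" using S.m_closed[OF \<rho>] by blast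
          show "inj_on (\<lambda>s. \<rho> \<otimes>\<^bsub>gal L E M\<^esub> s) S"
            using SG \<rho> by (intro inj_onI) (simp add: G.l_cancel)
        qed
        finally show ?thesis .
      qed
      moreover have "(\<Otimes>s\<in>S. e \<ominus> s c) \<in> M" using gal_finprod[OF D(2) \<tau>E finS f] by simp
      ultimately show ?thesis by (simp add: fixed_field_def)
    qed
    have eq: "(\<Otimes>s\<in>S. e \<ominus> \<tau> (s c)) = (\<Otimes>s\<in>S. e \<ominus> s c)" if e: "e \<in> E" for e
    proof -
      have f: "(\<lambda>s. e \<ominus> s c) \<in> S \<rightarrow> M" using diff sc EM(1)[OF e] by blast
      have "(\<Otimes>s\<in>S. e \<ominus> \<tau> (s c)) = (\<Otimes>s\<in>S. \<tau> (e \<ominus> s c))"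
      proof (rule finprod_cong')
        fix s assume s: "s \<in> S"
        show "e \<ominus> \<tau> (s c) = \<tau> (e \<ominus> s c)"
          using gal_zero_minus(2)[OF Mr \<tau>E EM(1)[OF e] sc[OF s]] gal_memD(3)[OF \<tau>E e] by simp
      next
        show "(\<lambda>s. \<tau> (e \<ominus> s c)) \<in> S \<rightarrow> carrier L"
          using gal_memD(4)[OF \<tau>E] diff sc EM(1)[OF e] D(9) by blast
      qed simp
      also have "\<dots> = \<tau> (\<Otimes>s\<in>S. e \<ominus> s c)" using gal_finprod[OF D(2) \<tau>E finS f] by simp
      also have "\<dots> = (\<Otimes>s\<in>S. e \<ominus> s c)" using gal_memD(3)[OF \<tau> inv[OF e]] .
      finally show ?thesis .
    qed
    have f1: "(\<lambda>s. \<tau> (s c)) \<in> S \<rightarrow> carrier L" using sc gal_memD(4)[OF \<tau>E] D(9) by blast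
    have f2: "(\<lambda>s. s c) \<in> S \<rightarrow> carrier L" using sc D(9) by blast
    obtain p where p: "p \<in> carrier (poly_ring L)" "\<And>x. x \<in> carrier L \<Longrightarrow> eval p x = (\<Otimes>s\<in>S. x \<ominus> \<tau> (s c))"
      using exists_poly_finprod[OF finS f1] by blast
    obtain q where q: "q \<in> carrier (poly_ring L)" "\<And>x. x \<in> carrier L \<Longrightarrow> eval q x = (\<Otimes>s\<in>S. x \<ominus> s c)"
      using exists_poly_finprod[OF finS f2] by blast
    have tc: "\<tau> c \<in> carrier L" using gal_memD(4)[OF \<tau>E c(1)] D(9) by blast
    have "eval p (\<tau> c) = eval q (\<tau> c)"
      by (rule poly_eval_eq_of_infinite[OF p(1) q(1) inf _ _ tc]) (use EM(2) p(2) q(2) eq in auto)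
    then have PQ: "(\<Otimes>s\<in>S. \<tau> c \<ominus> \<tau> (s c)) = (\<Otimes>s\<in>S. \<tau> c \<ominus> s c)" using p(2) q(2) tc by simp
    \<comment> \<open>In the product on the left of \<open>PQ\<close> the factor of the identity is
      \<tau> c - \<tau> c = 0. So the right product vanishes too, and \<tau> c equals some s
      c.\<close>
    let ?e = "\<one>\<^bsub>gal L E M\<^esub>"
    have "?e c = c" using c(1) by (simp add: one_gal)
    have "(\<Otimes>s\<in>insert ?e (S - {?e}). \<tau> c \<ominus> \<tau> (s c)) =
        (\<tau> c \<ominus> \<tau> (?e c)) \<otimes> (\<Otimes>s\<in>S - {?e}. \<tau> c \<ominus> \<tau> (s c))"
      by (rule finprod_insert) (use finS tc f1 \<open>?e c = c\<close> in auto)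
    also have "\<dots> = \<zero> \<otimes> (\<Otimes>s\<in>S - {?e}. \<tau> c \<ominus> \<tau> (s c))"
      using tc \<open>?e c = c\<close> by (simp add: a_minus_def r_neg)
    also have "\<dots> = \<zero>" by (rule l_null) (use tc f1 in \<open>auto intro!: finprod_closed\<close>)
    finally have "(\<Otimes>s\<in>S. \<tau> c \<ominus> s c) = \<zero>" using PQ S.one_closed by (simp add: insert_absorb)
    then obtain s where s: "s \<in> S" "\<tau> c \<ominus> s c = \<zero>"
      using finprod_nonzero[OF finS, of "\<lambda>s. \<tau> c \<ominus> s c"] tc f2 by blast
    then have "\<tau> c = s c" using tc f2 by (simp add: Pi_def)
    then have "\<tau> = s" by (rule gal_determined[OF M c \<tau>E SG[OF s(1)]])
    then show "\<tau> \<in> S" using s(1) by simp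
  qed
qed

text \<open>Automorphisms permute the roots of minimal polynomials and so preserve the normal
  extension F. Normality is needed because the Herbrand property speaks of normal subgroups.\<close>

lemma gal_normal:
  assumes M: "finite_galois_extension L E M" and F: "finite_galois_extension L E F" "F \<subseteq> M"
  shows "carrier (gal L F M) \<lhd> gal L E M"
proof -
  note D = finite_galois_extensionD[OF M] and DF = finite_galois_extensionD[OF F(1)]
  note Mr = subfieldE(1)[OF D(2)]
  interpret G: group "gal L E M" by (rule group_gal[OF Mr D(3)])
  have stable: "s x \<in> F" if "s \<in> carrier (gal L E M)" "x \<in> F" for s x
    using gal_root[OF M that(1)] F(2) DF(6)[OF that(2)] that(2) by blast
  have "s \<otimes>\<^bsub>gal L E M\<^esub> h \<otimes>\<^bsub>gal L E M\<^esub> inv\<^bsub>gal L E M\<^esub> s \<in> carrier (gal L F M)"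
    if s: "s \<in> carrier (gal L E M)" and h: "h \<in> carrier (gal L F M)" for s h
  proof -
    have hE: "h \<in> carrier (gal L E M)" using carrier_gal_mono[OF DF(3)] h by blast
    have i: "inv\<^bsub>gal L E M\<^esub> s \<in> carrier (gal L E M)" using s by simp
    let ?t = "s \<otimes>\<^bsub>gal L E M\<^esub> h \<otimes>\<^bsub>gal L E M\<^esub> inv\<^bsub>gal L E M\<^esub> s"
    have "?t x = x" if x: "x \<in> F" for x
    proof -
      have xM: "x \<in> M" using x F(2) by blast
      have "?t x = s (h ((inv\<^bsub>gal L E M\<^esub> s) x))"
        using gal_mult_apply[OF _ i xM, of "s \<otimes>\<^bsub>gal L E M\<^esub> h"] gal_mult_apply[OF s hE gal_memD(4)[OF i xM]] s hE
        by simp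
      also have "h ((inv\<^bsub>gal L E M\<^esub> s) x) = (inv\<^bsub>gal L E M\<^esub> s) x"
        by (rule gal_memD(3)[OF h stable[OF i x]])
      also have "s ((inv\<^bsub>gal L E M\<^esub> s) x) = x" by (rule inv_gal(2)[OF Mr D(3) s xM])
      finally show ?thesis .
    qed
    moreover have "?t \<in> carrier (gal L E M)" using s hE by simp
    ultimately show ?thesis by (simp add: carrier_gal)
  qed
  then show ?thesis
    using subgroup_gal[OF Mr DF(3) F(2)] G.normal_inv_iff by blast
qed

text \<open>Separability and normality are conditions on single minimal polynomials and hence
  survive intersection, which gives two Galois extensions a common Galois subextension.\<close>

lemma finite_galois_extension_Int:
  assumes A: "finite_galois_extension L E A" and B: "finite_galois_extension L E B"
  shows "finite_galois_extension L E (A \<inter> B)"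
proof -
  note DA = finite_galois_extensionD[OF A] and DB = finite_galois_extensionD[OF B]
  have AB: "subfield (A \<inter> B) L" by (rule subfield_Int[OF DA(2) DB(2)])
  have "finite_separable_extension L E (A \<inter> B)"
    by (rule finite_separable_extension_mid(1)[OF DA(5) AB]) (use DA(3) DB(3) in auto)
  then show ?thesis using DA(6) DB(6) by (auto simp: finite_galois_extension_def)
qed

end

lemma galois_closure_galois:
  assumes "finite_galois_extension \<Omega> E M"
  shows "galois_closure \<Omega> E M = M"
  using assms by (auto simp: galois_closure_def)

section \<open>Herbrand functions of towers\<close>

text \<open>The second assumption is the convention that finite extensions of a Herbrand field are
  Herbrand fields; it makes the Herbrand property available over intermediate fields E as
  base.\<close>

locale herbrand_base = algebraic_closure \<Omega> K for \<Omega> (structure) and K +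
  fixes v :: "'a \<Rightarrow> real"
  assumes herbrand_K: "herbrand_field \<Omega> K v"
    and herbrand_extensions:
      "\<And>E. finite_separable_extension \<Omega> K E \<Longrightarrow> herbrand_field \<Omega> E (ext_norm \<Omega> K v E)"

lemma valued_fieldD:
  assumes "valued_field \<Omega> M w"
  shows "subfield M \<Omega>" "\<And>x. x \<in> M \<Longrightarrow> 0 \<le> w x" "\<And>x. x \<in> M \<Longrightarrow> w x = 0 \<longleftrightarrow> x = \<zero>\<^bsub>\<Omega>\<^esub>"
    "\<And>x y. x \<in> M \<Longrightarrow> y \<in> M \<Longrightarrow> w (x \<otimes>\<^bsub>\<Omega>\<^esub> y) = w x * w y"
    "\<And>x y. x \<in> M \<Longrightarrow> y \<in> M \<Longrightarrow> w (x \<oplus>\<^bsub>\<Omega>\<^esub> y) \<le> max (w x) (w y)"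
    "\<exists>x\<in>M. x \<noteq> \<zero>\<^bsub>\<Omega>\<^esub> \<and> w x \<noteq> 1"
  using assms unfolding valued_field_def by blast+

context field
begin

lemma valued_field_one_minus:
  assumes "valued_field R M w"
  shows "w \<one> = 1" "\<And>x. x \<in> M \<Longrightarrow> w (\<ominus> x) = w x"
    "\<And>x y. x \<in> M \<Longrightarrow> y \<in> M \<Longrightarrow> w (x \<ominus> y) \<le> max (w x) (w y)"
proof -
  note V = valued_fieldD[OF assms]
  note m = subringE[OF subfieldE(1)[OF V(1)]]
  have "w \<one> * w \<one> = w \<one>" using V(4)[OF m(3) m(3)] by simp
  moreover have "w \<one> \<noteq> 0" using V(3)[OF m(3)] by simp
  ultimately show w1: "w \<one> = 1" by simp
  have mo: "\<ominus> \<one> \<in> M" using m(3,5) by blast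
  have "w (\<ominus> \<one>) * w (\<ominus> \<one>) = w ((\<ominus> \<one>) \<otimes> (\<ominus> \<one>))" using V(4)[OF mo mo] by simp
  also have "(\<ominus> \<one>) \<otimes> (\<ominus> \<one>) = \<one>" by (simp add: l_minus)
  finally have "(w (\<ominus> \<one>))\<^sup>2 = 1" using w1 by (simp add: power2_eq_square)
  then have wm: "w (\<ominus> \<one>) = 1" using V(2)[OF mo] by (simp add: power2_eq_1_iff)
  show neg: "w (\<ominus> x) = w x" if "x \<in> M" for x
  proof -
    have "x \<in> carrier R" using m(1) that by blast
    then have "\<ominus> x = (\<ominus> \<one>) \<otimes> x" by (simp add: l_minus)
    then show ?thesis using V(4)[OF mo that] wm by simp
  qed
  show "w (x \<ominus> y) \<le> max (w x) (w y)" if "x \<in> M" "y \<in> M" for x y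
    using V(5)[OF that(1) m(5)[OF that(2)]] neg[OF that(2)] by (simp add: a_minus_def)
qed

text \<open>A nonzero element of norm different from 1 has infinitely many distinct powers. This
  supplies the infinite ground fields for the Galois theory.\<close>

lemma valued_field_infinite:
  assumes "valued_field R M w"
  shows "infinite M"
proof -
  note V = valued_fieldD[OF assms]
  note m = subringE[OF subfieldE(1)[OF V(1)]]
  obtain x where x: "x \<in> M" "x \<noteq> \<zero>" "w x \<noteq> 1" using V(6) by blast
  have M: "x [^] (n::nat) \<in> M" for n by (induction n) (use m(3,6) x(1) in auto)
  have pow: "w (x [^] (n::nat)) = w x ^ n" for n
    by (induction n) (use V(4)[OF M x(1)] valued_field_one_minus(1)[OF assms] in auto)
  have pos: "w x > 0" using V(2,3)[OF x(1)] x(2) by simp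
  have "inj (\<lambda>n::nat. x [^] n)"
  proof (rule injI)
    fix k n :: nat assume "x [^] k = x [^] n"
    then have "w x ^ k = w x ^ n" using pow by metis
    then show "k = n" using pos x(3) power_inject_exp'[of "w x" k n] by auto
  qed
  then show ?thesis using M infinite_super[of "range (\<lambda>n::nat. x [^] n)" M] range_inj_infinite by blast
qed

end

context herbrand_base
begin

lemma henselian_K: "henselian \<Omega> K v" "valued_field \<Omega> K v"
  using herbrand_K by (auto simp: herbrand_field_def henselian_def)

lemma infinite_extension: "K \<subseteq> E \<Longrightarrow> infinite E"
  using valued_field_infinite[OF henselian_K(2)] finite_subset by blast

lemma ext_normI:
  assumes "henselian \<Omega> E u" "Defs.finite_extension \<Omega> E M"
  shows "norm_extension \<Omega> E u M (ext_norm \<Omega> E u M)"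
    "\<And>w. norm_extension \<Omega> E u M w \<Longrightarrow> w = ext_norm \<Omega> E u M"
proof -
  have ex: "\<exists>!w. norm_extension \<Omega> E u M w" using assms by (auto simp: henselian_def)
  show "norm_extension \<Omega> E u M (ext_norm \<Omega> E u M)"
    unfolding ext_norm_def by (rule theI'[OF ex])
  then show "w = ext_norm \<Omega> E u M" if "norm_extension \<Omega> E u M w" for w using ex that by blast
qed

text \<open>Uniqueness is used twice: over K it identifies the restriction of the norm of M to E
  with the norm of E; over E it then identifies the norm of M with the extension of that
  norm.\<close>

lemma ext_norm_tower:
  assumes M: "finite_separable_extension \<Omega> K M" and E: "subfield E \<Omega>" "K \<subseteq> E" "E \<subseteq> M"
  shows "ext_norm \<Omega> E (ext_norm \<Omega> K v E) M = ext_norm \<Omega> K v M"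
proof -
  let ?w = "ext_norm \<Omega> K v M"
  have fM: "Defs.finite_extension \<Omega> K M" using M by (simp add: finite_separable_extension_def)
  note sE = finite_separable_extension_mid[OF M E]
  have fE: "Defs.finite_extension \<Omega> K E" "Defs.finite_extension \<Omega> E M"
    using sE by (simp_all add: finite_separable_extension_def)
  have w: "norm_extension \<Omega> K v M ?w" by (rule ext_normI(1)[OF henselian_K(1) fM])
  then have wv: "valued_field \<Omega> M ?w" "\<And>x. x \<in> K \<Longrightarrow> ?w x = v x" "?w \<in> extensional M"
    by (auto simp: norm_extension_def)
  note m = subringE[OF subfieldE(1)[OF E(1)]]
  have "valued_field \<Omega> E (restrict ?w E)"
    unfolding valued_field_def
  proof (intro conjI)
    show "\<exists>x\<in>E. x \<noteq> \<zero> \<and> restrict ?w E x \<noteq> 1"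
      using valued_fieldD(6)[OF henselian_K(2)] wv(2) E(2) by fastforce
  qed (use valued_fieldD[OF wv(1)] E m in \<open>auto simp: subset_iff\<close>)
  then have "norm_extension \<Omega> K v E (restrict ?w E)"
    using wv(2) E(2) by (auto simp: norm_extension_def)
  then have "restrict ?w E = ext_norm \<Omega> K v E" by (rule ext_normI(2)[OF henselian_K(1) fE(1)])
  from fun_cong[OF this] have "?w x = ext_norm \<Omega> K v E x" if "x \<in> E" for x
    using that by (metis restrict_apply')
  then have "norm_extension \<Omega> E (ext_norm \<Omega> K v E) M ?w"
    using wv(1,3) by (simp add: norm_extension_def)
  moreover have "henselian \<Omega> E (ext_norm \<Omega> K v E)"
    using herbrand_extensions[OF sE(1)] by (simp add: herbrand_field_def)
  ultimately show ?thesis using ext_normI(2)[OF _ fE(2)] by simp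
qed

end

section \<open>Inertia as a length on the Galois group\<close>

locale herbrand_galois = herbrand_base +
  fixes M
  assumes galois: "finite_galois_extension \<Omega> K M"
begin

abbreviation "w \<equiv> ext_norm \<Omega> K v M"
abbreviation "i \<equiv> inertia \<Omega> M w"
abbreviation "Gal E \<equiv> carrier (gal \<Omega> E M)"

lemmas galD = finite_galois_extensionD[OF galois]

lemma norm_M: "norm_extension \<Omega> K v M w" "\<And>w'. norm_extension \<Omega> K v M w' \<Longrightarrow> w' = w"
  using ext_normI[OF henselian_K(1)] galD(5) by (simp_all add: finite_separable_extension_def)

lemma valued_M: "valued_field \<Omega> M w"
  using norm_M(1) by (simp add: norm_extension_def)

text \<open>The norm composed with an automorphism again extends the norm of K, so by uniqueness it
  is the same norm.\<close>

lemma norm_gal: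
  assumes "\<theta> \<in> Gal K" "x \<in> M"
  shows "w (\<theta> x) = w x"
proof -
  note D = gal_memD[OF assms(1)] and V = valued_fieldD[OF valued_M]
  note m = subringE[OF subfieldE(1)[OF V(1)]]
  have z: "\<theta> y = \<zero> \<longleftrightarrow> y = \<zero>" if "y \<in> M" for y
    using inj_on_eq_iff[OF bij_betw_imp_inj_on[OF D(2)] that m(2)]
      gal_zero_minus(1)[OF subfieldE(1)[OF V(1)] assms(1)] by simp
  have wK: "w x = v x" if "x \<in> K" for x using norm_M(1) that by (simp add: norm_extension_def)
  let ?u = "\<lambda>x\<in>M. w (\<theta> x)"
  have "valued_field \<Omega> M ?u"
    unfolding valued_field_def
  proof (intro conjI)
    show "\<exists>x\<in>M. x \<noteq> \<zero> \<and> ?u x \<noteq> 1"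
    proof -
      obtain x where "x \<in> K" "x \<noteq> \<zero>" "v x \<noteq> 1" using valued_fieldD(6)[OF henselian_K(2)] by blast
      then show ?thesis using galD(3) D(3) wK by (intro bexI[of _ x]) auto
    qed
    show "\<forall>x\<in>M. 0 \<le> ?u x" using V(2)[OF D(4)] by simp
    show "\<forall>x\<in>M. ?u x = 0 \<longleftrightarrow> x = \<zero>" using V(3)[OF D(4)] z by simp
    show "\<forall>x\<in>M. \<forall>y\<in>M. ?u (x \<otimes> y) = ?u x * ?u y"
      using V(4)[OF D(4) D(4)] D(5) m(6) by simp
    show "\<forall>x\<in>M. \<forall>y\<in>M. ?u (x \<oplus> y) \<le> max (?u x) (?u y)"
      using V(5)[OF D(4) D(4)] D(6) m(7) by simp
  qed (rule V(1))
  then have "norm_extension \<Omega> K v M ?u"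
    using galD(3) D(3) wK by (auto simp: norm_extension_def)
  then have "?u = w" by (rule norm_M(2))
  from fun_cong[OF this, of x] show ?thesis using assms(2) by simp
qed

lemma norm_sub: "x \<in> M \<Longrightarrow> y \<in> M \<Longrightarrow> w (x \<ominus> y) \<le> max (w x) (w y)"
  by (rule valued_field_one_minus(3)[OF valued_M])

lemma norm_neg: "x \<in> M \<Longrightarrow> w (\<ominus> x) = w x"
  by (rule valued_field_one_minus(2)[OF valued_M])

lemma sub_closed: "x \<in> M \<Longrightarrow> y \<in> M \<Longrightarrow> x \<ominus> y \<in> M"
  using subringE(5,7)[OF subfieldE(1)[OF galD(2)]] by (simp add: a_minus_def)

lemma norm_diff_le:
  assumes "\<theta> \<in> Gal K" "t \<in> M" "w t \<le> 1"
  shows "w (\<theta> t \<ominus> t) \<le> 1"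
  using norm_sub[OF gal_memD(4)[OF assms(1,2)] assms(2)] norm_gal[OF assms(1,2)] assms(3) by simp

text \<open>A real supremum is an upper bound only for a bounded set; here isometry and the
  ultrametric inequality bound the set by 1.\<close>

lemma inertia_upper:
  assumes "\<theta> \<in> Gal K" "t \<in> M" "w t \<le> 1"
  shows "w (\<theta> t \<ominus> t) \<le> i \<theta>"
  unfolding inertia_def
proof (rule cSUP_upper)
  show "bdd_above ((\<lambda>t. w (\<theta> t \<ominus> t)) ` {t \<in> M. w t \<le> 1})"
    using norm_diff_le[OF assms(1)] by (auto simp: bdd_above_def)
qed (use assms in auto)

lemma zero_integral: "\<zero> \<in> M" "w \<zero> = 0"
  using subringE(2)[OF subfieldE(1)[OF galD(2)]] valued_fieldD(3)[OF valued_M] by auto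

lemma inertia_least:
  assumes "\<And>t. t \<in> M \<Longrightarrow> w t \<le> 1 \<Longrightarrow> w (\<theta> t \<ominus> t) \<le> b"
  shows "i \<theta> \<le> b"
  unfolding inertia_def
proof (rule cSUP_least)
  have "\<zero> \<in> {t \<in> M. w t \<le> 1}" using zero_integral by simp
  then show "{t \<in> M. w t \<le> 1} \<noteq> {}" by blast
qed (use assms in auto)

lemma inertia_nonneg: "\<theta> \<in> Gal K \<Longrightarrow> 0 \<le> i \<theta>"
  using inertia_upper[of \<theta> \<zero>] zero_integral gal_zero_minus(1)[OF subfieldE(1)[OF galD(2)], of \<theta> K]
  by (simp add: a_minus_def)

text \<open>Inertia 0 fixes the integral elements, and an element that is not integral has an
  integral inverse.\<close>

lemma inertia_zero_imp_fixed:
  assumes \<theta>: "\<theta> \<in> Gal K" and "i \<theta> = 0" and x: "x \<in> M"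
  shows "\<theta> x = x"
proof -
  note V = valued_fieldD[OF valued_M]
  have int: "\<theta> t = t" if t: "t \<in> M" "w t \<le> 1" for t
  proof -
    note tM = gal_memD(4)[OF \<theta> t(1)]
    have "w (\<theta> t \<ominus> t) = 0"
      using inertia_upper[OF \<theta> t] assms(2) V(2)[OF sub_closed[OF tM t(1)]] by simp
    then have "\<theta> t \<ominus> t = \<zero>" using V(3)[OF sub_closed[OF tM t(1)]] by simp
    then show ?thesis using galD(9)[OF tM] galD(9)[OF t(1)] by simp
  qed
  show ?thesis
  proof (cases "w x \<le> 1")
    case True
    then show ?thesis using int x by blast
  next
    case False
    then have "x \<noteq> \<zero>" using zero_integral by auto
    note I = subfield_inverse[OF galD(2) x \<open>x \<noteq> \<zero>\<close>]
    have "w x * w (inv x) = 1" using V(4)[OF x I(1)] I(2) valued_field_one_minus(1)[OF valued_M] by simp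
    then have "w (inv x) = inverse (w x)" by (simp add: inverse_unique)
    then have "w (inv x) \<le> 1" using False by (simp add: inverse_le_1_iff)
    then have "\<theta> (inv x) = inv x" using int I(1) by blast
    then have eq: "inv x = inv (\<theta> x)" using gal_inverse[OF galD(2) \<theta> x \<open>x \<noteq> \<zero>\<close>] by simp
    have tx: "\<theta> x \<in> M" by (rule gal_memD(4)[OF \<theta> x])
    have "\<theta> x \<noteq> \<zero>"
      using norm_gal[OF \<theta> x] V(3)[OF tx] V(3)[OF x] \<open>x \<noteq> \<zero>\<close> by simp
    have "\<theta> x = \<theta> x \<otimes> (inv x \<otimes> x)" using I(3) galD(9)[OF tx] by simp
    also have "\<dots> = (\<theta> x \<otimes> inv (\<theta> x)) \<otimes> x" using eq I(4) galD(9)[OF tx] galD(9)[OF x] by (simp add: m_assoc)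
    also have "\<dots> = x" using subfield_inverse(2)[OF galD(2) tx \<open>\<theta> x \<noteq> \<zero>\<close>] galD(9)[OF x] by simp
    finally show ?thesis .
  qed
qed

lemma group_Gal: "group (gal \<Omega> K M)"
  by (rule group_gal[OF subfieldE(1)[OF galD(2)] galD(3)])

text \<open>Automorphisms are isometries, so inversion and conjugation only reparametrize the
  integral elements over which the supremum runs. For products the difference \<rho> \<tau> t - t is
  split at \<tau> t.\<close>

sublocale ramified: ramified_group "gal \<Omega> K M" i
proof (rule ramified_group.intro[OF group_Gal], unfold_locales)
  interpret G: group "gal \<Omega> K M" by (rule group_Gal)
  note Mr = subfieldE(1)[OF galD(2)]
  show "finite (Gal K)" by (rule card_gal(2)[OF galois infinite_extension[OF order_refl]])
  fix \<theta> assume \<theta>: "\<theta> \<in> Gal K"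
  show "0 \<le> i \<theta>" by (rule inertia_nonneg[OF \<theta>])
  show "i \<theta> \<le> 1" by (rule inertia_least) (rule norm_diff_le[OF \<theta>])
  show "i \<theta> = 0 \<longleftrightarrow> \<theta> = \<one>\<^bsub>gal \<Omega> K M\<^esub>"
  proof
    assume "i \<theta> = 0"
    then show "\<theta> = \<one>\<^bsub>gal \<Omega> K M\<^esub>"
      unfolding one_gal using inertia_zero_imp_fixed[OF \<theta>] gal_memD(1)[OF \<theta>]
      by (intro extensionalityI[of _ M]) auto
  next
    assume "\<theta> = \<one>\<^bsub>gal \<Omega> K M\<^esub>"
    then have "i \<theta> \<le> 0"
      using zero_integral(2) galD(9) by (intro inertia_least) (simp add: one_gal a_minus_def r_neg)
    then show "i \<theta> = 0" using inertia_nonneg[OF \<theta>] by simp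
  qed
  have inv_le: "i (inv\<^bsub>gal \<Omega> K M\<^esub> \<rho>) \<le> i \<rho>" if \<rho>: "\<rho> \<in> Gal K" for \<rho>
  proof (rule inertia_least)
    fix t assume t: "t \<in> M" "w t \<le> 1"
    let ?s = "(inv\<^bsub>gal \<Omega> K M\<^esub> \<rho>) t"
    have s: "?s \<in> M" "\<rho> ?s = t" "w ?s \<le> 1"
      using gal_memD(4)[OF G.inv_closed[OF \<rho>] t(1)] inv_gal(2)[OF Mr galD(3) \<rho> t(1)]
        norm_gal[OF G.inv_closed[OF \<rho>] t(1)] t(2) by auto
    have "?s \<ominus> t = \<ominus> (\<rho> ?s \<ominus> ?s)"
      using s(2) galD(9)[OF s(1)] galD(9)[OF t(1)] by (simp add: a_minus_def minus_add a_comm)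
    then have "w (?s \<ominus> t) = w (\<rho> ?s \<ominus> ?s)"
      using norm_neg[OF sub_closed[OF gal_memD(4)[OF \<rho> s(1)] s(1)]] by simp
    then show "w (?s \<ominus> t) \<le> i \<rho>" using inertia_upper[OF \<rho> s(1,3)] by simp
  qed
  show "i (inv\<^bsub>gal \<Omega> K M\<^esub> \<theta>) = i \<theta>"
    using inv_le[OF \<theta>] inv_le[OF G.inv_closed[OF \<theta>]] \<theta> by simp
  have mult_le: "i (\<rho> \<otimes>\<^bsub>gal \<Omega> K M\<^esub> \<tau>) \<le> max (i \<rho>) (i \<tau>)" if \<rho>: "\<rho> \<in> Gal K" and \<tau>: "\<tau> \<in> Gal K" for \<rho> \<tau>
  proof (rule inertia_least)
    fix t assume t: "t \<in> M" "w t \<le> 1"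
    have s: "\<tau> t \<in> M" "w (\<tau> t) \<le> 1" using gal_memD(4)[OF \<tau> t(1)] norm_gal[OF \<tau> t(1)] t(2) by auto
    have r: "\<rho> (\<tau> t) \<in> M" by (rule gal_memD(4)[OF \<rho> s(1)])
    note d = sub_closed[OF r s(1)] sub_closed[OF s(1) t(1)]
    have "(\<rho> \<otimes>\<^bsub>gal \<Omega> K M\<^esub> \<tau>) t \<ominus> t = \<rho> (\<tau> t) \<ominus> t" using gal_mult_apply[OF \<rho> \<tau> t(1)] by simp
    also have "\<dots> = (\<rho> (\<tau> t) \<ominus> \<tau> t) \<oplus> (\<tau> t \<ominus> t)"
      using galD(9)[OF t(1)] galD(9)[OF s(1)] galD(9)[OF r] by algebra
    finally have "w ((\<rho> \<otimes>\<^bsub>gal \<Omega> K M\<^esub> \<tau>) t \<ominus> t) \<le> max (w (\<rho> (\<tau> t) \<ominus> \<tau> t)) (w (\<tau> t \<ominus> t))"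
      using valued_fieldD(5)[OF valued_M d] by simp
    then show "w ((\<rho> \<otimes>\<^bsub>gal \<Omega> K M\<^esub> \<tau>) t \<ominus> t) \<le> max (i \<rho>) (i \<tau>)"
      using inertia_upper[OF \<rho> s] inertia_upper[OF \<tau> t] by linarith
  qed
  fix \<tau> assume \<tau>: "\<tau> \<in> Gal K"
  show "i (\<theta> \<otimes>\<^bsub>gal \<Omega> K M\<^esub> \<tau>) \<le> max (i \<theta>) (i \<tau>)" by (rule mult_le[OF \<theta> \<tau>])
  have conj_le: "i (\<rho> \<otimes>\<^bsub>gal \<Omega> K M\<^esub> \<mu> \<otimes>\<^bsub>gal \<Omega> K M\<^esub> inv\<^bsub>gal \<Omega> K M\<^esub> \<rho>) \<le> i \<mu>"
    if \<rho>: "\<rho> \<in> Gal K" and \<mu>: "\<mu> \<in> Gal K" for \<rho> \<mu>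
  proof (rule inertia_least)
    fix t assume t: "t \<in> M" "w t \<le> 1"
    note \<rho>i = G.inv_closed[OF \<rho>]
    let ?s = "(inv\<^bsub>gal \<Omega> K M\<^esub> \<rho>) t"
    have s: "?s \<in> M" "\<rho> ?s = t" "w ?s \<le> 1"
      using gal_memD(4)[OF \<rho>i t(1)] inv_gal(2)[OF Mr galD(3) \<rho> t(1)] norm_gal[OF \<rho>i t(1)] t(2) by auto
    have ms: "\<mu> ?s \<in> M" by (rule gal_memD(4)[OF \<mu> s(1)])
    have "(\<rho> \<otimes>\<^bsub>gal \<Omega> K M\<^esub> \<mu> \<otimes>\<^bsub>gal \<Omega> K M\<^esub> inv\<^bsub>gal \<Omega> K M\<^esub> \<rho>) t = \<rho> (\<mu> ?s)"
      using gal_mult_apply[OF G.m_closed[OF \<rho> \<mu>] \<rho>i t(1)] gal_mult_apply[OF \<rho> \<mu> s(1)] by simp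
    then have "(\<rho> \<otimes>\<^bsub>gal \<Omega> K M\<^esub> \<mu> \<otimes>\<^bsub>gal \<Omega> K M\<^esub> inv\<^bsub>gal \<Omega> K M\<^esub> \<rho>) t \<ominus> t = \<rho> (\<mu> ?s \<ominus> ?s)"
      using gal_zero_minus(2)[OF Mr \<rho> ms s(1)] s(2) by simp
    then show "w ((\<rho> \<otimes>\<^bsub>gal \<Omega> K M\<^esub> \<mu> \<otimes>\<^bsub>gal \<Omega> K M\<^esub> inv\<^bsub>gal \<Omega> K M\<^esub> \<rho>) t \<ominus> t) \<le> i \<mu>"
      using norm_gal[OF \<rho> sub_closed[OF ms s(1)]] inertia_upper[OF \<mu> s(1,3)] by simp
  qed
  let ?c = "\<theta> \<otimes>\<^bsub>gal \<Omega> K M\<^esub> \<tau> \<otimes>\<^bsub>gal \<Omega> K M\<^esub> inv\<^bsub>gal \<Omega> K M\<^esub> \<theta>"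
  \<comment> \<open>Conjugating back by the inverse turns the one-sided estimate
    \<open>conj_le\<close> into an equality.\<close>
  have "inv\<^bsub>gal \<Omega> K M\<^esub> \<theta> \<otimes>\<^bsub>gal \<Omega> K M\<^esub> ?c \<otimes>\<^bsub>gal \<Omega> K M\<^esub> inv\<^bsub>gal \<Omega> K M\<^esub> (inv\<^bsub>gal \<Omega> K M\<^esub> \<theta>) = \<tau>"
  proof -
    have "inv\<^bsub>gal \<Omega> K M\<^esub> \<theta> \<otimes>\<^bsub>gal \<Omega> K M\<^esub> ?c = \<tau> \<otimes>\<^bsub>gal \<Omega> K M\<^esub> inv\<^bsub>gal \<Omega> K M\<^esub> \<theta>"
      using \<theta> \<tau> by (simp flip: G.m_assoc)
    then show ?thesis using \<theta> \<tau> by (simp add: G.m_assoc)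
  qed
  then show "i ?c = i \<tau>" using conj_le[OF \<theta> \<tau>] conj_le[OF G.inv_closed[OF \<theta>], of ?c] \<theta> \<tau> by simp
qed

end

section \<open>Independence of the ambient Galois extension\<close>

context herbrand_base
begin

abbreviation inertia_on :: "'a set \<Rightarrow> ('a \<Rightarrow> 'a) \<Rightarrow> real" where
  "inertia_on N \<equiv> inertia \<Omega> N (ext_norm \<Omega> K v N)"

abbreviation herbrand_in :: "'a set \<Rightarrow> 'a set \<Rightarrow> 'a set \<Rightarrow> real \<Rightarrow> real" where
  "herbrand_in N E F \<equiv>
     herbrand_quotient (inertia_on N) (carrier (gal \<Omega> F N)) (carrier (gal \<Omega> E N))"

lemma herbrand_galoisI: "finite_galois_extension \<Omega> K N \<Longrightarrow> herbrand_galois \<Omega> K v N"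
  by (intro herbrand_galois.intro herbrand_base_axioms herbrand_galois_axioms.intro)

lemma galois_herbrand_eq_max_prod:
  "galois_herbrand \<Omega> E N w = max_prod (inertia \<Omega> N w) (carrier (gal \<Omega> E N))"
  by (simp add: galois_herbrand_def max_prod_def fun_eq_iff)

lemma subgroup_Gal:
  assumes N: "finite_galois_extension \<Omega> K N" and "K \<subseteq> E" "E \<subseteq> N"
  shows "subgroup (carrier (gal \<Omega> E N)) (gal \<Omega> K N)"
  using subgroup_gal[OF subfieldE(1)[OF finite_galois_extensionD(2)[OF N]]] assms by blast

lemma unit_weight_Gal:
  assumes N: "finite_galois_extension \<Omega> K N" and "K \<subseteq> E" "E \<subseteq> N"
  shows "unit_weight (inertia_on N) (carrier (gal \<Omega> E N))"
proof -
  interpret N: herbrand_galois \<Omega> K v N by (rule herbrand_galoisI[OF N])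
  show ?thesis by (rule N.ramified.unit_weight_subgroup[OF subgroup_Gal[OF assms]])
qed

text \<open>The Herbrand property of N1 over E for the normal subgroup Gal(N1/N0), whose fixed field
  is N0. Norms extended from E agree with those extended from K by
  \<open>ext_norm_tower\<close>.\<close>

lemma max_prod_tower:
  assumes N0: "finite_galois_extension \<Omega> K N0" and N1: "finite_galois_extension \<Omega> K N1" and sub: "N0 \<subseteq> N1"
    and E: "subfield E \<Omega>" "K \<subseteq> E" "E \<subseteq> N0" and r: "r \<in> {0..1}"
  shows "max_prod (inertia_on N1) (carrier (gal \<Omega> E N1)) r =
    max_prod (inertia_on N0) (carrier (gal \<Omega> E N0)) (max_prod (inertia_on N1) (carrier (gal \<Omega> N0 N1)) r)"
proof -
  note D0 = finite_galois_extensionD[OF N0] and D1 = finite_galois_extensionD[OF N1]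
  have EN1: "E \<subseteq> N1" using E(3) sub by blast
  note G0 = finite_galois_extension_mid[OF N0 E] and G1 = finite_galois_extension_mid[OF N1 E(1,2) EN1]
  let ?v = "ext_norm \<Omega> K v E"
  have "herbrand_field \<Omega> E ?v"
    by (rule herbrand_extensions[OF finite_separable_extension_mid(1)[OF D1(5) E(1,2) EN1]])
  then have "herbrand_extension \<Omega> E ?v N1"
    using finite_galois_extensionD(5)[OF G1] by (simp add: herbrand_field_def)
  then have H: "galois_herbrand_extension \<Omega> E ?v N1"
    by (simp add: herbrand_extension_def galois_closure_galois[OF G1])
  have fixed: "fixed_field N1 (carrier (gal \<Omega> N0 N1)) = N0"
    by (rule fixed_field_gal[OF finite_galois_extension_mid[OF N1 D0(2,3) sub] infinite_extension[OF D0(3)]])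
  have "\<forall>H. H \<lhd> gal \<Omega> E N1 \<longrightarrow> (\<forall>r\<in>{0..1}. galois_herbrand \<Omega> E N1 (ext_norm \<Omega> E ?v N1) r =
      galois_herbrand \<Omega> E (fixed_field N1 H) (ext_norm \<Omega> E ?v (fixed_field N1 H))
        (galois_herbrand \<Omega> (fixed_field N1 H) N1 (ext_norm \<Omega> E ?v N1) r))"
    using H by (simp add: galois_herbrand_extension_def Let_def)
  from this[rule_format, OF gal_normal[OF G1 G0 sub] r] show ?thesis
    unfolding fixed ext_norm_tower[OF D1(5) E(1,2) EN1] ext_norm_tower[OF D0(5) E] galois_herbrand_eq_max_prod .
qed

text \<open>Passing from N0 to N1 composes the functions for E and for F with the same inner
  function, that of N1 over N0, which cancels in the quotient.\<close>

lemma herbrand_in_subfield: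
  assumes N0: "finite_galois_extension \<Omega> K N0" and N1: "finite_galois_extension \<Omega> K N1" and sub: "N0 \<subseteq> N1"
    and E: "subfield E \<Omega>" "K \<subseteq> E" "E \<subseteq> N0" and F: "subfield F \<Omega>" "K \<subseteq> F" "F \<subseteq> N0" and r: "r \<in> {0..1}"
  shows "herbrand_in N1 E F r = herbrand_in N0 E F r"
proof -
  note D0 = finite_galois_extensionD[OF N0]
  have F1: "F \<subseteq> N1" using F(3) sub by blast
  note W1 = unit_weight_Gal[OF N1 F(2) F1] and W0 = unit_weight_Gal[OF N0 F(2,3)]
    and W = unit_weight_Gal[OF N1 D0(3) sub]
  obtain s where s: "s \<in> {0..1}" "r = max_prod (inertia_on N1) (carrier (gal \<Omega> F N1)) s"
    using max_prod_image[OF W1] r by (metis imageE)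
  define u where "u = max_prod (inertia_on N1) (carrier (gal \<Omega> N0 N1)) s"
  have u: "u \<in> {0..1}" unfolding u_def using max_prod_image[OF W] s(1) by (metis imageI)
  have "herbrand_in N1 E F r = max_prod (inertia_on N1) (carrier (gal \<Omega> E N1)) s"
    unfolding s(2) by (rule herbrand_quotient_max_prod[OF W1 s(1)])
  also have "\<dots> = max_prod (inertia_on N0) (carrier (gal \<Omega> E N0)) u"
    unfolding u_def by (rule max_prod_tower[OF N0 N1 sub E s(1)])
  also have "\<dots> = herbrand_in N0 E F (max_prod (inertia_on N0) (carrier (gal \<Omega> F N0)) u)"
    by (rule herbrand_quotient_max_prod[OF W0 u, symmetric])
  also have "max_prod (inertia_on N0) (carrier (gal \<Omega> F N0)) u = r"
    unfolding s(2) u_def by (rule max_prod_tower[OF N0 N1 sub F s(1), symmetric])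
  finally show ?thesis .
qed

lemma herbrand_eq_herbrand_in:
  assumes N: "finite_galois_extension \<Omega> K N" and E: "subfield E \<Omega>" "K \<subseteq> E" "E \<subseteq> F"
    and F: "subfield F \<Omega>" "F \<subseteq> N" and r: "r \<in> {0..1}"
  shows "herbrand \<Omega> K v E F r = herbrand_in N E F r"
proof -
  \<comment> \<open>The extension chosen inside \<open>herbrand\<close>. It meets N in a Galois
    extension that still contains F.\<close>
  define N' where "N' = (SOME N. finite_galois_extension \<Omega> K N \<and> F \<subseteq> N)"
  have N': "finite_galois_extension \<Omega> K N'" "F \<subseteq> N'"
    using someI[of "\<lambda>N. finite_galois_extension \<Omega> K N \<and> F \<subseteq> N", OF conjI[OF N F(2)]]
    by (simp_all add: N'_def)
  have "herbrand \<Omega> K v E F r = herbrand_in N' E F r"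
    unfolding herbrand_def N'_def[symmetric] Let_def herbrand_quotient_def galois_herbrand_eq_max_prod ..
  also have "\<dots> = herbrand_in (N \<inter> N') E F r"
    by (rule herbrand_in_subfield[OF finite_galois_extension_Int[OF N N'(1)] N'(1) _ E(1,2) _ F(1) _ _ r])
      (use E F N' in auto)
  also have "\<dots> = herbrand_in N E F r"
    by (rule herbrand_in_subfield[OF finite_galois_extension_Int[OF N N'(1)] N _ E(1,2) _ F(1) _ _ r, symmetric])
      (use E F N' in auto)
  finally show ?thesis .
qed

end

section \<open>Translation of towers into chains of subgroups\<close>

context herbrand_galois
begin

lemma card_Gal_ratio:
  assumes E: "subfield E \<Omega>" "K \<subseteq> E" "E \<subseteq> F" and F: "subfield F \<Omega>" "F \<subseteq> M"
  shows "card (Gal E) = dim E F * card (Gal F)"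
proof -
  have EM: "E \<subseteq> M" "K \<subseteq> F" using E F by auto
  note GE = finite_galois_extension_mid[OF galois E(1,2) EM(1)]
    and GF = finite_galois_extension_mid[OF galois F(1) EM(2) F(2)]
  show ?thesis
    using finite_dimension_tower(3)[OF E(1) F(1) galD(2) E(3) F(2) finite_galois_extensionD(4)[OF GE]]
      card_gal(1)[OF GE infinite_extension[OF E(2)]] card_gal(1)[OF GF infinite_extension[OF EM(2)]] by simp
qed

lemma break_points_herbrand:
  assumes E: "subfield E \<Omega>" "K \<subseteq> E" "E \<subseteq> F" and F: "subfield F \<Omega>" "F \<subseteq> M"
  shows "break_points (herbrand \<Omega> K v E F) = max_prod i (Gal F) ` jumps i (Gal F) (Gal E)"
proof -
  have EM: "E \<subseteq> M" "K \<subseteq> F" using E F by auto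
  have "break_points (herbrand \<Omega> K v E F) = break_points (herbrand_in M E F)"
    by (rule break_points_cong) (use herbrand_eq_herbrand_in[OF galois E F] in auto)
  then show ?thesis
    using break_points_herbrand_quotient[OF unit_weight_Gal[OF galois EM(2) F(2)] unit_weight_Gal[OF galois E(2) EM(1)]]
    by simp
qed

text \<open>Break-points are the images of the jumps under an injective function, so there is one
  iff there is one jump. With [F : E] = |Gal E| / |Gal F| the degree condition becomes the
  cardinality equation of the simple step.\<close>

lemma simply_ramified_iff:
  assumes E: "subfield E \<Omega>" "K \<subseteq> E" "E \<subseteq> F" and F: "subfield F \<Omega>" "F \<subseteq> M"
  shows "simply_ramified \<Omega> K v E F \<longleftrightarrow> (\<exists>\<beta>. ramified.simple_step (Gal F) (Gal E) \<beta>)"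
proof -
  have EM: "E \<subseteq> M" "K \<subseteq> F" using E F by auto
  let ?J = "jumps i (Gal F) (Gal E)" and ?f = "max_prod i (Gal F)"
  note SF = subgroup_Gal[OF galois EM(2) F(2)] and SE = subgroup_Gal[OF galois E(2) EM(1)]
  note WF = unit_weight_Gal[OF galois EM(2) F(2)] and WE = unit_weight_Gal[OF galois E(2) EM(1)]
  have sub: "Gal F \<subseteq> Gal E" by (rule carrier_gal_mono[OF E(3)])
  have inj: "inj_on ?f ?J"
    by (rule inj_on_subset[OF inj_on_max_prod[OF WF]]) (auto simp: jumps_def)
  have uniq: "(\<exists>!b. b \<in> break_points (herbrand \<Omega> K v E F)) \<longleftrightarrow> (\<exists>\<beta>. ?J = {\<beta>})"
  proof -
    have "(\<exists>!b. b \<in> A) \<longleftrightarrow> is_singleton A" for A :: "real set"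
      unfolding is_singleton_def by (auto simp: set_eq_iff)
    then have "(\<exists>!b. b \<in> ?f ` ?J) \<longleftrightarrow> is_singleton (?f ` ?J)" .
    also have "\<dots> \<longleftrightarrow> is_singleton ?J"
      by (simp only: is_singleton_altdef card_image[OF inj])
    finally show ?thesis unfolding break_points_herbrand[OF E F] is_singleton_def .
  qed
  have deg: "herbrand_degree (herbrand \<Omega> K v E F) = real (card (below i (Gal E) 1)) / real (card (below i (Gal F) 1))"
    by (rule herbrand_degree_herbrand_quotient[OF WF WE herbrand_eq_herbrand_in[OF galois E F]])
  have pos: "card (below i (Gal F) 1) > 0" "card (Gal F) > 0"
    using subgroup.finite_imp_card_positive[OF ramified.subgroup_level(1)[OF SF zero_less_one] ramified.finite_carrier]
      subgroup.finite_imp_card_positive[OF SF ramified.finite_carrier] .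
  have "herbrand_degree (herbrand \<Omega> K v E F) = real (dim E F) \<longleftrightarrow>
      real (card (below i (Gal E) 1)) = real (dim E F * card (below i (Gal F) 1))"
    unfolding deg using pos(1) by (simp add: divide_eq_eq)
  also have "\<dots> \<longleftrightarrow> card (below i (Gal E) 1) = dim E F * card (below i (Gal F) 1)"
    by (rule of_nat_eq_iff)
  also have "\<dots> \<longleftrightarrow> card (below i (Gal E) 1) * card (Gal F) = dim E F * card (below i (Gal F) 1) * card (Gal F)"
    using pos(2) by simp
  also have "dim E F * card (below i (Gal F) 1) * card (Gal F) = card (Gal E) * card (below i (Gal F) 1)"
    unfolding card_Gal_ratio[OF E F] by simp
  finally have "simply_ramified \<Omega> K v E F \<longleftrightarrow> (\<exists>\<beta>. ?J = {\<beta>}) \<and>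
      card (below i (Gal E) 1) * card (Gal F) = card (Gal E) * card (below i (Gal F) 1)"
    unfolding simply_ramified_def uniq by simp
  moreover have "(\<exists>\<beta>. ?J = {\<beta>}) \<and> card (below i (Gal E) 1) * card (Gal F) = card (Gal E) * card (below i (Gal F) 1)
      \<longleftrightarrow> (\<exists>\<beta>. ramified.simple_step (Gal F) (Gal E) \<beta>)" (is "?A \<longleftrightarrow> ?B")
  proof
    assume ?A
    then show ?B using ramified.simple_step_of_unique_jump[OF SF SE sub] by (elim conjE exE) (rule exI)
  next
    assume ?B
    then obtain \<beta> where "ramified.simple_step (Gal F) (Gal E) \<beta>" ..
    from ramified.simple_step_jumps[OF SF SE this] show ?A by (intro conjI exI)
  qed
  ultimately show ?thesis by simp
qed

text \<open>One \<beta> describes both: the break-point is its value under the function of Gal F,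
  the image of the break-point its value under that of Gal E. Hence neighbouring steps are compared
  through the function of the group they share.\<close>

lemma break_point_herbrand:
  assumes E: "subfield E \<Omega>" "K \<subseteq> E" "E \<subseteq> F" and F: "subfield F \<Omega>" "F \<subseteq> M"
    and st: "ramified.simple_step (Gal F) (Gal E) \<beta>"
  shows "break_point (herbrand \<Omega> K v E F) = max_prod i (Gal F) \<beta>"
    "herbrand \<Omega> K v E F (break_point (herbrand \<Omega> K v E F)) = max_prod i (Gal E) \<beta>"
proof -
  have EM: "E \<subseteq> M" "K \<subseteq> F" using E F by auto
  note SF = subgroup_Gal[OF galois EM(2) F(2)] and SE = subgroup_Gal[OF galois E(2) EM(1)]
  note WF = unit_weight_Gal[OF galois EM(2) F(2)]
  have "break_points (herbrand \<Omega> K v E F) = {max_prod i (Gal F) \<beta>}"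
    unfolding break_points_herbrand[OF E F] ramified.simple_step_jumps(1)[OF SF SE st] by simp
  then show bp: "break_point (herbrand \<Omega> K v E F) = max_prod i (Gal F) \<beta>"
    unfolding break_point_def by simp
  have \<beta>: "\<beta> \<in> {0..1}" using ramified.simple_stepD(1,2)[OF st] by simp
  have "max_prod i (Gal F) \<beta> \<in> {0..1}" using max_prod_image[OF WF] \<beta> by (metis imageI)
  then show "herbrand \<Omega> K v E F (break_point (herbrand \<Omega> K v E F)) = max_prod i (Gal E) \<beta>"
    unfolding bp using herbrand_eq_herbrand_in[OF galois E F] herbrand_quotient_max_prod[OF WF \<beta>] by simp
qed

lemma herbrand_identity_iff:
  assumes E: "subfield E \<Omega>" "K \<subseteq> E" "E \<subseteq> M"
  shows "(\<forall>r\<in>{0..1}. herbrand \<Omega> K v K E r = r) \<longleftrightarrow> (\<forall>\<theta>\<in>Gal K - Gal E. i \<theta> = 1)"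
  using herbrand_quotient_eq_id_iff[OF unit_weight_Gal[OF galois order_refl galD(3)]
      carrier_gal_mono[OF E(2)] unit_weight_Gal[OF galois E(2,3)]]
    herbrand_eq_herbrand_in[OF galois galD(1) order_refl E(2,1,3)] by simp

lemma tower_nth:
  assumes "tower \<Omega> K L Ls" "j < length Ls"
  shows "subfield (Ls ! j) \<Omega>" "K \<subseteq> Ls ! j" "Ls ! j \<subseteq> L"
proof -
  have step: "Ls ! Suc k \<subseteq> Ls ! k" if "Suc k < length Ls" for k using assms(1) that by (simp add: tower_def)
  have mono: "Ls ! b \<subseteq> Ls ! a" if "a \<le> b" "b < length Ls" for a b
    using that
  proof (induction b rule: dec_induct)
    case (step n)
    then show ?case using \<open>\<And>k. Suc k < length Ls \<Longrightarrow> Ls ! Suc k \<subseteq> Ls ! k\<close>[of n] by simp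
  qed simp
  have ne: "Ls \<noteq> []" "hd Ls = L" "K \<subseteq> last Ls" using assms(1) by (simp_all add: tower_def)
  show "subfield (Ls ! j) \<Omega>" using assms by (simp add: tower_def)
  show "Ls ! j \<subseteq> L" using mono[of 0 j] assms(2) ne by (simp add: hd_conv_nth)
  have "last Ls \<subseteq> Ls ! j"
    unfolding last_conv_nth[OF ne(1)] by (rule mono) (use assms(2) in auto)
  then show "K \<subseteq> Ls ! j" using ne(3) by blast
qed

text \<open>The composition telescopes: each step replaces the function of one Galois group in the
  chain by that of the next, at the same parameter s.\<close>

lemma compose_upto_step_herbrand:
  assumes T: "tower \<Omega> K L Ls" and "L \<subseteq> M" and "j < length Ls" and s: "s \<in> {0..1}"
  shows "compose_upto (step_herbrand \<Omega> K v Ls) j (max_prod i (Gal L) s) = max_prod i (Gal (Ls ! j)) s"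
  using assms(3)
proof (induction j)
  case 0
  then show ?case using T by (simp add: tower_def hd_conv_nth)
next
  case (Suc j)
  note 1 = tower_nth[OF T Suc.prems]
  have "j < length Ls" using Suc.prems by simp
  note 0 = tower_nth[OF T this]
  have sub: "Ls ! Suc j \<subseteq> Ls ! j" using T Suc.prems by (simp add: tower_def)
  have jM: "Ls ! j \<subseteq> M" using 0(3) assms(2) by blast
  note W = unit_weight_Gal[OF galois 0(2) jM]
  have "max_prod i (Gal (Ls ! j)) s \<in> {0..1}" using max_prod_image[OF W] s by (metis imageI)
  then show ?case
    using Suc herbrand_eq_herbrand_in[OF galois 1(1,2) sub 0(1) jM] herbrand_quotient_max_prod[OF W s]
    by (simp add: step_herbrand_def)
qed

lemma canonical_tower_iff:
  assumes T: "tower \<Omega> K L Ls" and LM: "L \<subseteq> M"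
  shows "(let n = length Ls - 1; f = step_herbrand \<Omega> K v Ls in
           (\<forall>j<n. simply_ramified \<Omega> K v (Ls ! Suc j) (Ls ! j)) \<and>
           (\<forall>r\<in>{0..1}. herbrand \<Omega> K v K (last Ls) r = r) \<and>
           (\<forall>r\<in>{0..1}. herbrand \<Omega> K v K L r = compose_upto f n r) \<and>
           (\<forall>j. Suc j < n \<longrightarrow> f j (break_point (f j)) < break_point (f (Suc j)))) \<longleftrightarrow>
    (\<exists>b. ramified.canonical_chain (map Gal Ls) b)"
proof -
  define n where "n = length Ls - 1"
  have ne: "Ls \<noteq> []" and len: "length Ls = Suc n" and hd: "Ls ! 0 = L" and last: "last Ls = Ls ! n"
    using T by (auto simp: tower_def n_def hd_conv_nth last_conv_nth)
  have sf: "subfield (Ls ! j) \<Omega>" "K \<subseteq> Ls ! j" "Ls ! j \<subseteq> M" if "j \<le> n" for j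
    using tower_nth[OF T, of j] LM that len by auto
  have sub: "Ls ! Suc j \<subseteq> Ls ! j" if "j < n" for j using T that len by (simp add: tower_def)
  let ?S = "\<lambda>j. Gal (Ls ! j)"
  have sr: "simply_ramified \<Omega> K v (Ls ! Suc j) (Ls ! j) \<longleftrightarrow> (\<exists>\<beta>. ramified.simple_step (?S j) (?S (Suc j)) \<beta>)"
    if "j < n" for j
    using simply_ramified_iff[OF _ _ sub[OF that]] sf[of j] sf[of "Suc j"] that by simp
  have id: "(\<forall>r\<in>{0..1}. herbrand \<Omega> K v K (last Ls) r = r) \<longleftrightarrow> (\<forall>\<theta>\<in>Gal K - Gal (last Ls). i \<theta> = 1)"
    unfolding last by (rule herbrand_identity_iff) (use sf[of n] in auto)
  \<comment> \<open>The steps telescope to the function of Gal K', and the identity Herbrand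
    function of K'/K equates it with that of Gal K.\<close>
  have comp: "\<forall>r\<in>{0..1}. herbrand \<Omega> K v K L r = compose_upto (step_herbrand \<Omega> K v Ls) n r"
    if I: "\<forall>r\<in>{0..1}. herbrand \<Omega> K v K (last Ls) r = r"
  proof
    fix r :: real assume r: "r \<in> {0..1}"
    have L: "subfield L \<Omega>" "K \<subseteq> L" using sf[of 0] hd by auto
    note W = unit_weight_Gal[OF galois L(2) LM] and Wn = unit_weight_Gal[OF galois sf(2,3)[OF order_refl]]
    obtain s where s: "s \<in> {0..1}" "r = max_prod i (Gal L) s"
      using max_prod_image[OF W] r by (metis imageE)
    have n: "max_prod i (?S n) s \<in> {0..1}" using max_prod_image[OF Wn] s(1) by (metis imageI)
    have "herbrand \<Omega> K v K L r = max_prod i (Gal K) s"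
      using herbrand_eq_herbrand_in[OF galois galD(1) order_refl L(2,1) LM r]
        herbrand_quotient_max_prod[OF W s(1)] s(2) by simp
    also have "\<dots> = herbrand \<Omega> K v K (last Ls) (max_prod i (?S n) s)"
      using herbrand_eq_herbrand_in[OF galois galD(1) order_refl sf(2,1,3)[OF order_refl] n]
        herbrand_quotient_max_prod[OF Wn s(1)] last by simp
    also have "\<dots> = max_prod i (?S n) s" using I n by blast
    also have "\<dots> = compose_upto (step_herbrand \<Omega> K v Ls) n r"
      using compose_upto_step_herbrand[OF T LM _ s(1), of n] len s(2) by simp
    finally show "herbrand \<Omega> K v K L r = compose_upto (step_herbrand \<Omega> K v Ls) n r" .
  qed
  \<comment> \<open>Both sides are values of the increasing function of the group with index j + 1,
    which ends step j and begins step j + 1.\<close>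
  have br: "step_herbrand \<Omega> K v Ls j (break_point (step_herbrand \<Omega> K v Ls j)) <
      break_point (step_herbrand \<Omega> K v Ls (Suc j)) \<longleftrightarrow> b j < b (Suc j)"
    if j: "Suc j < n" and st: "\<And>j. j < n \<Longrightarrow> ramified.simple_step (?S j) (?S (Suc j)) (b j)" for j b
  proof -
    have j': "j < n" "j \<le> n" "Suc j \<le> n" "Suc (Suc j) \<le> n" using j by simp_all
    note st0 = st[OF j'(1)] and st1 = st[OF j]
    have "step_herbrand \<Omega> K v Ls j (break_point (step_herbrand \<Omega> K v Ls j)) = max_prod i (?S (Suc j)) (b j)"
      unfolding step_herbrand_def
      by (rule break_point_herbrand(2)[OF sf(1,2)[OF j'(3)] sub[OF j'(1)] sf(1,3)[OF j'(2)] st0])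
    moreover have "break_point (step_herbrand \<Omega> K v Ls (Suc j)) = max_prod i (?S (Suc j)) (b (Suc j))"
      unfolding step_herbrand_def
      by (rule break_point_herbrand(1)[OF sf(1,2)[OF j'(4)] sub[OF j] sf(1,3)[OF j'(3)] st1])
    ultimately show ?thesis
      using max_prod_less_iff[OF unit_weight_Gal[OF galois sf(2,3)[OF j'(3)]], of "b j" "b (Suc j)"]
        ramified.simple_stepD(1)[OF st0] ramified.simple_stepD(1)[OF st1] by simp
  qed
  have subgr: "\<forall>S\<in>set (map Gal Ls). subgroup S (gal \<Omega> K M)"
    using sf(2,3) subgroup_Gal[OF galois] len by (auto simp: in_set_conv_nth less_Suc_eq_le)
  have chain: "ramified.canonical_chain (map Gal Ls) b \<longleftrightarrow>
     (\<forall>j<n. ramified.simple_step (?S j) (?S (Suc j)) (b j)) \<and> (\<forall>j. Suc j < n \<longrightarrow> b j < b (Suc j)) \<and>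
     (\<forall>\<theta>\<in>Gal K - Gal (last Ls). i \<theta> = 1)" for b
  proof -
    have "(\<forall>j. Suc j < length (map Gal Ls) \<longrightarrow>
        ramified.simple_step (map Gal Ls ! j) (map Gal Ls ! Suc j) (b j)) \<longleftrightarrow>
        (\<forall>j<n. ramified.simple_step (?S j) (?S (Suc j)) (b j))"
      by (simp add: len)
    then show ?thesis
      unfolding ramified.canonical_chain_def using subgr ne last_map[OF ne, of Gal] by (simp add: len)
  qed
  show ?thesis
    unfolding Let_def n_def[symmetric]
  proof (intro iffI; (elim conjE exE)?)
    assume sr': "\<forall>j<n. simply_ramified \<Omega> K v (Ls ! Suc j) (Ls ! j)"
      and id': "\<forall>r\<in>{0..1}. herbrand \<Omega> K v K (last Ls) r = r"
      and br': "\<forall>j. Suc j < n \<longrightarrow> step_herbrand \<Omega> K v Ls j (break_point (step_herbrand \<Omega> K v Ls j)) <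
        break_point (step_herbrand \<Omega> K v Ls (Suc j))"
    define b where "b j = (SOME \<beta>. ramified.simple_step (?S j) (?S (Suc j)) \<beta>)" for j
    have b: "ramified.simple_step (?S j) (?S (Suc j)) (b j)" if "j < n" for j
    proof -
      have "\<exists>\<beta>. ramified.simple_step (?S j) (?S (Suc j)) \<beta>" using sr'[rule_format, OF that] sr[OF that] by simp
      then show ?thesis unfolding b_def by (rule someI_ex)
    qed
    have "b j < b (Suc j)" if "Suc j < n" for j using br'[rule_format, OF that] br[OF that b] by simp
    then have "ramified.canonical_chain (map Gal Ls) b" unfolding chain using b id' id by simp
    then show "\<exists>b. ramified.canonical_chain (map Gal Ls) b" by (rule exI[of _ b])
  next
    fix b assume "ramified.canonical_chain (map Gal Ls) b"
    then have b: "\<And>j. j < n \<Longrightarrow> ramified.simple_step (?S j) (?S (Suc j)) (b j)"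
      and inc: "\<And>j. Suc j < n \<Longrightarrow> b j < b (Suc j)" and one: "\<forall>\<theta>\<in>Gal K - Gal (last Ls). i \<theta> = 1"
      unfolding chain by simp_all
    have I: "\<forall>r\<in>{0..1}. herbrand \<Omega> K v K (last Ls) r = r" using one id by simp
    show "(\<forall>j<n. simply_ramified \<Omega> K v (Ls ! Suc j) (Ls ! j)) \<and>
       (\<forall>r\<in>{0..1}. herbrand \<Omega> K v K (last Ls) r = r) \<and>
       (\<forall>r\<in>{0..1}. herbrand \<Omega> K v K L r = compose_upto (step_herbrand \<Omega> K v Ls) n r) \<and>
       (\<forall>j. Suc j < n \<longrightarrow> step_herbrand \<Omega> K v Ls j (break_point (step_herbrand \<Omega> K v Ls j)) <
          break_point (step_herbrand \<Omega> K v Ls (Suc j)))"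
    proof (intro conjI I comp[OF I] allI impI)
      fix j
      show "simply_ramified \<Omega> K v (Ls ! Suc j) (Ls ! j)" if "j < n"
        using sr[OF that] b[OF that] by blast
      show "step_herbrand \<Omega> K v Ls j (break_point (step_herbrand \<Omega> K v Ls j)) <
          break_point (step_herbrand \<Omega> K v Ls (Suc j))" if "Suc j < n"
        using br[OF that b] inc[OF that] by simp
    qed
  qed
qed

lemma Gal_inj:
  assumes "subfield E \<Omega>" "K \<subseteq> E" "E \<subseteq> M" "subfield F \<Omega>" "K \<subseteq> F" "F \<subseteq> M" "Gal E = Gal F"
  shows "E = F"
proof -
  have "E = fixed_field M (Gal E)"
    using fixed_field_gal[OF finite_galois_extension_mid[OF galois assms(1-3)] infinite_extension[OF assms(2)]] by (rule sym)
  also have "\<dots> = fixed_field M (Gal F)" by (rule arg_cong[OF assms(7)])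
  also have "\<dots> = F"
    by (rule fixed_field_gal[OF finite_galois_extension_mid[OF galois assms(4-6)] infinite_extension[OF assms(5)]])
  finally show ?thesis .
qed

text \<open>The tower consists of the fixed fields of the chain starting at Gal L;
  \<open>gal_fixed_field\<close> recovers each group from its fixed field, so the chain conditions
  carry over.\<close>

lemma canonical_tower_exists:
  assumes L: "subfield L \<Omega>" "K \<subseteq> L" "L \<subseteq> M"
  shows "\<exists>Ls b. tower \<Omega> K L Ls \<and> ramified.canonical_chain (map Gal Ls) b"
proof -
  obtain Ss b where C: "ramified.canonical_chain (Gal L # Ss) b"
    using ramified.canonical_chain_exists[OF subgroup_Gal[OF galois L(2,3)]] by blast
  let ?Ss = "Gal L # Ss"
  define Ls where "Ls = map (fixed_field M) ?Ss"
  have sg: "subgroup S (gal \<Omega> K M)" if "S \<in> set ?Ss" for S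
    using C that unfolding ramified.canonical_chain_def by blast
  have map: "map Gal Ls = ?Ss"
    unfolding Ls_def map_map
  proof (rule map_idI)
    fix S assume "S \<in> set ?Ss"
    from gal_fixed_field[OF galois infinite_extension[OF order_refl] sg[OF this]]
    show "(Gal \<circ> fixed_field M) S = S" by (simp only: comp_apply)
  qed
  have "tower \<Omega> K L Ls"
    unfolding tower_def
  proof (intro conjI ballI allI impI)
    show "Ls \<noteq> []" by (simp add: Ls_def)
    show "hd Ls = L"
      using fixed_field_gal[OF finite_galois_extension_mid[OF galois L] infinite_extension[OF L(2)]]
      by (simp add: Ls_def)
    show "subfield E \<Omega>" if E: "E \<in> set Ls" for E
    proof -
      obtain S where "S \<in> set ?Ss" "E = fixed_field M S" using E unfolding Ls_def by auto
      then show ?thesis using subfield_fixed_field[OF galD(2) subgroup.subset[OF sg]] by simp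
    qed
    show "Ls ! Suc j \<subseteq> Ls ! j" if j: "Suc j < length Ls" for j
    proof -
      have j': "Suc j < length ?Ss" using j by (simp add: Ls_def)
      then have "ramified.simple_step (?Ss ! j) (?Ss ! Suc j) (b j)"
        using C unfolding ramified.canonical_chain_def by blast
      from ramified.simple_step_subset[OF this sg[OF nth_mem[OF Suc_lessD[OF j']]] sg[OF nth_mem[OF j']]]
      have "?Ss ! j \<subseteq> ?Ss ! Suc j" .
      then have "fixed_field M (?Ss ! Suc j) \<subseteq> fixed_field M (?Ss ! j)"
        unfolding fixed_field_def by blast
      then show ?thesis using j' unfolding Ls_def by (simp only: nth_map Suc_lessD)
    qed
    have "last Ls = fixed_field M (last ?Ss)" unfolding Ls_def by (rule last_map) simp
    moreover have "K \<subseteq> fixed_field M (last ?Ss)"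
    proof
      fix x assume x: "x \<in> K"
      have "last ?Ss \<in> set ?Ss" by (rule last_in_set) simp
      then have "\<theta> x = x" if "\<theta> \<in> last ?Ss" for \<theta>
        using gal_memD(3)[OF subgroup.mem_carrier[OF sg that] x] by simp
      then show "x \<in> fixed_field M (last ?Ss)" using x galD(3) unfolding fixed_field_def by blast
    qed
    ultimately show "K \<subseteq> last Ls" by simp
  qed
  then show ?thesis using C map by (intro exI[of _ Ls] exI[of _ b]) simp
qed

lemma canonical_tower_unique:
  assumes T: "tower \<Omega> K L Ls" "tower \<Omega> K L Ls'" and LM: "L \<subseteq> M"
    and C: "ramified.canonical_chain (map Gal Ls) b" "ramified.canonical_chain (map Gal Ls') b'"
  shows "Ls = Ls'"
proof -
  obtain Es Es' where Es: "Ls = L # Es" "Ls' = L # Es'"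
    using T by (metis list.collapse tower_def)
  have "map Gal Ls = map Gal Ls'"
    using ramified.canonical_chain_unique C unfolding Es list.map by blast
  moreover have "inj_on Gal (set Ls \<union> set Ls')"
  proof (rule inj_onI)
    have mid: "subfield E \<Omega>" "K \<subseteq> E" "E \<subseteq> M" if E: "E \<in> set Ls \<union> set Ls'" for E
    proof -
      obtain Es where Es: "tower \<Omega> K L Es" "E \<in> set Es" using E T by blast
      then obtain j where "j < length Es" "E = Es ! j" by (metis in_set_conv_nth)
      then show "subfield E \<Omega>" "K \<subseteq> E" "E \<subseteq> M" using tower_nth[OF Es(1)] LM by blast+
    qed
    fix E F assume "E \<in> set Ls \<union> set Ls'" "F \<in> set Ls \<union> set Ls'" "Gal E = Gal F"
    then show "E = F" using Gal_inj mid by presburger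
  qed
  ultimately show ?thesis by (rule map_inj_on)
qed

end

theorem theorem2p11:
  fixes \<Omega> :: "('a, 'b) ring_scheme" and K L :: "'a set" and v :: "'a \<Rightarrow> real"
  assumes "algebraic_closure \<Omega> K"
    and "herbrand_field \<Omega> K v"
    and "\<And>E. finite_separable_extension \<Omega> K E \<Longrightarrow> herbrand_field \<Omega> E (ext_norm \<Omega> K v E)"
    and "finite_separable_extension \<Omega> K L"
  shows "\<exists>!Ls. tower \<Omega> K L Ls \<and>
           (let n = length Ls - 1; f = step_herbrand \<Omega> K v Ls in
             (\<forall>i<n. simply_ramified \<Omega> K v (Ls ! Suc i) (Ls ! i)) \<and>
             (\<forall>r\<in>{0..1}. herbrand \<Omega> K v K (last Ls) r = r) \<and>
             (\<forall>r\<in>{0..1}. herbrand \<Omega> K v K L r = compose_upto f n r) \<and>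
             (\<forall>i. Suc i < n \<longrightarrow> f i (break_point (f i)) < break_point (f (Suc i))))"
proof -
  interpret algebraic_closure \<Omega> K by fact
  have base: "herbrand_base \<Omega> K v"
    by (intro herbrand_base.intro herbrand_base_axioms.intro) (use assms in auto)
  define M where "M = galois_closure \<Omega> K L"
  \<comment> \<open>That the intersection defining \<open>galois_closure\<close> is itself a finite
    Galois extension is contained in L being a Herbrand extension.\<close>
  have "herbrand_extension \<Omega> K v L" using assms(2,4) by (simp add: herbrand_field_def)
  then have MG: "finite_galois_extension \<Omega> K M"
    by (simp add: herbrand_extension_def galois_herbrand_extension_def M_def)
  interpret herbrand_galois \<Omega> K v M
    by (intro herbrand_galois.intro base herbrand_galois_axioms.intro MG)
  have LM: "L \<subseteq> M" by (auto simp: M_def galois_closure_def)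
  have L: "subfield L \<Omega>" "K \<subseteq> L"
    using assms(4) by (auto simp: finite_separable_extension_def Defs.finite_extension_def)
  obtain Ls b where Ls: "tower \<Omega> K L Ls" "ramified.canonical_chain (map Gal Ls) b"
    using canonical_tower_exists[OF L LM] by blast
  show ?thesis
  proof (rule ex1I[of _ Ls])
    show "tower \<Omega> K L Ls \<and>
           (let n = length Ls - 1; f = step_herbrand \<Omega> K v Ls in
             (\<forall>i<n. simply_ramified \<Omega> K v (Ls ! Suc i) (Ls ! i)) \<and>
             (\<forall>r\<in>{0..1}. herbrand \<Omega> K v K (last Ls) r = r) \<and>
             (\<forall>r\<in>{0..1}. herbrand \<Omega> K v K L r = compose_upto f n r) \<and>
             (\<forall>i. Suc i < n \<longrightarrow> f i (break_point (f i)) < break_point (f (Suc i))))"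
      using canonical_tower_iff[OF Ls(1) LM] Ls by blast
  next
    fix Ls'
    assume T': "tower \<Omega> K L Ls' \<and>
           (let n = length Ls' - 1; f = step_herbrand \<Omega> K v Ls' in
             (\<forall>i<n. simply_ramified \<Omega> K v (Ls' ! Suc i) (Ls' ! i)) \<and>
             (\<forall>r\<in>{0..1}. herbrand \<Omega> K v K (last Ls') r = r) \<and>
             (\<forall>r\<in>{0..1}. herbrand \<Omega> K v K L r = compose_upto f n r) \<and>
             (\<forall>i. Suc i < n \<longrightarrow> f i (break_point (f i)) < break_point (f (Suc i))))"
    then obtain b' where "ramified.canonical_chain (map Gal Ls') b'"
      using canonical_tower_iff[OF _ LM, of Ls'] by blast
    then show "Ls' = Ls"
      using canonical_tower_unique[OF _ Ls(1) LM _ Ls(2), of Ls'] T' by blast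
  qed
qed

end
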